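(* Let $(X,\mathrm{d})$ be a non-empty compact metric space and let $\{\varepsilon_n,A_n\}_{n\in\mathbb{N}}$ be an adjusted approximative sequence of $X$. Then every polyhedral approximative sequence of $X$ is an HPol-expansion of $X$. That is, each of the following inverse sequences (all defined in the context from $\{\varepsilon_n,A_n\}$) is an HPol-expansion of $X$: (1) the Alexandroff-McCord approximative sequence $\mathcal{K}(X)=\{|\mathcal{K}(U_{2\varepsilon_n}(A_n))|,|p_{n,n+1}|\}$; (2) the Vietoris-Rips sequence of the approximations $\mathcal{M}(X)=\{|\mathcal{R}_{2\varepsilon_n}(A_n)|,|p^*_{n,n+1}|\}$; (3) the Čech approximative sequence $\check{\mathcal{C}}_A(X)=\{|\mathcal{N}(B_n)|,|p_{B_n,B_{n+1}}|\}$; (4) the witness approximative sequence $\mathcal{W}(X)=\{|\mathcal{W}_n|,|\omega_{n,n+1}|\}$; (5) the upper Dowker approximative sequence $\mathcal{D}_u(X)=\{|K^{X_n}|,|p^K_{n,n+1}|\}$; (6) the lower Dowker approximative sequence $\mathcal{D}_l(X)=\{|L^{X_n}|,|p^L_{n,n+1}|\}$.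
   Context: **Adjusted approximative sequences.** Let $(X,\mathrm{d})$ be a compact metric space. For $\varepsilon>0$, a finite set $A\subset X$ is an $\varepsilon$-approximation of $X$ if for every $x\in X$ there is $a\in A$ with $\mathrm{d}(x,a)<\varepsilon$. An adjusted approximative sequence $\{\varepsilon_n,A_n\}_{n\in\mathbb{N}}$ consists of a decreasing sequence of positive reals $\varepsilon_n$ tending to $0$ and finite sets $A_n\subset X$ such that, for every $n$, $A_n$ is an $\varepsilon_n$-approximation of $X$ and $\varepsilon_{n+1}<\frac{\varepsilon_n-\gamma_n}{2}$, where $\gamma_n=\sup\{\mathrm{d}(x,A_n):x\in X\}<\varepsilon_n$. For $x\in X$ put $q_{A_n}(x)=\{a\in A_n:\mathrm{d}(x,a)=\mathrm{d}(x,A_n)\}$, and for $C\subset X$ put $q_{A_n}(C)=\bigcup_{c\in C}q_{A_n}(c)$. **Finite spaces.** $X_n=U_{2\varepsilon_n}(A_n)=\{C\subset A_n: C\neq\emptyset,\ \mathrm{diam}(C)<2\varepsilon_n\}$, partially ordered by inclusion. The map $p_{n,n+1}:U_{2\varepsilon_{n+1}}(A_{n+1})\to U_{2\varepsilon_n}(A_n)$, $p_{n,n+1}(C)=q_{A_n}(C)$, is well defined and order preserving. **Conventions.** $|K|$ denotes the geometric realization of a simplicial complex $K$, and $|g|$ the realization of a simplicial map $g$. All inverse sequences are regarded as inverse sequences in the homotopy category: bonding maps are homotopy classes. When a simplicial map below involves the choice of an element $b\in q_{A_n}(a)$, any choice is allowed; the homotopy class of its realization does not depend on the choices. **The sequences.**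 (1) $\mathcal{K}(U_{2\varepsilon_n}(A_n))$ is the simplicial complex with vertex set $U_{2\varepsilon_n}(A_n)$ whose simplices are the finite non-empty chains $D_0\subset D_1\subset\dots\subset D_s$. The bonding simplicial map, again denoted $p_{n,n+1}$, is induced on vertices by $D\mapsto p_{n,n+1}(D)$. (2) $\mathcal{R}_{2\varepsilon_n}(A_n)$ is the simplicial complex with vertex set $A_n$ whose simplices are the non-empty subsets of $A_n$ of diameter $<2\varepsilon_n$. The bonding simplicial map $p^*_{n,n+1}:\mathcal{R}_{2\varepsilon_{n+1}}(A_{n+1})\to\mathcal{R}_{2\varepsilon_n}(A_n)$ sends a vertex $a$ to some $b\in q_{A_n}(a)$. (3) $B_n=\{B_n(a):a\in A_n\}$ is the covering of $X$ by the open balls $B_n(a)=\{x\in X:\mathrm{d}(x,a)<\varepsilon_n\}$, and $\mathcal{N}(B_n)$ is its nerve: vertices are the members of $B_n$, and a finite non-empty set of members is a simplex if and only if their intersection is non-empty. The bonding simplicial map $p_{B_n,B_{n+1}}:\mathcal{N}(B_{n+1})\to\mathcal{N}(B_n)$ sends $B_{n+1}(a)$ to $B_n(b)$ for some $b\in q_{A_n}(a)$. (4) $\mathcal{W}_n$ is the simplicial complex with vertex set $A_n$ whose simplices are the non-empty sets $\{a_0,\dots,a_s\}\subset A_n$ such that for every non-empty subset $\{a_{i_0},\dots,a_{i_r}\}$ (of $r+1$ elements) there exists $x\in X$ with $\sum_{j=0}^r\mathrm{d}(x,a_{i_j})<(r+1)\varepsilon_n$. The bonding simplicial map $\omega_{n,n+1}:\mathcal{W}_{n+1}\to\mathcal{W}_n$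 sends a vertex $a$ to some $b\in q_{A_n}(a)$. (5) $K^{X_n}$ is the simplicial complex with vertex set $X_n$ in which a finite non-empty set $\{C_0,\dots,C_r\}$ is a simplex if and only if there is $D\in X_n$ with $C_i\subset D$ for all $i$. The bonding simplicial map is $p^K_{n,n+1}(C)=p_{n,n+1}(C)$ on vertices. (6) $L^{X_n}$ is the simplicial complex with vertex set $X_n$ in which a finite non-empty set $\{D_0,\dots,D_s\}$ is a simplex if and only if there is $C\in X_n$ with $C\subset D_i$ for all $i$. The bonding simplicial map is $p^L_{n,n+1}(C)=p_{n,n+1}(C)$ on vertices. A polyhedral approximative sequence of $X$ is any of these inverse sequences, for any adjusted approximative sequence of $X$. **HPol-expansions.** HTop is the category of topological spaces and homotopy classes of continuous maps; HPol is its full subcategory of spaces homotopy equivalent to polyhedra (realizations of simplicial complexes). For a category $\mathcal{C}$, pro-$\mathcal{C}$ has as objects the inverse systems $(Y_\mu,q_{\mu\mu'},M)$ in $\mathcal{C}$ over directed sets, with $\mathrm{Hom}(\mathbf{X},\mathbf{Y})=\varprojlim_\mu\varinjlim_\lambda \mathcal{C}(X_\lambda,Y_\mu)$; an object $X$ of $\mathcal{C}$ is regarded as an inverse system all of whose terms are $X$ and whose bonding maps are identities. An inverse system $\mathbf{X}$ in HPol is an HPol-expansion of $X$ if there is a morphism $\mathbf{p}:X\to\mathbf{X}$ in pro-HTop such that for every inverse system $\mathbf{Y}$ in HPol and every morphism $\mathbf{h}:X\to\mathbf{Y}$ in pro-HTop there is a unique morphism $\mathbf{f}:\mathbf{X}\to\mathbf{Y}$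 in pro-HPol with $\mathbf{f}\mathbf{p}=\mathbf{h}$. *)

theory Defs
  imports "HOL-Analysis.Analysis"
begin

section \<open>The homotopy category\<close>

text \<open>A morphism of HTop is a homotopy class, represented as a set of maps. Since
  \<open>homotopic_with\<close> only looks at values on the carrier of the source, so do the classes.\<close>

definition hclass :: "'a topology \<Rightarrow> 'b topology \<Rightarrow> ('a \<Rightarrow> 'b) \<Rightarrow> ('a \<Rightarrow> 'b) set" where
  "hclass X Y f = {g. homotopic_with (\<lambda>_. True) X Y f g}"

definition HTop_hom :: "'a topology \<Rightarrow> 'b topology \<Rightarrow> ('a \<Rightarrow> 'b) set set" where
  "HTop_hom X Y = hclass X Y ` {f. continuous_map X Y f}"

text \<open>\<open>hcomp X Z G F\<close> is the composite of \<open>F\<close> from \<open>X\<close> to some \<open>Y\<close> and \<open>G\<close> from \<open>Y\<close> to \<open>Z\<close>.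
  The union is over a single class, as composition respects homotopy.\<close>

definition hcomp ::
  "'a topology \<Rightarrow> 'c topology \<Rightarrow> ('b \<Rightarrow> 'c) set \<Rightarrow> ('a \<Rightarrow> 'b) set \<Rightarrow> ('a \<Rightarrow> 'c) set" where
  "hcomp X Z G F = (\<Union>g\<in>G. \<Union>f\<in>F. hclass X Z (g \<circ> f))"

section \<open>Inverse systems in HTop and their morphisms\<close>

text \<open>\<open>bond S i j\<close> is the bonding morphism from \<open>space_at S j\<close> to \<open>space_at S i\<close>, meaningful
  for \<open>i \<le> j\<close> in the index set.\<close>

record ('i, 's) inv_system =
  idx :: "'i set"
  ile :: "'i \<Rightarrow> 'i \<Rightarrow> bool"
  space_at :: "'i \<Rightarrow> 's topology"
  bond :: "'i \<Rightarrow> 'i \<Rightarrow> ('s \<Rightarrow> 's) set"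

definition directed_set :: "'i set \<Rightarrow> ('i \<Rightarrow> 'i \<Rightarrow> bool) \<Rightarrow> bool" where
  "directed_set I le \<longleftrightarrow> I \<noteq> {} \<and>
     (\<forall>i\<in>I. le i i) \<and>
     (\<forall>i\<in>I. \<forall>j\<in>I. \<forall>k\<in>I. le i j \<longrightarrow> le j k \<longrightarrow> le i k) \<and>
     (\<forall>i\<in>I. \<forall>j\<in>I. \<exists>k\<in>I. le i k \<and> le j k)"

definition inverse_system :: "('i, 's) inv_system \<Rightarrow> bool" where
  "inverse_system S \<longleftrightarrow> directed_set (idx S) (ile S) \<and>
     (\<forall>i\<in>idx S. \<forall>j\<in>idx S. ile S i j \<longrightarrow>
        bond S i j \<in> HTop_hom (space_at S j) (space_at S i)) \<and>
     (\<forall>i\<in>idx S. bond S i i = hclass (space_at S i) (space_at S i) id) \<and>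
     (\<forall>i\<in>idx S. \<forall>j\<in>idx S. \<forall>k\<in>idx S. ile S i j \<longrightarrow> ile S j k \<longrightarrow>
        hcomp (space_at S k) (space_at S i) (bond S i j) (bond S j k) = bond S i k)"

definition const_system :: "'a topology \<Rightarrow> (unit, 'a) inv_system" where
  "const_system X = \<lparr> idx = UNIV, ile = (\<lambda>_ _. True), space_at = (\<lambda>_. X),
     bond = (\<lambda>_ _. hclass X X id) \<rparr>"

text \<open>The colimit over \<open>i\<close> of \<open>HTop(S i, Y)\<close> is the set of equivalence classes of pairs
  \<open>(i, F)\<close>, where \<open>F\<close> is a morphism from \<open>S i\<close> to \<open>Y\<close> and two pairs are identified if they
  become equal after composition with bonding morphisms of \<open>S\<close>. \<open>germ S Y i F\<close> is the class
  of \<open>(i, F)\<close>.\<close>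

definition germ ::
  "('i, 's) inv_system \<Rightarrow> 't topology \<Rightarrow> 'i \<Rightarrow> ('s \<Rightarrow> 't) set \<Rightarrow> ('i \<times> ('s \<Rightarrow> 't) set) set" where
  "germ S Y i F = {(j, G). j \<in> idx S \<and> G \<in> HTop_hom (space_at S j) Y \<and>
     (\<exists>k\<in>idx S. ile S i k \<and> ile S j k \<and>
        hcomp (space_at S k) Y F (bond S i k) = hcomp (space_at S k) Y G (bond S j k))}"

definition colim_hom ::
  "('i, 's) inv_system \<Rightarrow> 't topology \<Rightarrow> ('i \<times> ('s \<Rightarrow> 't) set) set set" where
  "colim_hom S Y = {germ S Y i F | i F. i \<in> idx S \<and> F \<in> HTop_hom (space_at S i) Y}"

text \<open>Post-composition of an element of \<open>colim_hom S Y\<close> with a morphism \<open>Q\<close> from \<open>Y\<close> to \<open>Z\<close>.\<close>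

definition colim_push ::
  "('i, 's) inv_system \<Rightarrow> 'u topology \<Rightarrow> ('t \<Rightarrow> 'u) set \<Rightarrow> ('i \<times> ('s \<Rightarrow> 't) set) set \<Rightarrow>
   ('i \<times> ('s \<Rightarrow> 'u) set) set" where
  "colim_push S Z Q \<xi> = (\<Union>(i, F)\<in>\<xi>. germ S Z i (hcomp (space_at S i) Z Q F))"

text \<open>The limit over \<open>j\<close> of \<open>colim_hom S (T j)\<close>, as compatible families (extended by
  \<open>undefined\<close> outside the index set of \<open>T\<close>, so that equality of morphisms is equality).\<close>

definition pro_hom ::
  "('i, 's) inv_system \<Rightarrow> ('j, 't) inv_system \<Rightarrow> ('j \<Rightarrow> ('i \<times> ('s \<Rightarrow> 't) set) set) set" where
  "pro_hom S T = {\<phi> \<in> (\<Pi>\<^sub>E j\<in>idx T. colim_hom S (space_at T j)).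
     \<forall>j\<in>idx T. \<forall>j'\<in>idx T. ile T j j' \<longrightarrow>
       colim_push S (space_at T j) (bond T j j') (\<phi> j') = \<phi> j}"

definition pro_comp ::
  "('i, 's) inv_system \<Rightarrow> ('k, 'u) inv_system \<Rightarrow>
   ('k \<Rightarrow> ('j \<times> ('t \<Rightarrow> 'u) set) set) \<Rightarrow> ('j \<Rightarrow> ('i \<times> ('s \<Rightarrow> 't) set) set) \<Rightarrow>
   ('k \<Rightarrow> ('i \<times> ('s \<Rightarrow> 'u) set) set)" where
  "pro_comp S U \<psi> \<phi> =
     (\<lambda>k\<in>idx U. \<Union>(j, G)\<in>\<psi> k. colim_push S (space_at U k) G (\<phi> j))"

section \<open>Polyhedra\<close>

definition simplicial_complex :: "'v set set \<Rightarrow> bool" where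
  "simplicial_complex K \<longleftrightarrow> (\<forall>\<sigma>\<in>K. finite \<sigma> \<and> \<sigma> \<noteq> {} \<and> (\<forall>\<tau>. \<tau> \<subseteq> \<sigma> \<longrightarrow> \<tau> \<noteq> {} \<longrightarrow> \<tau> \<in> K))"

definition closed_face :: "'v set \<Rightarrow> ('v \<Rightarrow> real) set" where
  "closed_face \<sigma> = {t. (\<forall>v. 0 \<le> t v) \<and> (\<forall>v. v \<notin> \<sigma> \<longrightarrow> t v = 0) \<and> (\<Sum>v\<in>\<sigma>. t v) = 1}"

text \<open>Points of the realization are barycentric coordinates; the topology is the weak one
  determined by the closed faces, each of which has its Euclidean topology.\<close>

definition realization :: "'v set set \<Rightarrow> ('v \<Rightarrow> real) topology" where
  "realization K = topology (\<lambda>U. U \<subseteq> (\<Union>\<sigma>\<in>K. closed_face \<sigma>) \<and>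
     (\<forall>\<sigma>\<in>K. openin (top_of_set (closed_face \<sigma>)) (U \<inter> closed_face \<sigma>)))"

lemma openin_realization:
  "openin (realization K) U \<longleftrightarrow> U \<subseteq> (\<Union>\<sigma>\<in>K. closed_face \<sigma>) \<and>
     (\<forall>\<sigma>\<in>K. openin (top_of_set (closed_face \<sigma>)) (U \<inter> closed_face \<sigma>))"
proof -
  have "istopology (\<lambda>U. U \<subseteq> (\<Union>\<sigma>\<in>K. closed_face \<sigma>) \<and>
     (\<forall>\<sigma>\<in>K. openin (top_of_set (closed_face \<sigma>)) (U \<inter> closed_face \<sigma>)))" (is "istopology ?P")
    unfolding istopology_def
  proof (intro conjI allI impI)
    fix S T assume "?P S" "?P T"
    moreover have "S \<inter> T \<inter> F = (S \<inter> F) \<inter> (T \<inter> F)" for F by blast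
    ultimately show "S \<inter> T \<subseteq> (\<Union>\<sigma>\<in>K. closed_face \<sigma>)"
      and "\<forall>\<sigma>\<in>K. openin (top_of_set (closed_face \<sigma>)) (S \<inter> T \<inter> closed_face \<sigma>)"
      by (auto intro: openin_Int)
  next
    fix \<U> assume \<U>: "\<forall>U\<in>\<U>. ?P U"
    then show "\<Union>\<U> \<subseteq> (\<Union>\<sigma>\<in>K. closed_face \<sigma>)" by blast
    show "\<forall>\<sigma>\<in>K. openin (top_of_set (closed_face \<sigma>)) (\<Union>\<U> \<inter> closed_face \<sigma>)"
    proof
      fix \<sigma> assume "\<sigma> \<in> K"
      with \<U> have "openin (top_of_set (closed_face \<sigma>)) (\<Union>U\<in>\<U>. U \<inter> closed_face \<sigma>)"
        by (intro openin_Union) blast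
      then show "openin (top_of_set (closed_face \<sigma>)) (\<Union>\<U> \<inter> closed_face \<sigma>)"
        by (simp only: Int_Union2)
    qed
  qed
  then show ?thesis by (simp add: realization_def)
qed

lemma topspace_realization: "topspace (realization K) = (\<Union>\<sigma>\<in>K. closed_face \<sigma>)"
proof (rule antisym)
  show "topspace (realization K) \<subseteq> (\<Union>\<sigma>\<in>K. closed_face \<sigma>)"
    using openin_topspace[of "realization K"] unfolding openin_realization by blast
  have "openin (realization K) (\<Union>\<sigma>\<in>K. closed_face \<sigma>)"
    unfolding openin_realization
  proof (intro conjI ballI subset_refl)
    fix \<sigma> assume "\<sigma> \<in> K"
    then have "(\<Union>\<sigma>\<in>K. closed_face \<sigma>) \<inter> closed_face \<sigma> = closed_face \<sigma>" by blast
    then show "openin (top_of_set (closed_face \<sigma>)) ((\<Union>\<sigma>\<in>K. closed_face \<sigma>) \<inter> closed_face \<sigma>)"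
      by simp
  qed
  then show "(\<Union>\<sigma>\<in>K. closed_face \<sigma>) \<subseteq> topspace (realization K)" by (rule openin_subset)
qed

definition realization_map :: "('v \<Rightarrow> 'w) \<Rightarrow> ('v \<Rightarrow> real) \<Rightarrow> ('w \<Rightarrow> real)" where
  "realization_map g t = (\<lambda>w. \<Sum>v | t v \<noteq> 0 \<and> g v = w. t v)"

text \<open>The type argument is the type from which the vertices of the polyhedra are taken.\<close>

definition in_HPol :: "'v itself \<Rightarrow> 'a topology \<Rightarrow> bool" where
  "in_HPol _ Y \<longleftrightarrow>
     (\<exists>K::'v set set. simplicial_complex K \<and> Y homotopy_equivalent_space (realization K))"

definition HPol_system :: "'v itself \<Rightarrow> ('i, 's) inv_system \<Rightarrow> bool" where
  "HPol_system V S \<longleftrightarrow> inverse_system S \<and> (\<forall>i\<in>idx S. in_HPol V (space_at S i))"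

section \<open>HPol-expansions\<close>

text \<open>The universal property of \<open>p\<close> with respect to all inverse systems in HPol whose indices,
  points and vertices are taken from the types given by the first two arguments.\<close>

definition HPol_universal ::
  "'v itself \<Rightarrow> ('m, 'b) inv_system itself \<Rightarrow> 'a topology \<Rightarrow> ('i, 's) inv_system \<Rightarrow>
   ('i \<Rightarrow> (unit \<times> ('a \<Rightarrow> 's) set) set) \<Rightarrow> bool" where
  "HPol_universal V _ X S p \<longleftrightarrow> p \<in> pro_hom (const_system X) S \<and>
     (\<forall>Y::('m, 'b) inv_system. HPol_system V Y \<longrightarrow>
        (\<forall>h\<in>pro_hom (const_system X) Y.
           \<exists>!f. f \<in> pro_hom S Y \<and> pro_comp (const_system X) Y f p = h))"

text \<open>\<open>S\<close>, an inverse system in HPol with vertices in \<open>'w\<close>, is an HPol-expansion of \<open>X\<close>. The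
  universal property has to be tested on all inverse systems in HPol, i.e. for all types \<open>'v\<close>,
  \<open>'m\<close>, \<open>'b\<close>, and \<open>p\<close> must not depend on them. As types cannot be quantified inside the
  formula, \<open>p\<close> is first required to exist with the universal property for the types of \<open>S\<close>
  itself; this determines \<open>p\<close> up to an automorphism of \<open>S\<close>. Then every such \<open>p\<close> (equivalently,
  one of them) is required to be universal for \<open>'v\<close>, \<open>'m\<close>, \<open>'b\<close>. Statements about
  \<open>HPol_expansion\<close> are meant to be made for type variables \<open>'v\<close>, \<open>'m\<close>, \<open>'b\<close>.\<close>

definition HPol_expansion ::
  "'v itself \<Rightarrow> ('m, 'b) inv_system itself \<Rightarrow> 'w itself \<Rightarrow> 'a topology \<Rightarrow>
   ('i, 's) inv_system \<Rightarrow> bool" where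
  "HPol_expansion V T W X S \<longleftrightarrow> HPol_system W S \<and>
     (\<exists>p. HPol_universal W TYPE(('i, 's) inv_system) X S p) \<and>
     (\<forall>p. HPol_universal W TYPE(('i, 's) inv_system) X S p \<longrightarrow> HPol_universal V T X S p)"

section \<open>Inverse sequences of simplicial complexes\<close>

text \<open>\<open>step_comp P b n k\<close> composes the bonding morphisms \<open>b n\<close>, \<dots>, \<open>b (n + k - 1)\<close>, where
  \<open>b i\<close> goes from \<open>P (i + 1)\<close> to \<open>P i\<close>.\<close>

primrec step_comp ::
  "(nat \<Rightarrow> 's topology) \<Rightarrow> (nat \<Rightarrow> ('s \<Rightarrow> 's) set) \<Rightarrow> nat \<Rightarrow> nat \<Rightarrow> ('s \<Rightarrow> 's) set" where
  "step_comp P b n 0 = hclass (P n) (P n) id"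
| "step_comp P b n (Suc k) = hcomp (P (n + Suc k)) (P n) (step_comp P b n k) (b (n + k))"

definition inverse_sequence ::
  "(nat \<Rightarrow> 's topology) \<Rightarrow> (nat \<Rightarrow> ('s \<Rightarrow> 's) set) \<Rightarrow> (nat, 's) inv_system" where
  "inverse_sequence P b = \<lparr> idx = UNIV, ile = (\<le>), space_at = P,
     bond = (\<lambda>n m. step_comp P b n (m - n)) \<rparr>"

definition polyhedral_sequence ::
  "(nat \<Rightarrow> 'v set set) \<Rightarrow> (nat \<Rightarrow> 'v \<Rightarrow> 'v) \<Rightarrow> (nat, 'v \<Rightarrow> real) inv_system" where
  "polyhedral_sequence K g = inverse_sequence (\<lambda>n. realization (K n))
     (\<lambda>n. hclass (realization (K (Suc n))) (realization (K n)) (realization_map (g n)))"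

section \<open>Adjusted approximative sequences\<close>

definition approximation :: "'a::metric_space set \<Rightarrow> real \<Rightarrow> 'a set \<Rightarrow> bool" where
  "approximation X \<epsilon> A \<longleftrightarrow> finite A \<and> A \<subseteq> X \<and> (\<forall>x\<in>X. \<exists>a\<in>A. dist x a < \<epsilon>)"

definition approx_gap :: "'a::metric_space set \<Rightarrow> 'a set \<Rightarrow> real" where
  "approx_gap X A = (SUP x\<in>X. infdist x A)"

definition adjusted_approximative_sequence ::
  "'a::metric_space set \<Rightarrow> (nat \<Rightarrow> real) \<Rightarrow> (nat \<Rightarrow> 'a set) \<Rightarrow> bool" where
  "adjusted_approximative_sequence X \<epsilon> A \<longleftrightarrow>
     decseq \<epsilon> \<and> (\<forall>n. 0 < \<epsilon> n) \<and> \<epsilon> \<longlonglongrightarrow> 0 \<and>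
     (\<forall>n. approximation X (\<epsilon> n) (A n) \<and> approx_gap X (A n) < \<epsilon> n \<and>
          \<epsilon> (Suc n) < (\<epsilon> n - approx_gap X (A n)) / 2)"

definition nearest :: "'a::metric_space set \<Rightarrow> 'a \<Rightarrow> 'a set" where
  "nearest A x = {a \<in> A. dist x a = infdist x A}"

definition nearest_set :: "'a::metric_space set \<Rightarrow> 'a set \<Rightarrow> 'a set" where
  "nearest_set A C = (\<Union>c\<in>C. nearest A c)"

definition small_subsets :: "real \<Rightarrow> 'a::metric_space set \<Rightarrow> 'a set set" where
  "small_subsets \<delta> A = {C. C \<subseteq> A \<and> C \<noteq> {} \<and> diameter C < \<delta>}"

section \<open>The simplicial complexes\<close>

definition order_complex :: "'a set set \<Rightarrow> 'a set set set" where
  "order_complex P = {\<D>. finite \<D> \<and> \<D> \<noteq> {} \<and> \<D> \<subseteq> P \<and> (\<forall>C\<in>\<D>. \<forall>D\<in>\<D>. C \<subseteq> D \<or> D \<subseteq> C)}"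

definition rips_complex :: "real \<Rightarrow> 'a::metric_space set \<Rightarrow> 'a set set" where
  "rips_complex \<delta> A = {\<sigma>. finite \<sigma> \<and> \<sigma> \<noteq> {} \<and> \<sigma> \<subseteq> A \<and> diameter \<sigma> < \<delta>}"

definition ball_in :: "'a::metric_space set \<Rightarrow> real \<Rightarrow> 'a \<Rightarrow> 'a set" where
  "ball_in X \<epsilon> a = {x \<in> X. dist x a < \<epsilon>}"

definition nerve :: "'a set set \<Rightarrow> 'a set set set" where
  "nerve B = {\<sigma>. finite \<sigma> \<and> \<sigma> \<noteq> {} \<and> \<sigma> \<subseteq> B \<and> \<Inter>\<sigma> \<noteq> {}}"

definition witness_complex :: "'a::metric_space set \<Rightarrow> real \<Rightarrow> 'a set \<Rightarrow> 'a set set" where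
  "witness_complex X \<epsilon> A = {\<sigma>. finite \<sigma> \<and> \<sigma> \<noteq> {} \<and> \<sigma> \<subseteq> A \<and>
     (\<forall>\<tau>. \<tau> \<subseteq> \<sigma> \<longrightarrow> \<tau> \<noteq> {} \<longrightarrow> (\<exists>x\<in>X. (\<Sum>a\<in>\<tau>. dist x a) < real (card \<tau>) * \<epsilon>))}"

definition upper_dowker :: "'a set set \<Rightarrow> 'a set set set" where
  "upper_dowker P = {\<sigma>. finite \<sigma> \<and> \<sigma> \<noteq> {} \<and> \<sigma> \<subseteq> P \<and> (\<exists>D\<in>P. \<forall>C\<in>\<sigma>. C \<subseteq> D)}"

definition lower_dowker :: "'a set set \<Rightarrow> 'a set set set" where
  "lower_dowker P = {\<sigma>. finite \<sigma> \<and> \<sigma> \<noteq> {} \<and> \<sigma> \<subseteq> P \<and> (\<exists>C\<in>P. \<forall>D\<in>\<sigma>. C \<subseteq> D)}"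

section \<open>The polyhedral approximative sequences\<close>

definition alexandroff_mccord_sequence ::
  "(nat \<Rightarrow> real) \<Rightarrow> (nat \<Rightarrow> 'a::metric_space set) \<Rightarrow> (nat, 'a set \<Rightarrow> real) inv_system" where
  "alexandroff_mccord_sequence \<epsilon> A =
     polyhedral_sequence (\<lambda>n. order_complex (small_subsets (2 * \<epsilon> n) (A n)))
       (\<lambda>n. nearest_set (A n))"

definition point_choice :: "(nat \<Rightarrow> 'a::metric_space set) \<Rightarrow> (nat \<Rightarrow> 'a \<Rightarrow> 'a) \<Rightarrow> bool" where
  "point_choice A \<pi> \<longleftrightarrow> (\<forall>n. \<forall>a\<in>A (Suc n). \<pi> n a \<in> nearest (A n) a)"

definition rips_sequence ::
  "(nat \<Rightarrow> real) \<Rightarrow> (nat \<Rightarrow> 'a::metric_space set) \<Rightarrow> (nat \<Rightarrow> 'a \<Rightarrow> 'a) \<Rightarrow>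
   (nat, 'a \<Rightarrow> real) inv_system" where
  "rips_sequence \<epsilon> A \<pi> = polyhedral_sequence (\<lambda>n. rips_complex (2 * \<epsilon> n) (A n)) \<pi>"

text \<open>Vertices of the nerve are balls as sets, so distinct centres may give the same vertex; the
  centre \<open>a\<close> used to map a vertex is then part of the choice.\<close>

definition ball_choice ::
  "'a::metric_space set \<Rightarrow> (nat \<Rightarrow> real) \<Rightarrow> (nat \<Rightarrow> 'a set) \<Rightarrow> (nat \<Rightarrow> 'a set \<Rightarrow> 'a set) \<Rightarrow> bool" where
  "ball_choice X \<epsilon> A \<beta> \<longleftrightarrow> (\<forall>n. \<forall>V\<in>ball_in X (\<epsilon> (Suc n)) ` A (Suc n).
     \<exists>a\<in>A (Suc n). V = ball_in X (\<epsilon> (Suc n)) a \<and>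
       (\<exists>b\<in>nearest (A n) a. \<beta> n V = ball_in X (\<epsilon> n) b))"

definition cech_sequence ::
  "'a::metric_space set \<Rightarrow> (nat \<Rightarrow> real) \<Rightarrow> (nat \<Rightarrow> 'a set) \<Rightarrow> (nat \<Rightarrow> 'a set \<Rightarrow> 'a set) \<Rightarrow>
   (nat, 'a set \<Rightarrow> real) inv_system" where
  "cech_sequence X \<epsilon> A \<beta> = polyhedral_sequence (\<lambda>n. nerve (ball_in X (\<epsilon> n) ` A n)) \<beta>"

definition witness_sequence ::
  "'a::metric_space set \<Rightarrow> (nat \<Rightarrow> real) \<Rightarrow> (nat \<Rightarrow> 'a set) \<Rightarrow> (nat \<Rightarrow> 'a \<Rightarrow> 'a) \<Rightarrow>
   (nat, 'a \<Rightarrow> real) inv_system" where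
  "witness_sequence X \<epsilon> A \<pi> = polyhedral_sequence (\<lambda>n. witness_complex X (\<epsilon> n) (A n)) \<pi>"

definition upper_dowker_sequence ::
  "(nat \<Rightarrow> real) \<Rightarrow> (nat \<Rightarrow> 'a::metric_space set) \<Rightarrow> (nat, 'a set \<Rightarrow> real) inv_system" where
  "upper_dowker_sequence \<epsilon> A =
     polyhedral_sequence (\<lambda>n. upper_dowker (small_subsets (2 * \<epsilon> n) (A n)))
       (\<lambda>n. nearest_set (A n))"

definition lower_dowker_sequence ::
  "(nat \<Rightarrow> real) \<Rightarrow> (nat \<Rightarrow> 'a::metric_space set) \<Rightarrow> (nat, 'a set \<Rightarrow> real) inv_system" where
  "lower_dowker_sequence \<epsilon> A =
     polyhedral_sequence (\<lambda>n. lower_dowker (small_subsets (2 * \<epsilon> n) (A n)))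
       (\<lambda>n. nearest_set (A n))"

end

theory Submission
  imports Defs
begin

text \<open>
  Let \<open>N\<^sub>n\<close> be the nerve of the balls \<open>B\<^sub>n(a)\<close> with vertex set \<open>A\<^sub>n\<close>, and \<open>\<phi>\<^sub>n: X \<rightarrow> |N\<^sub>n|\<close> the map of a
  partition of unity. The Mardesic-Segal criterion for \<open>(\<phi>\<^sub>n)\<close> to be universal is that a map \<open>X \<rightarrow> |L|\<close>
  factors up to homotopy through some \<open>\<phi>\<^sub>n\<close>, and that two maps \<open>f, g: |N\<^sub>n| \<rightarrow> |L|\<close> with
  \<open>f \<phi>\<^sub>n \<simeq> g \<phi>\<^sub>n\<close> become homotopic on some \<open>|N\<^sub>m|\<close>. Both hold with straight-line homotopies only: by
  a Lebesgue number argument a map \<open>X \<rightarrow> |L|\<close> sends small balls about the points of \<open>A\<^sub>m\<close> into open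
  stars of vertices of \<open>L\<close>, which gives a simplicial map \<open>N\<^sub>m \<rightarrow> L\<close>; along a homotopy this map only changes
  by contiguities. To compare it with \<open>f\<close> composed with the bonding map, the latter is replaced by the
  contiguous affine extension of \<open>\<phi>\<^sub>n\<close> restricted to \<open>A\<^sub>m\<close>, which maps simplices to small sets.
  The six sequences are isomorphic to \<open>(N\<^sub>n)\<close> in pro-HTop: the Rips, witness and Cech ones directly, and
  the other three through the barycentric subdivision or the vertex inclusion of the Rips complex.
\<close>

text \<open>Indexing the nerve by centres gives the nerve, witness and Rips complexes of stage
  \<open>n\<close> the common vertex set \<open>A n\<close>, with each contained in the next. The
  adjustment inequality, read as
  \<open>approx_gap X (A n) + 2 * \<epsilon> (Suc n) < \<epsilon> n\<close>, supplies maps in the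
  other direction one stage down: nearest-point choices send even a Rips simplex of stage
  \<open>Suc n\<close> to a simplex of the nerve of stage \<open>n\<close>.

  The obstacle is that nearest-point choices are not continuous: two arbitrarily close points may be
  sent to different vertices, so a bonding map can stretch a small simplex over a whole simplex, and
  star conditions for \<open>f\<close> say nothing about \<open>f\<close> after bonding. Partition
  functions are continuous on the compact space \<open>X\<close>, so a Lebesgue number controls
  their affine extension.

  Test polyhedra may be infinite, with the weak topology. Every source is compact, so two given maps
  meet only finitely many vertices, where the weak topology is that of the coordinates.\<close>

abbreviation homot :: "'a topology \<Rightarrow> 'b topology \<Rightarrow> ('a \<Rightarrow> 'b) \<Rightarrow> ('a \<Rightarrow> 'b) \<Rightarrow> bool" where
  "homot X Y \<equiv> homotopic_with (\<lambda>_. True) X Y"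

lemma homot_comp_left: "homot X Y f g \<Longrightarrow> continuous_map Y Z h \<Longrightarrow> homot X Z (h \<circ> f) (h \<circ> g)"
  by (rule homotopic_with_compose_continuous_map_left) auto

lemma homot_comp_right: "homot Y Z f g \<Longrightarrow> continuous_map X Y h \<Longrightarrow> homot X Z (f \<circ> h) (g \<circ> h)"
  by (rule homotopic_with_compose_continuous_map_right) auto

section \<open>Morphisms of the homotopy category\<close>

text \<open>Continuity enters because a discontinuous map is homotopic to nothing: its class is
  empty, and any two such classes would coincide.\<close>

lemma hclass_eq_iff:
  assumes "continuous_map X Y f"
  shows "hclass X Y f = hclass X Y g \<longleftrightarrow> homot X Y f g"
proof
  assume "hclass X Y f = hclass X Y g"
  moreover have "f \<in> hclass X Y f" using assms by (simp add: hclass_def)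
  ultimately show "homot X Y f g" by (auto simp: hclass_def homotopic_with_sym)
next
  assume "homot X Y f g"
  then show "hclass X Y f = hclass X Y g"
    by (auto simp: hclass_def intro: homotopic_with_trans homotopic_with_symD)
qed

lemma hclass_eqI: "homot X Y f g \<Longrightarrow> hclass X Y f = hclass X Y g"
  using hclass_eq_iff homotopic_with_imp_continuous_maps by blast

lemma hclass_in_HTop_hom: "continuous_map X Y f \<Longrightarrow> hclass X Y f \<in> HTop_hom X Y"
  by (simp add: HTop_hom_def)

lemma HTop_homE:
  assumes "F \<in> HTop_hom X Y"
  obtains f where "continuous_map X Y f" "F = hclass X Y f"
  using assms by (auto simp: HTop_hom_def)

lemma hcomp_hclass:
  assumes "continuous_map X Y f" "continuous_map Y Z g"
  shows "hcomp X Z (hclass Y Z g) (hclass X Y f) = hclass X Z (g \<circ> f)"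
proof -
  have "hclass X Z (g' \<circ> f') = hclass X Z (g \<circ> f)"
    if "g' \<in> hclass Y Z g" "f' \<in> hclass X Y f" for f' g'
    using that by (intro hclass_eqI) (auto simp: hclass_def homotopic_with_sym intro: homotopic_compose)
  moreover have "g \<in> hclass Y Z g" "f \<in> hclass X Y f" using assms by (auto simp: hclass_def)
  ultimately show ?thesis unfolding hcomp_def by blast
qed

lemma hcomp_in:
  assumes "F \<in> HTop_hom X Y" "G \<in> HTop_hom Y Z"
  shows "hcomp X Z G F \<in> HTop_hom X Z"
  using assms by (elim HTop_homE) (auto simp: hcomp_hclass intro!: hclass_in_HTop_hom continuous_map_compose)

lemma hcomp_assoc:
  assumes "F \<in> HTop_hom X Y" "G \<in> HTop_hom Y Z" "H \<in> HTop_hom Z W"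
  shows "hcomp X W (hcomp Y W H G) F = hcomp X W H (hcomp X Z G F)"
proof -
  obtain f g h where "continuous_map X Y f" "F = hclass X Y f" "continuous_map Y Z g"
    "G = hclass Y Z g" "continuous_map Z W h" "H = hclass Z W h"
    using assms by (elim HTop_homE)
  then show ?thesis
    by (simp add: hcomp_hclass continuous_map_compose[of X Y f Z g] continuous_map_compose[of Y Z g W h] comp_assoc)
qed

lemma hcomp_id_right: "F \<in> HTop_hom X Y \<Longrightarrow> hcomp X Y F (hclass X X id) = F"
  by (elim HTop_homE) (simp add: hcomp_hclass[of X X])

lemma hcomp_id_left: "F \<in> HTop_hom X Y \<Longrightarrow> hcomp X Y (hclass Y Y id) F = F"
  by (elim HTop_homE) (simp add: hcomp_hclass[of X Y _ Y])

lemma id_in_HTop_hom: "hclass X X id \<in> HTop_hom X X"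
  by (rule hclass_in_HTop_hom) simp

section \<open>Pro-morphisms\<close>

text \<open>Morphisms of the pro-category act on germs by unions over all representatives; such a
  union collapses once every representative gives the same value.\<close>

lemma UN_pair_const:
  assumes "(a, b) \<in> A" and "\<And>x y. (x, y) \<in> A \<Longrightarrow> f x y = c"
  shows "(\<Union>(x, y)\<in>A. f x y) = c"
  using assms by (intro equalityI subsetI) fastforce+

context
  fixes S :: "('i, 's) inv_system"
  assumes S: "inverse_system S"
begin

lemma system_refl: "i \<in> idx S \<Longrightarrow> ile S i i"
  using S unfolding inverse_system_def directed_set_def by (elim conjE) (rule bspec)

lemma system_trans: "ile S i j \<Longrightarrow> ile S j k \<Longrightarrow> i \<in> idx S \<Longrightarrow> j \<in> idx S \<Longrightarrow> k \<in> idx S \<Longrightarrow> ile S i k"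
proof -
  have "\<forall>i\<in>idx S. \<forall>j\<in>idx S. \<forall>k\<in>idx S. ile S i j \<longrightarrow> ile S j k \<longrightarrow> ile S i k"
    using S unfolding inverse_system_def directed_set_def by (elim conjE)
  then show "ile S i j \<Longrightarrow> ile S j k \<Longrightarrow> i \<in> idx S \<Longrightarrow> j \<in> idx S \<Longrightarrow> k \<in> idx S \<Longrightarrow> ile S i k" by blast
qed

lemma system_directed:
  assumes "i \<in> idx S" "j \<in> idx S"
  obtains k where "k \<in> idx S" "ile S i k" "ile S j k"
proof -
  have "\<forall>i\<in>idx S. \<forall>j\<in>idx S. \<exists>k\<in>idx S. ile S i k \<and> ile S j k"
    using S unfolding inverse_system_def directed_set_def by (elim conjE)
  then show ?thesis using assms that by blast
qed

lemma bond_in: "ile S i j \<Longrightarrow> i \<in> idx S \<Longrightarrow> j \<in> idx S \<Longrightarrow> bond S i j \<in> HTop_hom (space_at S j) (space_at S i)"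
proof -
  have "\<forall>i\<in>idx S. \<forall>j\<in>idx S. ile S i j \<longrightarrow> bond S i j \<in> HTop_hom (space_at S j) (space_at S i)"
    using S unfolding inverse_system_def by (elim conjE)
  then show "ile S i j \<Longrightarrow> i \<in> idx S \<Longrightarrow> j \<in> idx S \<Longrightarrow> bond S i j \<in> HTop_hom (space_at S j) (space_at S i)" by blast
qed

lemma bond_refl: "i \<in> idx S \<Longrightarrow> bond S i i = hclass (space_at S i) (space_at S i) id"
proof -
  have "\<forall>i\<in>idx S. bond S i i = hclass (space_at S i) (space_at S i) id"
    using S unfolding inverse_system_def by (elim conjE)
  then show "i \<in> idx S \<Longrightarrow> bond S i i = hclass (space_at S i) (space_at S i) id" by blast
qed

lemma bond_comp: "ile S i j \<Longrightarrow> ile S j k \<Longrightarrow> i \<in> idx S \<Longrightarrow> j \<in> idx S \<Longrightarrow> k \<in> idx S \<Longrightarrow>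
    hcomp (space_at S k) (space_at S i) (bond S i j) (bond S j k) = bond S i k"
proof -
  have "\<forall>i\<in>idx S. \<forall>j\<in>idx S. \<forall>k\<in>idx S. ile S i j \<longrightarrow> ile S j k \<longrightarrow> hcomp (space_at S k) (space_at S i) (bond S i j) (bond S j k) = bond S i k"
    using S unfolding inverse_system_def by (elim conjE)
  then show "ile S i j \<Longrightarrow> ile S j k \<Longrightarrow> i \<in> idx S \<Longrightarrow> j \<in> idx S \<Longrightarrow> k \<in> idx S \<Longrightarrow> hcomp (space_at S k) (space_at S i) (bond S i j) (bond S j k) = bond S i k" by blast
qed

lemma hcomp_bond:
  assumes "F \<in> HTop_hom (space_at S i) Y" "ile S i j" "ile S j k" "i \<in> idx S" "j \<in> idx S" "k \<in> idx S"
  shows "hcomp (space_at S k) Y (hcomp (space_at S j) Y F (bond S i j)) (bond S j k)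
    = hcomp (space_at S k) Y F (bond S i k)"
proof -
  have "hcomp (space_at S k) Y (hcomp (space_at S j) Y F (bond S i j)) (bond S j k)
    = hcomp (space_at S k) Y F (hcomp (space_at S k) (space_at S i) (bond S i j) (bond S j k))"
    using assms by (intro hcomp_assoc bond_in)
  then show ?thesis using assms by (simp add: bond_comp)
qed

lemma germ_memD:
  assumes "(j, G) \<in> germ S Y i F"
  shows "j \<in> idx S" "G \<in> HTop_hom (space_at S j) Y"
    "\<exists>k\<in>idx S. ile S i k \<and> ile S j k \<and>
        hcomp (space_at S k) Y F (bond S i k) = hcomp (space_at S k) Y G (bond S j k)"
  using assms by (auto simp: germ_def)

lemma germ_self: "i \<in> idx S \<Longrightarrow> F \<in> HTop_hom (space_at S i) Y \<Longrightarrow> (i, F) \<in> germ S Y i F"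
  using system_refl by (auto simp: germ_def)

text \<open>Transitivity of the germ relation. The two equalities hold at unrelated stages
  \<open>k\<close> and \<open>k'\<close>; directedness gives a stage \<open>m\<close> beyond both,
  where they are chained through \<open>F\<close>.\<close>

lemma germ_subset:
  assumes "i \<in> idx S" "F \<in> HTop_hom (space_at S i) Y"
    and jG: "(j, G) \<in> germ S Y i F"
  shows "germ S Y i F \<subseteq> germ S Y j G"
proof
  fix x assume "x \<in> germ S Y i F"
  then obtain l H where x: "x = (l, H)" and lH: "(l, H) \<in> germ S Y i F" by (cases x) auto
  obtain k where k: "k \<in> idx S" "ile S i k" "ile S j k"
    "hcomp (space_at S k) Y F (bond S i k) = hcomp (space_at S k) Y G (bond S j k)"
    using germ_memD(3)[OF jG] by blast
  obtain k' where k': "k' \<in> idx S" "ile S i k'" "ile S l k'"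
    "hcomp (space_at S k') Y F (bond S i k') = hcomp (space_at S k') Y H (bond S l k')"
    using germ_memD(3)[OF lH] by blast
  obtain m where m: "m \<in> idx S" "ile S k m" "ile S k' m"
    using system_directed k(1) k'(1) by blast
  note j = germ_memD(1,2)[OF jG] and l = germ_memD(1,2)[OF lH]
  have jm: "ile S j m" "ile S l m" using system_trans j l k k' m by blast+
  have "hcomp (space_at S m) Y G (bond S j m) = hcomp (space_at S m) Y F (bond S i m)"
    using hcomp_bond[of G j Y k m] hcomp_bond[of F i Y k m] assms j k m by simp
  also have "\<dots> = hcomp (space_at S m) Y H (bond S l m)"
    using hcomp_bond[of H l Y k' m] hcomp_bond[of F i Y k' m] assms l k' m by simp
  finally show "x \<in> germ S Y j G"
    using x l jm m by (auto simp: germ_def)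
qed

lemma germ_eqI:
  assumes "i \<in> idx S" "F \<in> HTop_hom (space_at S i) Y" and jG: "(j, G) \<in> germ S Y i F"
  shows "germ S Y j G = germ S Y i F"
proof
  note j = germ_memD(1,2)[OF jG]
  have "(i, F) \<in> germ S Y j G" using germ_subset[OF assms] germ_self assms by blast
  then show "germ S Y j G \<subseteq> germ S Y i F" using germ_subset j by blast
  show "germ S Y i F \<subseteq> germ S Y j G" by (rule germ_subset[OF assms])
qed

lemma germ_eq_iff:
  assumes "i \<in> idx S" "F \<in> HTop_hom (space_at S i) Y" "j \<in> idx S" "G \<in> HTop_hom (space_at S j) Y"
  shows "germ S Y i F = germ S Y j G \<longleftrightarrow> (\<exists>k\<in>idx S. ile S i k \<and> ile S j k \<and>
        hcomp (space_at S k) Y F (bond S i k) = hcomp (space_at S k) Y G (bond S j k))" (is "?L = ?R")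
proof
  assume ?L
  then have "(j, G) \<in> germ S Y i F" using germ_self[OF assms(3,4)] by simp
  then show ?R by (rule germ_memD)
next
  assume ?R
  then have "(j, G) \<in> germ S Y i F" using assms by (auto simp: germ_def)
  then show ?L using germ_eqI assms by blast
qed

lemma colim_homE:
  assumes "\<xi> \<in> colim_hom S Y"
  obtains i F where "i \<in> idx S" "F \<in> HTop_hom (space_at S i) Y" "\<xi> = germ S Y i F"
  using assms by (auto simp: colim_hom_def)

lemma germ_in_colim_hom: "i \<in> idx S \<Longrightarrow> F \<in> HTop_hom (space_at S i) Y \<Longrightarrow> germ S Y i F \<in> colim_hom S Y"
  by (auto simp: colim_hom_def)

text \<open>Independence of the representative: an equality of composites at a stage
  \<open>k\<close> persists under post-composition with \<open>Q\<close> by associativity.\<close>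

lemma colim_push_germ:
  assumes "i \<in> idx S" "F \<in> HTop_hom (space_at S i) Y" "Q \<in> HTop_hom Y Z"
  shows "colim_push S Z Q (germ S Y i F) = germ S Z i (hcomp (space_at S i) Z Q F)"
proof -
  have "germ S Z j (hcomp (space_at S j) Z Q G) = germ S Z i (hcomp (space_at S i) Z Q F)"
    if jG: "(j, G) \<in> germ S Y i F" for j G
  proof -
    note j = germ_memD(1,2)[OF jG]
    obtain k where k: "k \<in> idx S" "ile S i k" "ile S j k"
      "hcomp (space_at S k) Y F (bond S i k) = hcomp (space_at S k) Y G (bond S j k)"
      using germ_memD(3)[OF jG] by blast
    have "hcomp (space_at S k) Z (hcomp (space_at S i) Z Q F) (bond S i k)
        = hcomp (space_at S k) Z (hcomp (space_at S j) Z Q G) (bond S j k)"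
      using hcomp_assoc[OF bond_in[OF k(2)] assms(2,3)] hcomp_assoc[OF bond_in[OF k(3)] j(2) assms(3)]
        assms j k by simp
    then show ?thesis
      using germ_eq_iff[of j "hcomp (space_at S j) Z Q G" Z i "hcomp (space_at S i) Z Q F"] assms j k
      by (metis hcomp_in)
  qed
  then show ?thesis unfolding colim_push_def by (rule UN_pair_const[OF germ_self[OF assms(1,2)]])
qed

lemma colim_push_in: "\<xi> \<in> colim_hom S Y \<Longrightarrow> Q \<in> HTop_hom Y Z \<Longrightarrow> colim_push S Z Q \<xi> \<in> colim_hom S Z"
  by (elim colim_homE) (simp add: colim_push_germ germ_in_colim_hom hcomp_in)

lemma colim_push_push:
  assumes "\<xi> \<in> colim_hom S Y" "Q \<in> HTop_hom Y Z" "R \<in> HTop_hom Z W"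
  shows "colim_push S W R (colim_push S Z Q \<xi>) = colim_push S W (hcomp Y W R Q) \<xi>"
proof -
  obtain i F where i: "i \<in> idx S" "F \<in> HTop_hom (space_at S i) Y" "\<xi> = germ S Y i F"
    using assms(1) by (rule colim_homE)
  then show ?thesis using assms
    by (simp add: colim_push_germ hcomp_in[of F _ Y] hcomp_in[of Q Y Z R] hcomp_assoc[OF i(2)])
qed

lemma colim_push_id: "\<xi> \<in> colim_hom S Y \<Longrightarrow> colim_push S Y (hclass Y Y id) \<xi> = \<xi>"
  by (elim colim_homE) (simp add: colim_push_germ id_in_HTop_hom hcomp_id_left)

end

section \<open>Composition and identities in the pro-category\<close>

lemma pro_hom_in: "\<phi> \<in> pro_hom S T \<Longrightarrow> j \<in> idx T \<Longrightarrow> \<phi> j \<in> colim_hom S (space_at T j)"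
  by (auto simp: pro_hom_def)

lemma pro_hom_compat: "\<phi> \<in> pro_hom S T \<Longrightarrow> j \<in> idx T \<Longrightarrow> j' \<in> idx T \<Longrightarrow> ile T j j' \<Longrightarrow>
   colim_push S (space_at T j) (bond T j j') (\<phi> j') = \<phi> j"
  by (auto simp: pro_hom_def)

lemma pro_hom_ext: "\<phi> \<in> pro_hom S T \<Longrightarrow> \<psi> \<in> pro_hom S T \<Longrightarrow> (\<And>j. j \<in> idx T \<Longrightarrow> \<phi> j = \<psi> j) \<Longrightarrow> \<phi> = \<psi>"
  unfolding pro_hom_def by (auto intro: PiE_ext)

text \<open>A single representative of \<open>\<psi> k\<close> computes the composite. Two
  representatives agree after restriction to some stage \<open>l\<close>, and compatibility of
  \<open>\<phi>\<close> expresses both values through \<open>\<phi> l\<close>.\<close>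

lemma pro_comp_apply:
  assumes S: "inverse_system S" and T: "inverse_system T" and phi: "\<phi> \<in> pro_hom S T"
    and k: "k \<in> idx U" and j: "j \<in> idx T" and G: "G \<in> HTop_hom (space_at T j) (space_at U k)"
    and psi: "\<psi> k = germ T (space_at U k) j G"
  shows "pro_comp S U \<psi> \<phi> k = colim_push S (space_at U k) G (\<phi> j)"
proof -
  let ?W = "space_at U k"
  have "colim_push S ?W G' (\<phi> j') = colim_push S ?W G (\<phi> j)" if jG: "(j', G') \<in> \<psi> k" for j' G'
  proof -
    note jG' = jG[unfolded psi]
    note j' = germ_memD(1,2)[OF T jG']
    obtain l where l: "l \<in> idx T" "ile T j l" "ile T j' l"
      "hcomp (space_at T l) ?W G (bond T j l) = hcomp (space_at T l) ?W G' (bond T j' l)"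
      using germ_memD(3)[OF T jG'] by blast
    have "colim_push S ?W G' (\<phi> j') = colim_push S ?W G' (colim_push S (space_at T j') (bond T j' l) (\<phi> l))"
      using pro_hom_compat[OF phi] j' l by simp
    also have "\<dots> = colim_push S ?W G (colim_push S (space_at T j) (bond T j l) (\<phi> l))"
      using l(4) colim_push_push[OF S pro_hom_in[OF phi l(1)] bond_in[OF T l(2)] G]
        colim_push_push[OF S pro_hom_in[OF phi l(1)] bond_in[OF T l(3)] j'(2)] j j' l by simp
    also have "\<dots> = colim_push S ?W G (\<phi> j)"
      using pro_hom_compat[OF phi] j l by simp
    finally show ?thesis .
  qed
  then have "(\<Union>(j', G')\<in>\<psi> k. colim_push S ?W G' (\<phi> j')) = colim_push S ?W G (\<phi> j)"
    by (rule UN_pair_const[where a=j and b=G, rotated]) (simp_all add: psi germ_self[OF T j G])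
  then show ?thesis using k by (simp add: pro_comp_def)
qed

lemma pro_comp_in:
  assumes S: "inverse_system S" and T: "inverse_system T" and U: "inverse_system U"
    and phi: "\<phi> \<in> pro_hom S T" and psi: "\<psi> \<in> pro_hom T U"
  shows "pro_comp S U \<psi> \<phi> \<in> pro_hom S U"
  unfolding pro_hom_def
proof (intro CollectI conjI PiE_I ballI impI)
  fix k assume k: "k \<in> idx U"
  obtain j G where j: "j \<in> idx T" "G \<in> HTop_hom (space_at T j) (space_at U k)"
    "\<psi> k = germ T (space_at U k) j G" using colim_homE[OF T pro_hom_in[OF psi k]] by metis
  show "pro_comp S U \<psi> \<phi> k \<in> colim_hom S (space_at U k)"
    using pro_comp_apply[where k=k and \<psi>=\<psi>, OF S T phi k j] colim_push_in[OF S pro_hom_in[OF phi j(1)] j(2)] by simp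
next
  fix k assume "k \<notin> idx U"
  then show "pro_comp S U \<psi> \<phi> k = undefined" by (simp add: pro_comp_def)
next
  fix k k' assume k: "k \<in> idx U" and k': "k' \<in> idx U" and le: "ile U k k'"
  obtain j G where j: "j \<in> idx T" "G \<in> HTop_hom (space_at T j) (space_at U k')"
    "\<psi> k' = germ T (space_at U k') j G" using colim_homE[OF T pro_hom_in[OF psi k']] by metis
  \<comment> \<open>Composing a representative at \<open>k'\<close> with the bonding morphism
    represents \<open>\<psi>\<close> at \<open>k\<close>, so one stage \<open>j\<close> serves both
    indices.\<close>
  let ?G = "hcomp (space_at T j) (space_at U k) (bond U k k') G"
  have G: "?G \<in> HTop_hom (space_at T j) (space_at U k)"
    using hcomp_in[OF j(2) bond_in[OF U le k k']] .
  have "\<psi> k = germ T (space_at U k) j ?G"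
    using pro_hom_compat[OF psi k k' le] colim_push_germ[OF T j(1,2) bond_in[OF U le k k']] j(3) by simp
  then have "pro_comp S U \<psi> \<phi> k = colim_push S (space_at U k) ?G (\<phi> j)"
    by (rule pro_comp_apply[OF S T phi k j(1) G])
  then show "colim_push S (space_at U k) (bond U k k') (pro_comp S U \<psi> \<phi> k') = pro_comp S U \<psi> \<phi> k"
    using pro_comp_apply[where k=k' and \<psi>=\<psi>, OF S T phi k' j] colim_push_push[OF S pro_hom_in[OF phi j(1)] j(2) bond_in[OF U le k k']]
    by simp
qed

lemma pro_comp_assoc:
  assumes S: "inverse_system S" and T: "inverse_system T" and U: "inverse_system U" and V: "inverse_system V"
    and phi: "\<phi> \<in> pro_hom S T" and psi: "\<psi> \<in> pro_hom T U" and chi: "\<theta> \<in> pro_hom U V"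
  shows "pro_comp S V \<theta> (pro_comp S U \<psi> \<phi>) = pro_comp S V (pro_comp T V \<theta> \<psi>) \<phi>"
proof (rule pro_hom_ext[of _ S V])
  show "pro_comp S V \<theta> (pro_comp S U \<psi> \<phi>) \<in> pro_hom S V"
    "pro_comp S V (pro_comp T V \<theta> \<psi>) \<phi> \<in> pro_hom S V"
    using assms by (auto intro!: pro_comp_in[of S U] pro_comp_in[of S T] pro_comp_in[of T U])
  fix l assume l: "l \<in> idx V"
  obtain k H where k: "k \<in> idx U" "H \<in> HTop_hom (space_at U k) (space_at V l)"
    "\<theta> l = germ U (space_at V l) k H" using colim_homE[OF U pro_hom_in[OF chi l]] by metis
  obtain j G where j: "j \<in> idx T" "G \<in> HTop_hom (space_at T j) (space_at U k)"
    "\<psi> k = germ T (space_at U k) j G" using colim_homE[OF T pro_hom_in[OF psi k(1)]] by metis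
  let ?HG = "hcomp (space_at T j) (space_at V l) H G"
  have HG: "?HG \<in> HTop_hom (space_at T j) (space_at V l)" using hcomp_in j(2) k(2) by blast
  have "pro_comp T V \<theta> \<psi> l = germ T (space_at V l) j ?HG"
    using pro_comp_apply[where k=l and \<psi>=\<theta>, OF T U psi l k] colim_push_germ[OF T j(1,2) k(2)] j(3) by simp
  then have "pro_comp S V (pro_comp T V \<theta> \<psi>) \<phi> l = colim_push S (space_at V l) ?HG (\<phi> j)"
    by (rule pro_comp_apply[OF S T phi l j(1) HG])
  also have "\<dots> = colim_push S (space_at V l) H (colim_push S (space_at U k) G (\<phi> j))"
    using colim_push_push[OF S pro_hom_in[OF phi j(1)] j(2) k(2)] by simp
  also have "\<dots> = pro_comp S V \<theta> (pro_comp S U \<psi> \<phi>) l"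
    using pro_comp_apply[where k=k and \<psi>=\<psi>, OF S T phi k(1) j]
      pro_comp_apply[where k=l and \<psi>=\<theta>, OF S U pro_comp_in[OF S T U phi psi] l k] by simp
  finally show "pro_comp S V \<theta> (pro_comp S U \<psi> \<phi>) l = pro_comp S V (pro_comp T V \<theta> \<psi>) \<phi> l" ..
qed

definition pro_id :: "('i, 's) inv_system \<Rightarrow> 'i \<Rightarrow> ('i \<times> ('s \<Rightarrow> 's) set) set" where
  "pro_id S = (\<lambda>i\<in>idx S. germ S (space_at S i) i (hclass (space_at S i) (space_at S i) id))"

lemma pro_id_in:
  assumes S: "inverse_system S"
  shows "pro_id S \<in> pro_hom S S"
  unfolding pro_hom_def
proof (intro CollectI conjI PiE_I ballI impI)
  fix i assume i: "i \<in> idx S"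
  then show "pro_id S i \<in> colim_hom S (space_at S i)"
    using germ_in_colim_hom[OF S i id_in_HTop_hom] by (simp add: pro_id_def)
next
  fix i assume "i \<notin> idx S" then show "pro_id S i = undefined" by (simp add: pro_id_def)
next
  fix i k assume i: "i \<in> idx S" and k: "k \<in> idx S" and le: "ile S i k"
  note b = bond_in[OF S le i k]
  have "germ S (space_at S i) k (bond S i k)
      = germ S (space_at S i) i (hclass (space_at S i) (space_at S i) id)"
    unfolding germ_eq_iff[OF S k b i id_in_HTop_hom] using le k system_refl[OF S k]
    by (intro bexI[of _ k]) (simp_all add: bond_refl[OF S] hcomp_id_right[OF b] hcomp_id_left[OF b])
  then show "colim_push S (space_at S i) (bond S i k) (pro_id S k) = pro_id S i"
    using colim_push_germ[OF S k id_in_HTop_hom b] i k by (simp add: pro_id_def hcomp_id_right[OF b])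
qed

lemma pro_comp_id_left:
  assumes S: "inverse_system S" and T: "inverse_system T" and phi: "\<phi> \<in> pro_hom S T"
  shows "pro_comp S T (pro_id T) \<phi> = \<phi>"
proof (rule pro_hom_ext[of _ S T])
  show "pro_comp S T (pro_id T) \<phi> \<in> pro_hom S T" by (rule pro_comp_in[OF S T T phi pro_id_in[OF T]])
  fix j assume j: "j \<in> idx T"
  have "pro_comp S T (pro_id T) \<phi> j = colim_push S (space_at T j) (hclass (space_at T j) (space_at T j) id) (\<phi> j)"
    by (rule pro_comp_apply[OF S T phi j j id_in_HTop_hom]) (simp add: pro_id_def j)
  then show "pro_comp S T (pro_id T) \<phi> j = \<phi> j" using colim_push_id[OF S pro_hom_in[OF phi j]] by simp
qed (rule phi)

lemma pro_comp_id_right: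
  assumes S: "inverse_system S" and T: "inverse_system T" and phi: "\<phi> \<in> pro_hom S T"
  shows "pro_comp S T \<phi> (pro_id S) = \<phi>"
proof (rule pro_hom_ext[of _ S T])
  show "pro_comp S T \<phi> (pro_id S) \<in> pro_hom S T" by (rule pro_comp_in[OF S S T pro_id_in[OF S] phi])
  fix j assume j: "j \<in> idx T"
  obtain i F where i: "i \<in> idx S" "F \<in> HTop_hom (space_at S i) (space_at T j)"
    "\<phi> j = germ S (space_at T j) i F" using colim_homE[OF S pro_hom_in[OF phi j]] by metis
  have "pro_comp S T \<phi> (pro_id S) j = colim_push S (space_at T j) F (pro_id S i)"
    by (rule pro_comp_apply[where k=j and \<psi>=\<phi>, OF S S pro_id_in[OF S] j i])
  also have "\<dots> = \<phi> j"
    using colim_push_germ[OF S i(1) id_in_HTop_hom i(2)] i by (simp add: pro_id_def hcomp_id_right)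
  finally show "pro_comp S T \<phi> (pro_id S) j = \<phi> j" .
qed (rule phi)

lemma inverse_system_const: "inverse_system (const_system X)"
  by (simp add: inverse_system_def const_system_def directed_set_def id_in_HTop_hom hcomp_id_left)

section \<open>Universal pro-morphisms\<close>

text \<open>Both morphisms are universal among systems of the type of \<open>S\<close>, hence differ by an
  automorphism of \<open>S\<close>, along which the universal property for the other types is transported.\<close>

lemma HPol_universal_transport:
  fixes S :: "('i, 's) inv_system"
  assumes S: "HPol_system W S"
    and p0: "HPol_universal W TYPE(('i, 's) inv_system) X S p0" "HPol_universal V TYPE(('m, 'b) inv_system) X S p0"
    and p: "HPol_universal W TYPE(('i, 's) inv_system) X S p"
  shows "HPol_universal V TYPE(('m, 'b) inv_system) X S p"
proof -
  let ?C = "const_system X"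
  have C: "inverse_system ?C" by (rule inverse_system_const)
  have S': "inverse_system S" using S by (simp add: HPol_system_def)
  have pin: "p \<in> pro_hom ?C S" and p0in: "p0 \<in> pro_hom ?C S"
    using p p0 by (auto simp: HPol_universal_def)
  obtain f where f: "f \<in> pro_hom S S" "pro_comp ?C S f p0 = p"
    using p0(1) S pin unfolding HPol_universal_def by blast
  obtain g where g: "g \<in> pro_hom S S" "pro_comp ?C S g p = p0"
    using p S p0in unfolding HPol_universal_def by blast
  let ?fg = "pro_comp S S f g"
  have fgin: "?fg \<in> pro_hom S S" by (rule pro_comp_in[OF S' S' S' g(1) f(1)])
  have "pro_comp ?C S ?fg p = p"
    using pro_comp_assoc[OF C S' S' S' pin g(1) f(1)] f g by simp
  moreover have "pro_comp ?C S (pro_id S) p = p" by (rule pro_comp_id_left[OF C S' pin])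
  \<comment> \<open>Uniqueness of factorizations for the target \<open>S\<close> with
    \<open>h = p\<close>: both \<open>?fg\<close> and the identity carry \<open>p\<close> to
    \<open>p\<close>. Below it recovers \<open>q\<close> from its composite with
    \<open>f\<close>.\<close>
  ultimately have fg: "?fg = pro_id S"
    using p S pin pro_id_in[OF S'] fgin unfolding HPol_universal_def by blast
  show ?thesis unfolding HPol_universal_def
  proof (intro conjI allI impI ballI pin)
    fix Y :: "('m, 'b) inv_system" and h
    assume Y: "HPol_system V Y" and h: "h \<in> pro_hom ?C Y"
    have Y': "inverse_system Y" using Y by (simp add: HPol_system_def)
    have ex1: "\<exists>!f'. f' \<in> pro_hom S Y \<and> pro_comp ?C Y f' p0 = h"
      using p0(2) Y h unfolding HPol_universal_def by blast
    then obtain f' where f': "f' \<in> pro_hom S Y" "pro_comp ?C Y f' p0 = h" by blast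
    show "\<exists>!f'. f' \<in> pro_hom S Y \<and> pro_comp ?C Y f' p = h"
    proof (rule ex1I[of _ "pro_comp S Y f' g"], intro conjI)
      show "pro_comp S Y f' g \<in> pro_hom S Y" by (rule pro_comp_in[OF S' S' Y' g(1) f'(1)])
      show "pro_comp ?C Y (pro_comp S Y f' g) p = h"
        using pro_comp_assoc[OF C S' S' Y' pin g(1) f'(1)] f' g by simp
    next
      fix q assume q: "q \<in> pro_hom S Y \<and> pro_comp ?C Y q p = h"
      let ?qf = "pro_comp S Y q f"
      have "?qf \<in> pro_hom S Y" using pro_comp_in[OF S' S' Y' f(1)] q by blast
      moreover have "pro_comp ?C Y ?qf p0 = h"
        using pro_comp_assoc[OF C S' S' Y' p0in f(1) conjunct1[OF q]] q f(2) by simp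
      ultimately have "?qf = f'" using ex1 f' by blast
      then have "pro_comp S Y f' g = pro_comp S Y q ?fg"
        using pro_comp_assoc[OF S' S' S' Y' g(1) f(1) conjunct1[OF q]] by simp
      then show "q = pro_comp S Y f' g"
        using fg pro_comp_id_right[OF S' Y' conjunct1[OF q]] by simp
    qed
  qed
qed

section \<open>Inverse sequences of maps\<close>

declare homotopic_with_trans [trans]

text \<open>The second number counts steps, so the source is \<open>P (n + k)\<close> without
  subtraction of naturals; new maps are added on the source side, as in
  \<open>step_comp\<close>.\<close>

primrec comp_bond :: "(nat \<Rightarrow> 's \<Rightarrow> 's) \<Rightarrow> nat \<Rightarrow> nat \<Rightarrow> 's \<Rightarrow> 's" where
  "comp_bond b n 0 = id"
| "comp_bond b n (Suc k) = comp_bond b n k \<circ> b (n + k)"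

lemma comp_bond_add: "comp_bond b n (j + k) = comp_bond b n j \<circ> comp_bond b (n + j) k"
  by (induction k) (simp_all only: comp_bond.simps add_Suc_right add_0_right comp_id comp_assoc add.assoc)

abbreviation map_system :: "(nat \<Rightarrow> 's topology) \<Rightarrow> (nat \<Rightarrow> 's \<Rightarrow> 's) \<Rightarrow> (nat, 's) inv_system" where
  "map_system P b \<equiv> inverse_sequence P (\<lambda>n. hclass (P (Suc n)) (P n) (b n))"

locale map_sequence =
  fixes P :: "nat \<Rightarrow> 's topology" and b :: "nat \<Rightarrow> 's \<Rightarrow> 's"
  assumes bond_cont: "continuous_map (P (Suc n)) (P n) (b n)"
begin

lemma comp_bond_cont: "continuous_map (P (n + k)) (P n) (comp_bond b n k)"
proof (induction k)
  case (Suc k)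
  show "continuous_map (P (n + (Suc k))) (P n) (comp_bond b n (Suc k))" unfolding comp_bond.simps add_Suc_right by (rule continuous_map_compose[OF bond_cont Suc])
next
  case 0
  show "continuous_map (P (n + 0)) (P n) (comp_bond b n 0)" unfolding comp_bond.simps by simp
qed

lemma step_comp_eq:
  "step_comp P (\<lambda>n. hclass (P (Suc n)) (P n) (b n)) n k = hclass (P (n + k)) (P n) (comp_bond b n k)"
proof (induction k)
  case (Suc k)
  show "step_comp P (\<lambda>n. hclass (P (Suc n)) (P n) (b n)) n (Suc k) = hclass (P (n + (Suc k))) (P n) (comp_bond b n (Suc k))"
    unfolding comp_bond.simps step_comp.simps Suc add_Suc_right
    by (rule hcomp_hclass[OF bond_cont comp_bond_cont])
next
  case 0
  show "step_comp P (\<lambda>n. hclass (P (Suc n)) (P n) (b n)) n 0 = hclass (P (n + 0)) (P n) (comp_bond b n 0)" unfolding comp_bond.simps step_comp.simps by simp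
qed

lemma bond_eq: "bond (map_system P b) n (n + k) = hclass (P (n + k)) (P n) (comp_bond b n k)"
  by (simp add: inverse_sequence_def step_comp_eq)

lemma system_simps: "idx (map_system P b) = UNIV" "ile (map_system P b) = (\<le>)"
  "space_at (map_system P b) = P"
  by (simp_all add: inverse_sequence_def)

lemma inverse_system_map_system: "inverse_system (map_system P b)"
  unfolding inverse_system_def system_simps
proof (intro conjI ballI impI)
  show "directed_set UNIV ((\<le>) :: nat \<Rightarrow> nat \<Rightarrow> bool)"
    by (auto simp: directed_set_def) (metis max.cobounded1 max.cobounded2)
next
  fix i j :: nat assume "i \<le> j"
  then obtain k where j: "j = i + k" using le_Suc_ex by blast
  show "bond (map_system P b) i j \<in> HTop_hom (P j) (P i)"
    unfolding j bond_eq by (rule hclass_in_HTop_hom[OF comp_bond_cont])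
next
  fix i
  show "bond (map_system P b) i i = hclass (P i) (P i) id"
    using bond_eq[of i 0] unfolding comp_bond.simps by simp
next
  fix i j l :: nat assume "i \<le> j" "j \<le> l"
  then obtain k m where j: "j = i + k" "l = i + k + m" using le_Suc_ex by metis
  show "hcomp (P l) (P i) (bond (map_system P b) i j) (bond (map_system P b) j l) = bond (map_system P b) i l"
    using hcomp_hclass[OF comp_bond_cont[of "i + k" m] comp_bond_cont[of i k]] bond_eq[of i "k + m"]
      bond_eq[of "i + k" m] bond_eq[of i k]
    by (simp add: j comp_bond_add add.assoc)
qed

end

text \<open>The map from the colimit of the sets \<open>[P n, L]\<close> to \<open>[X, L]\<close>
  induced by \<open>p\<close> is surjective and injective. Injectivity is stated for two maps on the
  same stage; \<open>factor_unique\<close> first pulls maps on different stages back to a common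
  one.\<close>

definition expands :: "'a topology \<Rightarrow> (nat \<Rightarrow> 's topology) \<Rightarrow> (nat \<Rightarrow> 's \<Rightarrow> 's) \<Rightarrow> (nat \<Rightarrow> 'a \<Rightarrow> 's) \<Rightarrow> 'c topology \<Rightarrow> bool" where
  "expands X P b p L \<longleftrightarrow>
     (\<forall>h. continuous_map X L h \<longrightarrow> (\<exists>n f. continuous_map (P n) L f \<and> homot X L (f \<circ> p n) h)) \<and>
     (\<forall>n f g. continuous_map (P n) L f \<longrightarrow> continuous_map (P n) L g \<longrightarrow> homot X L (f \<circ> p n) (g \<circ> p n) \<longrightarrow>
        (\<exists>k. homot (P (n + k)) L (f \<circ> comp_bond b n k) (g \<circ> comp_bond b n k)))"

lemma expands_ex:
  assumes "expands X P b p L" "continuous_map X L h"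
  obtains n f where "continuous_map (P n) L f" "homot X L (f \<circ> p n) h"
  using assms unfolding expands_def by blast

lemma expands_eq:
  assumes "expands X P b p L" "continuous_map (P n) L f" "continuous_map (P n) L g"
    "homot X L (f \<circ> p n) (g \<circ> p n)"
  shows "\<exists>k. homot (P (n + k)) L (f \<circ> comp_bond b n k) (g \<circ> comp_bond b n k)"
  using assms unfolding expands_def by blast

locale cone = map_sequence P b for P :: "nat \<Rightarrow> 's topology" and b +
  fixes X :: "'a topology" and p :: "nat \<Rightarrow> 'a \<Rightarrow> 's"
  assumes p_cont: "continuous_map X (P n) (p n)"
    and p_compat: "homot X (P n) (p n) (b n \<circ> p (Suc n))"
begin

lemma p_comp_bond: "homot X (P n) (p n) (comp_bond b n k \<circ> p (n + k))"
proof (induction k)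
  case 0
  show "homot X (P n) (p n) (comp_bond b n 0 \<circ> p (n + 0))" unfolding comp_bond.simps using p_cont by simp
next
  case (Suc k)
  note Suc
  also have "homot X (P n) (comp_bond b n k \<circ> p (n + k)) (comp_bond b n k \<circ> (b (n + k) \<circ> p (Suc (n + k))))"
    by (rule homot_comp_left[OF p_compat comp_bond_cont])
  finally show "homot X (P n) (p n) (comp_bond b n (Suc k) \<circ> p (n + (Suc k)))" by (simp only: comp_bond.simps add_Suc_right comp_assoc)
qed

text \<open>Targets in HPol are only homotopy equivalent to realizations. Maps into
  \<open>L'\<close> are pushed into \<open>L\<close> by \<open>u\<close> and recovered through
  \<open>v\<close>, since \<open>v \<circ> u\<close> is homotopic to the identity.\<close>

lemma expands_homotopy_equivalent:
  assumes ex: "expands X P b p L" and eq: "L' homotopy_equivalent_space L"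
  shows "expands X P b p L'"
proof -
  obtain u v where u: "continuous_map L' L u" and v: "continuous_map L L' v" and vu: "homot L' L' (v \<circ> u) id"
    using eq unfolding homotopy_equivalent_space_def by blast
  show ?thesis unfolding expands_def
  proof (intro conjI allI impI)
    fix h assume h: "continuous_map X L' h"
    obtain n f where f: "continuous_map (P n) L f" "homot X L (f \<circ> p n) (u \<circ> h)"
      using expands_ex[OF ex continuous_map_compose[OF h u]] .
    have "homot X L' (v \<circ> (f \<circ> p n)) (v \<circ> (u \<circ> h))" by (rule homot_comp_left[OF f(2) v])
    also have "homot X L' (v \<circ> (u \<circ> h)) h"
      using homot_comp_right[OF vu h] by (simp add: comp_assoc)
    finally have "homot X L' ((v \<circ> f) \<circ> p n) h" by (simp only: comp_assoc)
    then show "\<exists>n f. continuous_map (P n) L' f \<and> homot X L' (f \<circ> p n) h"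
      using continuous_map_compose[OF f(1) v] by blast
  next
    fix n f g assume f: "continuous_map (P n) L' f" and g: "continuous_map (P n) L' g"
      and fg: "homot X L' (f \<circ> p n) (g \<circ> p n)"
    have ufg: "homot X L ((u \<circ> f) \<circ> p n) ((u \<circ> g) \<circ> p n)"
      using homot_comp_left[OF fg u] by (simp add: comp_assoc)
    obtain k where k: "homot (P (n + k)) L ((u \<circ> f) \<circ> comp_bond b n k) ((u \<circ> g) \<circ> comp_bond b n k)"
      using expands_eq[OF ex continuous_map_compose[OF f u] continuous_map_compose[OF g u] ufg] ..
    have retr: "homot (P (n + k)) L' (v \<circ> ((u \<circ> q) \<circ> comp_bond b n k)) (q \<circ> comp_bond b n k)"
      if q: "continuous_map (P n) L' q" for q
      using homot_comp_right[OF vu continuous_map_compose[OF comp_bond_cont q]] by (simp add: comp_assoc)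
    have "homot (P (n + k)) L' (f \<circ> comp_bond b n k) (v \<circ> ((u \<circ> f) \<circ> comp_bond b n k))"
      by (rule homotopic_with_symD[OF retr[OF f]])
    also have "homot (P (n + k)) L' \<dots> (v \<circ> ((u \<circ> g) \<circ> comp_bond b n k))"
      by (rule homot_comp_left[OF k v])
    also have "homot (P (n + k)) L' \<dots> (g \<circ> comp_bond b n k)" by (rule retr[OF g])
    finally show "\<exists>k. homot (P (n + k)) L' (f \<circ> comp_bond b n k) (g \<circ> comp_bond b n k)" by blast
  qed
qed

end

section \<open>Transfer along pro-isomorphisms\<close>

text \<open>A levelwise map \<open>s\<close> is invertible in pro-HTop when each level has a map
  back from a later stage making both triangles commute up to homotopy (Morita's criterion). The
  shift \<open>k\<close> is 0 where stages are homotopy equivalent, 1 for the Rips and witness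
  complexes, 2 for the lower Dowker complexes.\<close>

locale interleaving = cone P b X p + P': map_sequence P' b'
  for P :: "nat \<Rightarrow> 's topology" and b X and p :: "nat \<Rightarrow> 'a \<Rightarrow> 's"
    and P' :: "nat \<Rightarrow> 't topology" and b' +
  fixes s :: "nat \<Rightarrow> 's \<Rightarrow> 't"
  assumes s_cont: "continuous_map (P n) (P' n) (s n)"
    and s_bond: "homot (P (Suc n)) (P' n) (s n \<circ> b n) (b' n \<circ> s (Suc n))"
    and s_back: "\<exists>k l. continuous_map (P' (n + k)) (P n) l \<and>
      homot (P (n + k)) (P n) (l \<circ> s (n + k)) (comp_bond b n k) \<and>
      homot (P' (n + k)) (P' n) (s n \<circ> l) (comp_bond b' n k)"
begin

lemma s_comp_bond: "homot (P (n + k)) (P' n) (s n \<circ> comp_bond b n k) (comp_bond b' n k \<circ> s (n + k))"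
proof (induction k)
  case 0
  show "homot (P (n + 0)) (P' n) (s n \<circ> comp_bond b n 0) (comp_bond b' n 0 \<circ> s (n + 0))" unfolding comp_bond.simps using s_cont by simp
next
  case (Suc k)
  have IH: "homot (P (n + k)) (P' n) (s n \<circ> comp_bond b n k) (comp_bond b' n k \<circ> s (n + k))"
    using Suc .
  have "homot (P (n + Suc k)) (P' n) (s n \<circ> comp_bond b n k \<circ> b (n + k)) (comp_bond b' n k \<circ> s (n + k) \<circ> b (n + k))"
    using homot_comp_right[OF IH bond_cont[of "n + k"]] by simp
  also have "homot (P (n + Suc k)) (P' n) \<dots> (comp_bond b' n k \<circ> b' (n + k) \<circ> s (n + Suc k))"
    using homot_comp_left[OF s_bond[of "n + k"] P'.comp_bond_cont[of n k]] by (simp add: comp_assoc)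
  finally show "homot (P (n + (Suc k))) (P' n) (s n \<circ> comp_bond b n (Suc k)) (comp_bond b' n (Suc k) \<circ> s (n + (Suc k)))" by (simp only: comp_bond.simps add_Suc_right comp_assoc)
qed

sublocale target: cone P' b' X "\<lambda>n. s n \<circ> p n"
proof
  fix n
  show "continuous_map X (P' n) (s n \<circ> p n)" by (rule continuous_map_compose[OF p_cont s_cont])
  have "homot X (P' n) (s n \<circ> p n) (s n \<circ> (b n \<circ> p (Suc n)))" by (rule homot_comp_left[OF p_compat s_cont])
  also have "homot X (P' n) \<dots> (b' n \<circ> (s (Suc n) \<circ> p (Suc n)))"
    using homot_comp_right[OF s_bond p_cont] by (simp add: comp_assoc)
  finally show "homot X (P' n) (s n \<circ> p n) (b' n \<circ> (s (Suc n) \<circ> p (Suc n)))" .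
qed

text \<open>Surjectivity uses \<open>l \<circ> s\<close>: a factorization through \<open>P n\<close>
  is continued by \<open>l\<close> to stage \<open>n + k\<close> of \<open>P'\<close>. Injectivity
  uses \<open>s \<circ> l\<close>: two maps are pulled back along \<open>s\<close>, equalized on a
  later stage of \<open>P\<close>, and brought back to \<open>P'\<close> by
  \<open>l\<close>.\<close>

lemma expands_transfer:
  assumes ex: "expands X P b p L"
  shows "expands X P' b' (\<lambda>n. s n \<circ> p n) L"
  unfolding expands_def
proof (intro conjI allI impI)
  fix h assume h: "continuous_map X L h"
  obtain n f where f: "continuous_map (P n) L f" "homot X L (f \<circ> p n) h"
    using expands_ex[OF ex h] .
  obtain k l where l: "continuous_map (P' (n + k)) (P n) l"
      "homot (P (n + k)) (P n) (l \<circ> s (n + k)) (comp_bond b n k)"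
    using s_back by blast
  have "homot X L (f \<circ> ((l \<circ> s (n + k)) \<circ> p (n + k))) (f \<circ> (comp_bond b n k \<circ> p (n + k)))"
    by (intro homot_comp_left[OF _ f(1)] homot_comp_right[OF l(2) p_cont])
  also have "homot X L \<dots> (f \<circ> p n)"
    by (rule homotopic_with_symD[OF homot_comp_left[OF p_comp_bond f(1)]])
  also note f(2)
  finally have "homot X L ((f \<circ> l) \<circ> (s (n + k) \<circ> p (n + k))) h" by (simp only: comp_assoc)
  then show "\<exists>n f. continuous_map (P' n) L f \<and> homot X L (f \<circ> (s n \<circ> p n)) h"
    using continuous_map_compose[OF l(1) f(1)] by blast
next
  fix n f g assume f: "continuous_map (P' n) L f" and g: "continuous_map (P' n) L g"
    and fg: "homot X L (f \<circ> (s n \<circ> p n)) (g \<circ> (s n \<circ> p n))"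
  have fg': "homot X L ((f \<circ> s n) \<circ> p n) ((g \<circ> s n) \<circ> p n)"
    using fg by (simp only: comp_assoc)
  obtain k where k: "homot (P (n + k)) L ((f \<circ> s n) \<circ> comp_bond b n k) ((g \<circ> s n) \<circ> comp_bond b n k)"
    using expands_eq[OF ex continuous_map_compose[OF s_cont f] continuous_map_compose[OF s_cont g] fg'] ..
  obtain j l where l: "continuous_map (P' (n + k + j)) (P (n + k)) l"
      "homot (P' (n + k + j)) (P' (n + k)) (s (n + k) \<circ> l) (comp_bond b' (n + k) j)"
    using s_back[of "n + k"] by blast
  \<comment> \<open>Going back by \<open>l\<close>, down in \<open>P\<close> and across by
    \<open>s\<close> is homotopic to going down in \<open>P'\<close>, with \<open>k\<close> steps
    for the equalization and \<open>j\<close> for \<open>l\<close>.\<close>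
  have push: "homot (P' (n + k + j)) L ((q \<circ> s n) \<circ> comp_bond b n k \<circ> l) (q \<circ> comp_bond b' n (k + j))"
    if q: "continuous_map (P' n) L q" for q
  proof -
    have "homot (P' (n + k + j)) L (q \<circ> ((s n \<circ> comp_bond b n k) \<circ> l)) (q \<circ> ((comp_bond b' n k \<circ> s (n + k)) \<circ> l))"
      by (intro homot_comp_left[OF _ q] homot_comp_right[OF s_comp_bond l(1)])
    also have "homot (P' (n + k + j)) L (q \<circ> (comp_bond b' n k \<circ> s (n + k) \<circ> l))
        (q \<circ> (comp_bond b' n k \<circ> comp_bond b' (n + k) j))"
      unfolding comp_assoc by (intro homot_comp_left[OF _ q] homot_comp_left[OF l(2)] P'.comp_bond_cont)
    finally show ?thesis by (simp add: comp_assoc comp_bond_add)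
  qed
  have "homot (P' (n + k + j)) L (f \<circ> comp_bond b' n (k + j)) ((f \<circ> s n) \<circ> comp_bond b n k \<circ> l)"
    by (rule homotopic_with_symD[OF push[OF f]])
  also have "homot (P' (n + k + j)) L \<dots> ((g \<circ> s n) \<circ> comp_bond b n k \<circ> l)"
    by (rule homot_comp_right[OF k l(1)])
  also have "homot (P' (n + k + j)) L \<dots> (g \<circ> comp_bond b' n (k + j))" by (rule push[OF g])
  finally show "\<exists>k. homot (P' (n + k)) L (f \<circ> comp_bond b' n k) (g \<circ> comp_bond b' n k)"
    unfolding add.assoc by blast
qed

end

section \<open>A criterion for universality\<close>

lemma const_simps: "idx (const_system X) = UNIV" "space_at (const_system X) u = X"
  by (simp_all add: const_system_def)

text \<open>One index and identity bonds: the colimit over the constant system is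
  \<open>HTop_hom X Y\<close> itself.\<close>

lemma germ_const_eq_iff:
  assumes "F \<in> HTop_hom X Y" "G \<in> HTop_hom X Y"
  shows "germ (const_system X) Y () F = germ (const_system X) Y () G \<longleftrightarrow> F = G"
proof -
  have "germ (const_system X) Y () F = germ (const_system X) Y () G \<longleftrightarrow>
      hcomp X Y F (hclass X X id) = hcomp X Y G (hclass X X id)"
    using germ_eq_iff[OF inverse_system_const[of X], of "()" F Y "()" G] assms
    by (simp add: const_system_def)
  then show ?thesis using assms by (simp add: hcomp_id_right)
qed

context cone
begin

abbreviation S where "S \<equiv> map_system P b"
abbreviation C where "C \<equiv> const_system X"
abbreviation pc where "pc n \<equiv> hclass X (P n) (p n)"

definition pro_cone where "pro_cone = (\<lambda>n. germ C (P n) () (pc n))"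

lemma pc_in: "pc n \<in> HTop_hom X (P n)"
  by (rule hclass_in_HTop_hom[OF p_cont])

lemma push_pro_cone:
  "F \<in> HTop_hom (P n) L \<Longrightarrow> colim_push C L F (pro_cone n) = germ C L () (hcomp X L F (pc n))"
  using colim_push_germ[OF inverse_system_const[of X], of "()" "pc n" "P n" F L] pc_in
  by (simp add: pro_cone_def const_simps)

lemma pro_cone_in: "pro_cone \<in> pro_hom C S"
  unfolding pro_hom_def system_simps
proof (intro CollectI conjI PiE_I ballI impI)
  fix n
  show "pro_cone n \<in> colim_hom C (P n)"
    using germ_in_colim_hom[OF inverse_system_const[of X], of "()" "pc n"] pc_in
    by (simp add: pro_cone_def const_simps)
next
  fix n m :: nat assume "n \<le> m"
  then obtain k where m: "m = n + k" using le_Suc_ex by blast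
  have "hcomp X (P n) (bond S n m) (pc m) = pc n"
    unfolding m bond_eq hcomp_hclass[OF p_cont comp_bond_cont]
    by (rule hclass_eqI[OF homotopic_with_symD[OF p_comp_bond]])
  moreover have "bond S n m \<in> HTop_hom (P m) (P n)"
    unfolding m bond_eq by (rule hclass_in_HTop_hom[OF comp_bond_cont])
  ultimately show "colim_push C (P n) (bond S n m) (pro_cone m) = pro_cone n"
    using push_pro_cone[of "bond S n m" m "P n"] by (simp add: pro_cone_def)
qed simp

lemma factor_exists:
  assumes "expands X P b p L" "H \<in> HTop_hom X L"
  obtains n F where "F \<in> HTop_hom (P n) L" "hcomp X L F (pc n) = H"
proof -
  obtain h where h: "continuous_map X L h" "H = hclass X L h" using assms(2) by (rule HTop_homE)
  obtain n f where f: "continuous_map (P n) L f" "homot X L (f \<circ> p n) h"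
    using expands_ex[OF assms(1) h(1)] .
  show ?thesis
    using that[OF hclass_in_HTop_hom[OF f(1)]] hcomp_hclass[OF p_cont f(1)] hclass_eqI[OF f(2)] h by simp
qed

lemma factor_unique:
  assumes ex: "expands X P b p L" and F: "F \<in> HTop_hom (P n) L" and G: "G \<in> HTop_hom (P m) L"
    and eq: "hcomp X L F (pc n) = hcomp X L G (pc m)"
  shows "germ S L n F = germ S L m G"
proof -
  obtain f where f: "continuous_map (P n) L f" "F = hclass (P n) L f" using F by (rule HTop_homE)
  obtain g where g: "continuous_map (P m) L g" "G = hclass (P m) L g" using G by (rule HTop_homE)
  \<comment> \<open>The injectivity clause of \<open>expands\<close> speaks of one stage, so both
    maps are first pulled back to the stage \<open>n + i = m + j\<close>.\<close>
  obtain i j where ij: "n + i = m + j" by (metis add.commute)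
  let ?f = "f \<circ> comp_bond b n i" and ?g = "g \<circ> comp_bond b m j"
  have f': "continuous_map (P (n + i)) L ?f" by (rule continuous_map_compose[OF comp_bond_cont f(1)])
  have g': "continuous_map (P (n + i)) L ?g"
    unfolding ij by (rule continuous_map_compose[OF comp_bond_cont g(1)])
  have "homot X L (?f \<circ> p (n + i)) (f \<circ> p n)"
    unfolding comp_assoc by (rule homotopic_with_symD[OF homot_comp_left[OF p_comp_bond f(1)]])
  also have "homot X L (f \<circ> p n) (g \<circ> p m)"
    using eq hclass_eq_iff[OF continuous_map_compose[OF p_cont f(1)]]
      hcomp_hclass[OF p_cont f(1)] hcomp_hclass[OF p_cont g(1)] f(2) g(2) by simp
  also have "homot X L (g \<circ> p m) (?g \<circ> p (n + i))"
    unfolding comp_assoc ij by (rule homot_comp_left[OF p_comp_bond g(1)])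
  finally have fg: "homot X L (?f \<circ> p (n + i)) (?g \<circ> p (n + i))" .
  obtain k where k: "homot (P (n + i + k)) L (?f \<circ> comp_bond b (n + i) k) (?g \<circ> comp_bond b (n + i) k)"
    using expands_eq[OF ex f' g' fg] ..
  have "hcomp (P (n + i + k)) L F (bond S n (n + i + k)) = hcomp (P (n + i + k)) L G (bond S m (n + i + k))"
  proof -
    have "hcomp (P (n + (i + k))) L F (bond S n (n + (i + k))) = hclass (P (n + (i + k))) L (f \<circ> comp_bond b n (i + k))"
      unfolding bond_eq f(2) by (rule hcomp_hclass[OF comp_bond_cont f(1)])
    moreover have "hcomp (P (m + (j + k))) L G (bond S m (m + (j + k))) = hclass (P (m + (j + k))) L (g \<circ> comp_bond b m (j + k))"
      unfolding bond_eq g(2) by (rule hcomp_hclass[OF comp_bond_cont g(1)])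
    moreover have "n + (i + k) = n + i + k" "m + (j + k) = n + i + k" using ij by auto
    moreover have "hclass (P (n + i + k)) L (f \<circ> comp_bond b n (i + k)) = hclass (P (n + i + k)) L (g \<circ> comp_bond b m (j + k))"
      using hclass_eqI[OF k] ij by (simp add: comp_bond_add comp_assoc)
    ultimately show ?thesis by simp
  qed
  then have "\<exists>l\<in>idx S. ile S n l \<and> ile S m l \<and>
      hcomp (space_at S l) L F (bond S n l) = hcomp (space_at S l) L G (bond S m l)"
    unfolding system_simps using ij by (intro bexI[of _ "n + i + k"] conjI) auto
  then show ?thesis
    by (intro iffD2[OF germ_eq_iff[OF inverse_system_map_system]]) (simp_all add: system_simps F G)
qed

text \<open>The factorizations \<open>F k\<close> are chosen independently for each index
  \<open>k\<close>, at unrelated stages \<open>N k\<close>. That their germs are compatible, and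
  that any other factorization has the same germs, both follow from
  \<open>factor_unique\<close>.\<close>

lemma pro_cone_universal:
  assumes ex: "\<And>K :: 'v set set. simplicial_complex K \<Longrightarrow> expands X P b p (realization K)"
  shows "HPol_universal TYPE('v) TYPE(('m, 'b) inv_system) X S pro_cone"
  unfolding HPol_universal_def
proof (intro conjI allI impI ballI pro_cone_in)
  fix Y :: "('m, 'b) inv_system" and h
  assume Y: "HPol_system TYPE('v) Y" and h: "h \<in> pro_hom C Y"
  have Y': "inverse_system Y" using Y by (simp add: HPol_system_def)
  have exY: "expands X P b p (space_at Y k)" if "k \<in> idx Y" for k
  proof -
    have "in_HPol TYPE('v) (space_at Y k)" using Y that by (simp add: HPol_system_def)
    then obtain K :: "'v set set" where K: "simplicial_complex K" "space_at Y k homotopy_equivalent_space realization K"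
      unfolding in_HPol_def by (elim exE conjE)
    show ?thesis by (rule expands_homotopy_equivalent[OF ex[OF K(1)] K(2)])
  qed
  have "\<forall>k\<in>idx Y. \<exists>H n F. H \<in> HTop_hom X (space_at Y k) \<and> h k = germ C (space_at Y k) () H \<and>
      F \<in> HTop_hom (P n) (space_at Y k) \<and> hcomp X (space_at Y k) F (pc n) = H"
  proof
    fix k assume k: "k \<in> idx Y"
    obtain u H where H: "H \<in> HTop_hom X (space_at Y k)" "h k = germ C (space_at Y k) u H"
      by (rule colim_homE[OF inverse_system_const pro_hom_in[OF h k]]) (simp add: const_simps)
    obtain n F where F: "F \<in> HTop_hom (P n) (space_at Y k)" "hcomp X (space_at Y k) F (pc n) = H"
      by (rule factor_exists[OF exY[OF k] H(1)])
    show "\<exists>H n F. H \<in> HTop_hom X (space_at Y k) \<and> h k = germ C (space_at Y k) () H \<and>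
      F \<in> HTop_hom (P n) (space_at Y k) \<and> hcomp X (space_at Y k) F (pc n) = H"
      using H F by (intro exI[of _ H] exI[of _ n] exI[of _ F]) simp
  qed
  then obtain H N F where H: "\<And>k. k \<in> idx Y \<Longrightarrow> H k \<in> HTop_hom X (space_at Y k)"
    and hH: "\<And>k. k \<in> idx Y \<Longrightarrow> h k = germ C (space_at Y k) () (H k)"
    and F: "\<And>k. k \<in> idx Y \<Longrightarrow> F k \<in> HTop_hom (P (N k)) (space_at Y k)"
    and FH: "\<And>k. k \<in> idx Y \<Longrightarrow> hcomp X (space_at Y k) (F k) (pc (N k)) = H k"
    by metis
  define f where "f = (\<lambda>k\<in>idx Y. germ S (space_at Y k) (N k) (F k))"
  note S' = inverse_system_map_system and C' = inverse_system_const[of X]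
  have comp_eq: "pro_comp C Y q pro_cone k = germ C (space_at Y k) () (hcomp X (space_at Y k) G (pc n))"
    if "k \<in> idx Y" "G \<in> HTop_hom (P n) (space_at Y k)" "q k = germ S (space_at Y k) n G" for q k n G
    using pro_comp_apply[where k=k and \<psi>=q, OF C' S' pro_cone_in that(1), of n G] push_pro_cone[OF that(2)] that(2,3)
    by (simp add: system_simps)
  have fin: "f \<in> pro_hom S Y"
    unfolding pro_hom_def
  proof (intro CollectI conjI PiE_I ballI impI)
    fix k assume "k \<in> idx Y"
    then show "f k \<in> colim_hom S (space_at Y k)"
      using germ_in_colim_hom[OF S', of "N k" "F k"] F by (simp add: f_def system_simps)
  next
    fix k assume "k \<notin> idx Y" then show "f k = undefined" by (simp add: f_def)
  next
    fix k k' assume k: "k \<in> idx Y" "k' \<in> idx Y" "ile Y k k'"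
    let ?BF = "hcomp (P (N k')) (space_at Y k) (bond Y k k') (F k')"
    have B: "bond Y k k' \<in> HTop_hom (space_at Y k') (space_at Y k)" using bond_in[OF Y'] k by blast
    have "germ C (space_at Y k) () (hcomp X (space_at Y k) (bond Y k k') (H k')) = germ C (space_at Y k) () (H k)"
      using pro_hom_compat[OF h k] hH[OF k(1)] hH[OF k(2)]
        colim_push_germ[OF C', of "()" "H k'" "space_at Y k'" "bond Y k k'"] H[OF k(2)] B
      by (simp add: const_simps)
    then have BH: "hcomp X (space_at Y k) (bond Y k k') (H k') = H k"
      using germ_const_eq_iff[OF hcomp_in[OF H[OF k(2)] B] H[OF k(1)]] by simp
    have "hcomp X (space_at Y k) ?BF (pc (N k')) = hcomp X (space_at Y k) (F k) (pc (N k))"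
      using hcomp_assoc[OF pc_in F[OF k(2)] B] FH[OF k(1)] FH[OF k(2)] BH by simp
    then have "germ S (space_at Y k) (N k') ?BF = germ S (space_at Y k) (N k) (F k)"
      by (rule factor_unique[OF exY[OF k(1)] hcomp_in[OF F[OF k(2)] B] F[OF k(1)]])
    then show "colim_push S (space_at Y k) (bond Y k k') (f k') = f k"
      using colim_push_germ[OF S', of "N k'" "F k'" "space_at Y k'" "bond Y k k'" "space_at Y k"] F[OF k(2)] B k by (simp add: f_def system_simps)
  qed
  show "\<exists>!f. f \<in> pro_hom S Y \<and> pro_comp C Y f pro_cone = h"
  proof (rule ex1I[of _ f], intro conjI fin)
    show "pro_comp C Y f pro_cone = h"
    proof (rule pro_hom_ext[OF pro_comp_in[OF C' S' Y' pro_cone_in fin] h])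
      fix k assume k: "k \<in> idx Y"
      show "pro_comp C Y f pro_cone k = h k"
        using comp_eq[OF k F[OF k], of f] FH[OF k] hH[OF k] k by (simp add: f_def)
    qed
  next
    fix q assume q: "q \<in> pro_hom S Y \<and> pro_comp C Y q pro_cone = h"
    show "q = f"
    proof (rule pro_hom_ext[OF conjunct1[OF q] fin])
      fix k assume k: "k \<in> idx Y"
      obtain n G where G: "G \<in> HTop_hom (P n) (space_at Y k)" "q k = germ S (space_at Y k) n G"
        using colim_homE[OF S' pro_hom_in[OF conjunct1[OF q] k]] by (metis system_simps(3))
      have "germ C (space_at Y k) () (hcomp X (space_at Y k) G (pc n)) = germ C (space_at Y k) () (H k)"
        using comp_eq[where q=q, OF k G] hH[OF k] q by simp
      then have "hcomp X (space_at Y k) G (pc n) = hcomp X (space_at Y k) (F k) (pc (N k))"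
        using germ_const_eq_iff[OF hcomp_in[OF pc_in G(1)] H[OF k]] FH[OF k] by simp
      then show "q k = f k"
        using factor_unique[OF exY[OF k] G(1) F[OF k]] G(2) k by (simp add: f_def)
    qed
  qed
qed

end

section \<open>Geometric realizations\<close>

abbreviation supp :: "('v \<Rightarrow> real) \<Rightarrow> 'v set" where
  "supp t \<equiv> {v. t v \<noteq> 0}"

lemma closed_faceI:
  assumes "\<And>v. 0 \<le> t v" "supp t \<subseteq> \<sigma>" "sum t \<sigma> = 1"
  shows "t \<in> closed_face \<sigma>"
  using assms by (auto simp: closed_face_def)

lemma closed_faceD:
  assumes "t \<in> closed_face \<sigma>"
  shows "0 \<le> t v" "supp t \<subseteq> \<sigma>" "sum t \<sigma> = 1"
  using assms by (auto simp: closed_face_def)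

lemma closed_face_le_1:
  assumes "finite \<sigma>" "t \<in> closed_face \<sigma>"
  shows "t v \<le> 1"
proof (cases "v \<in> \<sigma>")
  case True
  then have "t v \<le> sum t \<sigma>" using assms by (intro member_le_sum) (auto simp: closed_face_def)
  then show ?thesis using closed_faceD(3)[OF assms(2)] by simp
next
  case False
  then show ?thesis using assms by (auto simp: closed_face_def)
qed

lemma closed_face_subset:
  assumes "t \<in> closed_face \<sigma>" "supp t \<subseteq> \<tau>" "finite \<sigma>" "finite \<tau>"
  shows "t \<in> closed_face \<tau>"
proof (rule closed_faceI)
  have "sum t \<tau> = sum t (supp t)" using assms by (intro sum.mono_neutral_right) auto
  also have "\<dots> = sum t \<sigma>" using assms closed_faceD(2)[OF assms(1)]
    by (intro sum.mono_neutral_left) auto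
  finally show "sum t \<tau> = 1" using closed_faceD(3)[OF assms(1)] by simp
qed (use assms closed_faceD in auto)

lemma closed_face_mono: "t \<in> closed_face \<sigma> \<Longrightarrow> \<sigma> \<subseteq> \<tau> \<Longrightarrow> finite \<tau> \<Longrightarrow> t \<in> closed_face \<tau>"
  using closed_face_subset[of t \<sigma> \<tau>] closed_faceD(2)[of t \<sigma>] finite_subset by blast

lemma supp_nonempty: "t \<in> closed_face \<sigma> \<Longrightarrow> supp t \<noteq> {}"
  using closed_faceD(3)[of t \<sigma>] sum.neutral[of \<sigma> t] by fastforce

lemma closed_face_supp:
  "t \<in> closed_face \<sigma> \<Longrightarrow> finite \<sigma> \<Longrightarrow> t \<in> closed_face (supp t)"
  using closed_face_subset[of t \<sigma> "supp t"] closed_faceD(2)[of t \<sigma>] finite_subset by blast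

lemma simplicial_complexD:
  assumes "simplicial_complex K" "\<sigma> \<in> K"
  shows "finite \<sigma>" "\<sigma> \<noteq> {}" "\<tau> \<subseteq> \<sigma> \<Longrightarrow> \<tau> \<noteq> {} \<Longrightarrow> \<tau> \<in> K"
  using assms unfolding simplicial_complex_def by blast+

lemma supp_in_complex:
  assumes "simplicial_complex K" "t \<in> closed_face \<sigma>" "\<sigma> \<in> K"
  shows "supp t \<in> K"
  using simplicial_complexD(3)[OF assms(1,3) closed_faceD(2)[OF assms(2)] supp_nonempty[OF assms(2)]] .

lemma topspace_realizationE:
  assumes "t \<in> topspace (realization K)"
  obtains \<sigma> where "\<sigma> \<in> K" "t \<in> closed_face \<sigma>"
  using assms by (auto simp: topspace_realization)

lemma continuous_coordinate: "continuous_on A (\<lambda>t :: 'v \<Rightarrow> real. t v)"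
  by (rule continuous_on_subset[OF continuous_on_product_coordinates]) simp

lemma closed_closed_face:
  assumes "finite \<sigma>"
  shows "closed (closed_face \<sigma>)"
proof -
  have "closed_face \<sigma> = (\<Inter>v. {t. 0 \<le> t v}) \<inter> (\<Inter>v\<in>-\<sigma>. {t. t v = 0}) \<inter> {t. sum t \<sigma> = 1}"
    by (auto simp: closed_face_def)
  moreover have "closed \<dots>"
    by (intro closed_Int closed_INT ballI closed_Collect_le closed_Collect_eq continuous_on_sum
        continuous_coordinate continuous_on_const)
  ultimately show ?thesis by simp
qed

lemma compact_closed_face:
  assumes "finite \<sigma>"
  shows "compact (closed_face \<sigma> :: ('v \<Rightarrow> real) set)"
proof -
  have "compactin (product_topology (\<lambda>i::'v. euclideanreal) UNIV) (PiE UNIV (\<lambda>_. {0..1}))"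
    by (subst compactin_PiE) auto
  then have "compact (PiE UNIV (\<lambda>_. {0..1}) :: ('v \<Rightarrow> real) set)"
    by (simp add: euclidean_product_topology)
  moreover have "closed_face \<sigma> \<subseteq> PiE UNIV (\<lambda>_. {0..1})"
    using closed_faceD(1) closed_face_le_1[OF assms] by auto
  ultimately show ?thesis
    using compact_Int_closed[OF _ closed_closed_face[OF assms]] by (metis inf.absorb2)
qed

text \<open>Faces of finite simplices are closed in the product topology, so a set that is
  relatively closed in each of finitely many of them is closed; hence the weak topology has no
  further open sets.\<close>

lemma realization_finite:
  assumes "finite K" "\<And>\<sigma>. \<sigma> \<in> K \<Longrightarrow> finite \<sigma>"
  shows "realization K = top_of_set (\<Union>\<sigma>\<in>K. closed_face \<sigma>)"
proof (rule topology_eq[THEN iffD2], intro allI iffI)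
  let ?T = "\<Union>\<sigma>\<in>K. closed_face \<sigma>"
  fix U
  assume "openin (realization K) U"
  then have sub: "U \<subseteq> ?T" and op: "\<And>\<sigma>. \<sigma> \<in> K \<Longrightarrow> openin (top_of_set (closed_face \<sigma>)) (U \<inter> closed_face \<sigma>)"
    by (auto simp: openin_realization)
  have "closed (closed_face \<sigma> - U)" if "\<sigma> \<in> K" for \<sigma>
  proof -
    have "closedin (top_of_set (closed_face \<sigma>)) (closed_face \<sigma> - (U \<inter> closed_face \<sigma>))"
      using op[OF that] openin_closedin_eq[of "top_of_set (closed_face \<sigma>)" "U \<inter> closed_face \<sigma>"] by simp
    moreover have "closed_face \<sigma> - (U \<inter> closed_face \<sigma>) = closed_face \<sigma> - U" by blast
    ultimately show ?thesis using closedin_closed_trans closed_closed_face[OF assms(2)[OF that]] by simp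
  qed
  then have "closed (\<Union>\<sigma>\<in>K. closed_face \<sigma> - U)" using assms(1) by blast
  then have "openin (top_of_set ?T) (?T \<inter> - (\<Union>\<sigma>\<in>K. closed_face \<sigma> - U))"
    by (intro openin_open_Int open_Compl)
  moreover have "?T \<inter> - (\<Union>\<sigma>\<in>K. closed_face \<sigma> - U) = U" using sub by blast
  ultimately show "openin (top_of_set ?T) U" by simp
next
  let ?T = "\<Union>\<sigma>\<in>K. closed_face \<sigma>"
  fix U
  assume "openin (top_of_set ?T) U"
  then obtain W where W: "open W" "U = ?T \<inter> W" by (auto simp: openin_open)
  show "openin (realization K) U"
    unfolding openin_realization
  proof (intro conjI ballI)
    fix \<sigma> assume "\<sigma> \<in> K"
    then have "U \<inter> closed_face \<sigma> = closed_face \<sigma> \<inter> W" using W by blast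
    then show "openin (top_of_set (closed_face \<sigma>)) (U \<inter> closed_face \<sigma>)" using W by (simp add: openin_open_Int)
  qed (use W in blast)
qed

lemma compact_space_realization:
  assumes "finite K" "simplicial_complex K"
  shows "compact_space (realization K)"
proof -
  have "compact (\<Union>\<sigma>\<in>K. closed_face \<sigma>)"
    using assms compact_closed_face simplicial_complexD(1)[OF assms(2)] by (intro compact_UN) auto
  then show ?thesis
    using realization_finite[OF assms(1) simplicial_complexD(1)[OF assms(2)]]
    by (simp add: compact_space_subtopology)
qed

lemma continuous_map_coordinate:
  "continuous_map (realization K) euclideanreal (\<lambda>t. t v)"
  unfolding continuous_map_alt
proof (intro conjI allI impI)
  fix U :: "real set"
  assume "openin euclidean U"
  then have U: "open U" by simp
  show "openin (realization K) ((\<lambda>t. t v) -` U \<inter> topspace (realization K))"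
    unfolding openin_realization
  proof (intro conjI ballI)
    fix \<sigma> assume "\<sigma> \<in> K"
    then have "(\<lambda>t. t v) -` U \<inter> topspace (realization K) \<inter> closed_face \<sigma> = closed_face \<sigma> \<inter> (\<lambda>t. t v) -` U"
      by (auto simp: topspace_realization)
    then show "openin (top_of_set (closed_face \<sigma>)) ((\<lambda>t. t v) -` U \<inter> topspace (realization K) \<inter> closed_face \<sigma>)"
      using continuous_openin_preimage_gen[OF continuous_coordinate U] by simp
  qed (simp add: topspace_realization)
qed simp

lemma continuous_map_coordinateD:
  "continuous_map Z (realization K) f \<Longrightarrow> continuous_map Z euclideanreal (\<lambda>z. f z v)"
  using continuous_map_compose[OF _ continuous_map_coordinate, of Z K f v] by (simp add: o_def)

lemma openin_star: "openin (realization K) {t \<in> topspace (realization K). t v \<noteq> 0}"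
proof -
  have "open (- {0 :: real})" by blast
  then have "openin (realization K) {t \<in> topspace (realization K). t v \<in> - {0}}"
    by (intro openin_continuous_map_preimage[OF continuous_map_coordinate]) simp
  then show ?thesis by simp
qed

text \<open>Finitely many simplices carry the image, so the weak topology is that of the coordinates.\<close>

lemma continuous_map_realizationI:
  assumes K0: "finite K0" "K0 \<subseteq> K" and K: "simplicial_complex K"
    and face: "\<And>z. z \<in> topspace Z \<Longrightarrow> \<exists>\<sigma>\<in>K0. f z \<in> closed_face \<sigma>"
    and cont: "\<And>v. continuous_map Z euclideanreal (\<lambda>z. f z v)"
  shows "continuous_map Z (realization K) f"
proof -
  have fin: "\<And>\<sigma>. \<sigma> \<in> K0 \<Longrightarrow> finite \<sigma>" using K0(2) simplicial_complexD(1)[OF K] by blast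
  have "continuous_map Z euclidean f"
    using continuous_map_componentwise_UNIV[of Z "\<lambda>_. euclideanreal" f] cont
    by (simp add: euclidean_product_topology)
  then have "continuous_map Z (top_of_set (\<Union>\<sigma>\<in>K0. closed_face \<sigma>)) f"
    using face by (auto simp: continuous_map_in_subtopology)
  then have f: "continuous_map Z (realization K0) f"
    using realization_finite[OF K0(1) fin] by simp
  have "continuous_map (realization K0) (realization K) id"
    unfolding continuous_map_alt
  proof (intro conjI allI impI)
    show "id \<in> topspace (realization K0) \<rightarrow> topspace (realization K)"
      using K0(2) by (auto simp: topspace_realization)
    fix U assume U: "openin (realization K) U"
    show "openin (realization K0) (id -` U \<inter> topspace (realization K0))"
      unfolding openin_realization
    proof (intro conjI ballI)
      fix \<sigma> assume s: "\<sigma> \<in> K0"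
      then have "id -` U \<inter> topspace (realization K0) \<inter> closed_face \<sigma> = U \<inter> closed_face \<sigma>"
        by (auto simp: topspace_realization)
      then show "openin (top_of_set (closed_face \<sigma>)) (id -` U \<inter> topspace (realization K0) \<inter> closed_face \<sigma>)"
        using U s K0(2) by (auto simp: openin_realization)
    qed (simp add: topspace_realization)
  qed
  from continuous_map_compose[OF f this] show ?thesis by simp
qed

lemma closed_function_point: "closed {t :: 'v \<Rightarrow> real}"
proof -
  have "{t} = (\<Inter>v. {x. x v = t v})" by (auto simp: fun_eq_iff)
  moreover have "closed \<dots>"
    by (intro closed_INT ballI closed_Collect_eq continuous_coordinate continuous_on_const)
  ultimately show ?thesis by simp
qed

text \<open>A set containing at most one point per carrier is closed and discrete in the realization.\<close>

lemma finite_carriers: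
  assumes K: "simplicial_complex K" and C: "compactin (realization K) C"
  shows "finite (supp ` C)"
proof (rule ccontr)
  assume inf: "infinite (supp ` C)"
  let ?T = "topspace (realization K)"
  \<comment> \<open>One point for each carrier occurring in \<open>C\<close>, so that
    \<open>S\<close> is infinite but meets every closed face in a finite set.\<close>
  obtain S where S: "S \<subseteq> C" "inj_on supp S" "supp ` C = supp ` S"
    using subset_image_inj[of "supp ` C" supp C] by auto
  have infS: "infinite S" using inf S(3) by auto
  have CT: "C \<subseteq> ?T" using C compactin_subset_topspace by blast
  have op: "openin (realization K) (?T - S')" if S': "S' \<subseteq> S" for S'
    unfolding openin_realization
  proof (intro conjI ballI)
    fix \<sigma> assume s: "\<sigma> \<in> K"
    have "supp ` (S' \<inter> closed_face \<sigma>) \<subseteq> Pow \<sigma>" using closed_faceD(2) by blast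
    then have "finite (supp ` (S' \<inter> closed_face \<sigma>))"
      using simplicial_complexD(1)[OF K s] finite_subset by blast
    then have "finite (S' \<inter> closed_face \<sigma>)"
      by (rule finite_imageD) (use S(2) S' in \<open>auto intro: inj_on_subset\<close>)
    then have "closed (\<Union>t\<in>S' \<inter> closed_face \<sigma>. {t})" by (intro closed_UN ballI closed_function_point)
    then have "openin (top_of_set (closed_face \<sigma>)) (closed_face \<sigma> \<inter> - (S' \<inter> closed_face \<sigma>))"
      by (intro openin_open_Int open_Compl) simp
    moreover have "closed_face \<sigma> \<inter> - (S' \<inter> closed_face \<sigma>) = (?T - S') \<inter> closed_face \<sigma>"
      using s by (auto simp: topspace_realization)
    ultimately show "openin (top_of_set (closed_face \<sigma>)) ((?T - S') \<inter> closed_face \<sigma>)" by simp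
  qed (auto simp: topspace_realization)
  \<comment> \<open>Each member of this cover contains exactly one point of \<open>S\<close>, so
    finitely many of them cannot cover \<open>C\<close>.\<close>
  let ?U = "(\<lambda>s. ?T - (S - {s})) ` S"
  have "\<forall>V\<in>?U. openin (realization K) V" using op by auto
  moreover have "C \<subseteq> \<Union>?U"
  proof
    fix x assume x: "x \<in> C"
    obtain s where s: "s \<in> S" using infS by (metis finite.emptyI ex_in_conv)
    show "x \<in> \<Union>?U" using x CT s by (cases "x \<in> S") auto
  qed
  ultimately obtain \<F> where F: "finite \<F>" "\<F> \<subseteq> ?U" "C \<subseteq> \<Union>\<F>"
    using C unfolding compactin_def by (metis (no_types, lifting))
  obtain S0 where S0: "finite S0" "S0 \<subseteq> S" "\<F> = (\<lambda>s. ?T - (S - {s})) ` S0"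
    using finite_subset_image[OF F(1,2)] by blast
  have "S \<subseteq> S0" using F(3) S(1) unfolding S0(3) by blast
  then show False using infS S0(1) finite_subset by blast
qed

text \<open>A compact image meets only finitely many carriers, each with finitely many vertices.
  This reduces maps into infinite complexes to finite ones.\<close>

lemma finite_subcomplex:
  assumes K: "simplicial_complex K" and Z: "compact_space Z"
    and f: "continuous_map Z (realization K) f"
  shows "finite (\<Union>z\<in>topspace Z. supp (f z))"
proof -
  have "finite (supp ` (f ` topspace Z))"
    using finite_carriers[OF K image_compactin[OF _ f]] Z by (simp add: compact_space_def)
  moreover have "finite (supp (f z))" if z: "z \<in> topspace Z" for z
  proof -
    have "f z \<in> topspace (realization K)" using continuous_map_image_subset_topspace[OF f] z by blast
    then obtain \<sigma> where "\<sigma> \<in> K" "f z \<in> closed_face \<sigma>" by (rule topspace_realizationE)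
    then show ?thesis using simplicial_complexD(1)[OF K] closed_faceD(2) finite_subset by metis
  qed
  ultimately show ?thesis using finite_Union[of "supp ` (f ` topspace Z)"] by (auto simp: image_image)
qed

section \<open>Straight-line homotopies\<close>

lemma closed_face_convex:
  assumes "s \<in> closed_face \<sigma>" "t \<in> closed_face \<sigma>" "0 \<le> u" "u \<le> 1"
  shows "(\<lambda>v. (1 - u) * s v + u * t v) \<in> closed_face \<sigma>"
  using assms by (auto simp: closed_face_def sum.distrib simp flip: sum_distrib_left)

text \<open>The homotopy is linear in barycentric coordinates. Compactness of \<open>Z\<close>
  confines both maps to a finite vertex set \<open>?V\<close>, so continuity can be tested on
  coordinates.\<close>

lemma homot_contiguous:
  assumes K: "simplicial_complex K" and Z: "compact_space Z"
    and f: "continuous_map Z (realization K) f" and g: "continuous_map Z (realization K) g"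
    and face: "\<And>z. z \<in> topspace Z \<Longrightarrow> \<exists>\<sigma>\<in>K. f z \<in> closed_face \<sigma> \<and> g z \<in> closed_face \<sigma>"
  shows "homot Z (realization K) f g"
proof -
  let ?V = "(\<Union>z\<in>topspace Z. supp (f z)) \<union> (\<Union>z\<in>topspace Z. supp (g z))"
  let ?K0 = "{\<sigma> \<in> K. \<sigma> \<subseteq> ?V}"
  let ?I = "top_of_set {0..1::real}"
  let ?h = "\<lambda>(u, z) v. (1 - u) * f z v + u * g z v"
  have V: "finite ?V" using finite_subcomplex[OF K Z f] finite_subcomplex[OF K Z g] by blast
  have "continuous_map (prod_topology ?I Z) (realization K) ?h"
  proof (rule continuous_map_realizationI[OF _ _ K])
    show "finite ?K0" by (rule finite_subset[of _ "Pow ?V"]) (use V in auto)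
  next
    fix x assume x: "x \<in> topspace (prod_topology ?I Z)"
    obtain u z where uz: "x = (u, z)" by (cases x)
    have u: "0 \<le> u" "u \<le> 1" and z: "z \<in> topspace Z" using x uz by auto
    obtain \<sigma> where s: "\<sigma> \<in> K" "f z \<in> closed_face \<sigma>" "g z \<in> closed_face \<sigma>" using face[OF z] by blast
    \<comment> \<open>The common simplex \<open>\<sigma>\<close> may have vertices outside
      \<open>?V\<close>; the union of the two carriers is a face of it inside
      \<open>?V\<close>.\<close>
    let ?\<tau> = "supp (f z) \<union> supp (g z)"
    have sub: "?\<tau> \<subseteq> \<sigma>" using closed_faceD(2)[OF s(2)] closed_faceD(2)[OF s(3)] by blast
    have "finite \<sigma>" by (rule simplicial_complexD(1)[OF K s(1)])
    then have "finite ?\<tau>" using sub finite_subset by blast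
    have "?\<tau> \<in> K" using simplicial_complexD(3)[OF K s(1) sub] supp_nonempty[OF s(2)] by blast
    moreover have "?\<tau> \<subseteq> ?V" using z by blast
    moreover have "?h x \<in> closed_face ?\<tau>"
      using closed_face_convex[OF closed_face_subset[OF s(2) _ \<open>finite \<sigma>\<close> \<open>finite ?\<tau>\<close>]
          closed_face_subset[OF s(3) _ \<open>finite \<sigma>\<close> \<open>finite ?\<tau>\<close>] u] uz by auto
    ultimately show "\<exists>\<sigma>\<in>?K0. ?h x \<in> closed_face \<sigma>" by blast
  next
    fix v
    have 1: "continuous_map (prod_topology ?I Z) euclideanreal fst"
      using continuous_map_fst[of ?I Z] continuous_map_into_fulltopology by blast
    have 2: "continuous_map (prod_topology ?I Z) euclideanreal (\<lambda>x. q (snd x) v)"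
      if "continuous_map Z (realization K) q" for q
      using continuous_map_compose[OF continuous_map_snd continuous_map_coordinateD[OF that]] by (simp add: o_def)
    show "continuous_map (prod_topology ?I Z) euclideanreal (\<lambda>x. ?h x v)"
      unfolding case_prod_beta
      by (intro continuous_map_add continuous_map_real_mult continuous_map_diff 1 2 f g continuous_map_canonical_const)
  qed auto
  then show ?thesis unfolding homotopic_with_def by (intro exI[of _ ?h]) auto
qed

section \<open>Affine extension of vertex maps\<close>

text \<open>The extension of a vertex map that is linear on each simplex, where vertices may go to
  arbitrary points. Summing over a fixed \<open>V\<close> rather than over the support of
  \<open>t\<close> makes every coordinate a fixed finite sum, hence continuous.\<close>

definition affine_ext :: "'v set \<Rightarrow> ('v \<Rightarrow> 'w \<Rightarrow> real) \<Rightarrow> ('v \<Rightarrow> real) \<Rightarrow> 'w \<Rightarrow> real" where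
  "affine_ext V F t = (\<lambda>w. \<Sum>v\<in>V. t v * F v w)"

lemma affine_ext_in_face:
  assumes t: "t \<in> closed_face \<sigma>" and V: "\<sigma> \<subseteq> V" "finite V"
    and F: "\<And>v. v \<in> \<sigma> \<Longrightarrow> F v \<in> closed_face \<tau>"
  shows "affine_ext V F t \<in> closed_face \<tau>"
proof (rule closed_faceI)
  have 0: "t v = 0" if "v \<notin> \<sigma>" for v using that t by (simp add: closed_face_def)
  have nn: "0 \<le> t v * F v w" for v w
    using 0 closed_faceD(1)[OF t, of v] closed_faceD(1)[OF F, of v w] by (cases "v \<in> \<sigma>") auto
  show "0 \<le> affine_ext V F t w" for w unfolding affine_ext_def by (intro sum_nonneg nn)
  show "supp (affine_ext V F t) \<subseteq> \<tau>"
  proof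
    fix w assume "w \<in> supp (affine_ext V F t)"
    then have "(\<Sum>v\<in>V. t v * F v w) \<noteq> 0" by (simp add: affine_ext_def)
    then have "\<exists>v\<in>V. t v * F v w \<noteq> 0" by (meson sum.neutral)
    then obtain v where "t v \<noteq> 0" "F v w \<noteq> 0" by auto
    then have "v \<in> \<sigma>" using 0 by blast
    then show "w \<in> \<tau>" using closed_faceD(2)[OF F] \<open>F v w \<noteq> 0\<close> by blast
  qed
  have "sum (affine_ext V F t) \<tau> = (\<Sum>v\<in>V. t v * sum (F v) \<tau>)"
    unfolding affine_ext_def by (subst sum.swap) (simp add: sum_distrib_left)
  also have "\<dots> = (\<Sum>v\<in>V. t v)"
  proof (rule sum.cong[OF refl])
    fix v show "t v * sum (F v) \<tau> = t v"
      using 0[of v] closed_faceD(3)[OF F, of v] by (cases "v \<in> \<sigma>") auto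
  qed
  also have "\<dots> = sum t \<sigma>" using V 0 by (intro sum.mono_neutral_right) auto
  finally show "sum (affine_ext V F t) \<tau> = 1" using closed_faceD(3)[OF t] by simp
qed

lemma affine_ext_cont:
  assumes K: "simplicial_complex K" "finite K" and L: "simplicial_complex L"
    and F: "\<And>\<sigma>. \<sigma> \<in> K \<Longrightarrow> \<exists>\<tau>\<in>L. \<forall>v\<in>\<sigma>. F v \<in> closed_face \<tau>"
  shows "continuous_map (realization K) (realization L) (affine_ext (\<Union>K) F)"
proof -
  have V: "finite (\<Union>K)" using K simplicial_complexD(1) by blast
  obtain T where T: "\<And>\<sigma>. \<sigma> \<in> K \<Longrightarrow> T \<sigma> \<in> L" "\<And>\<sigma> v. \<sigma> \<in> K \<Longrightarrow> v \<in> \<sigma> \<Longrightarrow> F v \<in> closed_face (T \<sigma>)"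
    using F by metis
  show ?thesis
  proof (rule continuous_map_realizationI[of "T ` K", OF _ _ L])
    fix t assume "t \<in> topspace (realization K)"
    then obtain \<sigma> where s: "\<sigma> \<in> K" "t \<in> closed_face \<sigma>" by (rule topspace_realizationE)
    then have "affine_ext (\<Union>K) F t \<in> closed_face (T \<sigma>)"
      by (intro affine_ext_in_face[OF s(2)] V T(2)) auto
    then show "\<exists>\<tau>\<in>T ` K. affine_ext (\<Union>K) F t \<in> closed_face \<tau>" using s by blast
  next
    fix w
    show "continuous_map (realization K) euclideanreal (\<lambda>t. affine_ext (\<Union>K) F t w)"
      unfolding affine_ext_def
      by (intro continuous_map_sum V continuous_map_real_mult continuous_map_coordinate continuous_map_canonical_const)
  qed (use K T in auto)
qed

definition vertex_point :: "'v \<Rightarrow> 'v \<Rightarrow> real" where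
  "vertex_point v = (\<lambda>w. if w = v then 1 else 0)"

lemma vertex_point_in_face: "v \<in> \<sigma> \<Longrightarrow> finite \<sigma> \<Longrightarrow> vertex_point v \<in> closed_face \<sigma>"
  by (auto simp: vertex_point_def closed_face_def)

text \<open>\<open>realization_map\<close> sums over the support of its argument, which varies; as
  an affine extension over a fixed vertex set it inherits continuity and carriers.\<close>

lemma realization_map_affine:
  assumes "t \<in> closed_face \<sigma>" "\<sigma> \<subseteq> V" "finite V"
  shows "realization_map g t = affine_ext V (\<lambda>v. vertex_point (g v)) t"
proof
  fix w
  have "affine_ext V (\<lambda>v. vertex_point (g v)) t w = (\<Sum>v\<in>V. if g v = w then t v else 0)"
    unfolding affine_ext_def vertex_point_def by (intro sum.cong) auto
  also have "\<dots> = (\<Sum>v | t v \<noteq> 0 \<and> g v = w. t v)"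
    using assms closed_faceD(2)[OF assms(1)] by (intro sum.mono_neutral_cong_right) auto
  finally show "realization_map g t w = affine_ext V (\<lambda>v. vertex_point (g v)) t w"
    by (simp add: realization_map_def)
qed

lemma realization_map_in_face:
  assumes "t \<in> closed_face \<sigma>" "finite \<sigma>"
  shows "realization_map g t \<in> closed_face (g ` \<sigma>)"
  unfolding realization_map_affine[OF assms(1) order_refl assms(2)]
  by (rule affine_ext_in_face[OF assms(1)]) (use assms(2) in \<open>auto intro: vertex_point_in_face\<close>)

lemma realization_map_cont:
  assumes K: "simplicial_complex K" "finite K" and L: "simplicial_complex L"
    and g: "\<And>\<sigma>. \<sigma> \<in> K \<Longrightarrow> g ` \<sigma> \<in> L"
  shows "continuous_map (realization K) (realization L) (realization_map g)"
proof (rule continuous_map_eq)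
  have V: "finite (\<Union>K)" using K simplicial_complexD(1) by blast
  show "continuous_map (realization K) (realization L) (affine_ext (\<Union>K) (\<lambda>v. vertex_point (g v)))"
  proof (rule affine_ext_cont[OF K L])
    fix \<sigma> assume "\<sigma> \<in> K"
    then show "\<exists>\<tau>\<in>L. \<forall>v\<in>\<sigma>. vertex_point (g v) \<in> closed_face \<tau>"
      using g simplicial_complexD(1)[OF L] by (intro bexI[of _ "g ` \<sigma>"]) (auto intro!: vertex_point_in_face)
  qed
  fix t assume "t \<in> topspace (realization K)"
  then obtain \<sigma> where "\<sigma> \<in> K" "t \<in> closed_face \<sigma>" by (rule topspace_realizationE)
  then show "affine_ext (\<Union>K) (\<lambda>v. vertex_point (g v)) t = realization_map g t"
    using realization_map_affine[OF _ _ V] by (metis Union_upper)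
qed

text \<open>Points of the realization vanish off the vertices, so of a basic open set of the product
  only the finitely many vertex coordinates matter, and their radii have a positive minimum. The
  \<open>insert 1\<close> in \<open>e\<close> spares a proof that there is a vertex.\<close>

lemma open_realization_coordinates:
  assumes K: "finite K" "simplicial_complex K" and U: "openin (realization K) U" and z: "z \<in> U"
  shows "\<exists>d>0. \<forall>z'\<in>topspace (realization K). (\<forall>w\<in>\<Union>K. \<bar>z' w - z w\<bar> < d) \<longrightarrow> z' \<in> U"
proof -
  let ?T = "\<Union>\<sigma>\<in>K. closed_face \<sigma>"
  have fin: "\<And>\<sigma>. \<sigma> \<in> K \<Longrightarrow> finite \<sigma>" by (rule simplicial_complexD(1)[OF K(2)])
  have V: "finite (\<Union>K)" using K(1) fin by blast
  obtain W where W: "open W" "U = ?T \<inter> W"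
    using U realization_finite[OF K(1) fin] by (auto simp: openin_open)
  have "openin (product_topology (\<lambda>i. euclideanreal) UNIV) W"
    using W(1) by (simp add: euclidean_product_topology)
  then obtain B where B: "z \<in> PiE UNIV B" "\<And>i. open (B i)" "PiE UNIV B \<subseteq> W"
    using product_topology_open_contains_basis[of "\<lambda>i. euclideanreal" UNIV W z] z W(2) by auto
  have "\<exists>d>0. \<forall>r. \<bar>r - z w\<bar> < d \<longrightarrow> r \<in> B w" for w
    using B(1) B(2)[of w] by (auto simp: open_dist dist_real_def)
  then obtain d where d: "\<And>w. d w > 0" "\<And>w r. \<bar>r - z w\<bar> < d w \<Longrightarrow> r \<in> B w" by metis
  define e where "e = Min (insert 1 (d ` \<Union>K))"
  have e: "e > 0" unfolding e_def using V d(1) by (subst Min_gr_iff) auto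
  have ed: "e \<le> d w" if "w \<in> \<Union>K" for w unfolding e_def using V that by (intro Min_le) auto
  have "z' \<in> U" if z': "z' \<in> topspace (realization K)" "\<forall>w\<in>\<Union>K. \<bar>z' w - z w\<bar> < e" for z'
  proof -
    have "z' w \<in> B w" for w
    proof (cases "w \<in> \<Union>K")
      case True
      then show ?thesis using z'(2) ed[of w] d(2)[of "z' w" w] by force
    next
      case False
      then have "z' w = 0" "z w = 0"
        using z'(1) z W(2) by (auto simp: topspace_realization closed_face_def)
      then show ?thesis using d(2)[of "z' w" w] d(1)[of w] by simp
    qed
    then have "z' \<in> W" using B(3) by auto
    then show ?thesis using z'(1) W(2) by (simp add: topspace_realization)
  qed
  then show ?thesis using e by blast
qed

section \<open>Lebesgue numbers\<close>

lemma metric_diameter_le: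
  fixes S :: "'a::metric_space set"
  assumes "\<And>x y. x \<in> S \<Longrightarrow> y \<in> S \<Longrightarrow> dist x y \<le> d" "0 \<le> d"
  shows "diameter S \<le> d"
  using assms by (cases "S = {}") (auto simp: diameter_def intro!: cSUP_least)

lemma Lebesgue_openin:
  fixes S :: "'a::metric_space set"
  assumes S: "compact S" and op: "\<And>i. i \<in> I \<Longrightarrow> openin (top_of_set S) (W i)"
    and cover: "\<And>s. s \<in> S \<Longrightarrow> \<exists>i\<in>I. s \<in> W i"
  obtains e where "e > 0" "\<And>s. s \<in> S \<Longrightarrow> \<exists>i\<in>I. \<forall>s'\<in>S. dist s s' < e \<longrightarrow> s' \<in> W i"
proof (cases "S = {}")
  case True
  then show ?thesis using that[of 1] by simp
next
  case False
  have "\<exists>O'. open O' \<and> W i = S \<inter> O'" if "i \<in> I" for i using op[OF that] by (auto simp: openin_open)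
  then obtain O' where O': "\<And>i. i \<in> I \<Longrightarrow> open (O' i)" "\<And>i. i \<in> I \<Longrightarrow> W i = S \<inter> O' i" by metis
  have ne: "O' ` I \<noteq> {}" using False cover by blast
  have sub: "S \<subseteq> \<Union>(O' ` I)" using cover O'(2) by blast
  have opn: "\<And>B. B \<in> O' ` I \<Longrightarrow> open B" using O'(1) by blast
  obtain d where d: "d > 0" "\<And>T. T \<subseteq> S \<Longrightarrow> diameter T < d \<Longrightarrow> \<exists>B\<in>O' ` I. T \<subseteq> B"
    using Lebesgue_number_lemma[OF S ne sub opn] by metis
  \<comment> \<open>Radius \<open>d / 3\<close> bounds the diameter by two thirds of
    \<open>d\<close>, which leaves room for the strict inequality.\<close>
  have "\<exists>i\<in>I. \<forall>s'\<in>S. dist s s' < d / 3 \<longrightarrow> s' \<in> W i" if s: "s \<in> S" for s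
  proof -
    let ?T = "{s' \<in> S. dist s s' < d / 3}"
    have "diameter ?T \<le> d / 3 + d / 3"
    proof (rule metric_diameter_le)
      fix x y assume "x \<in> ?T" "y \<in> ?T"
      then have "dist x s < d / 3" "dist s y < d / 3" by (auto simp: dist_commute)
      then show "dist x y \<le> d / 3 + d / 3" using dist_triangle[of x y s] by linarith
    qed (use d in auto)
    then have "diameter ?T < d" using d(1) by linarith
    then obtain i where "i \<in> I" "?T \<subseteq> O' i" using d(2)[of ?T] by blast
    then show ?thesis using O'(2) by blast
  qed
  then show ?thesis using that[of "d / 3"] d(1) by simp
qed

text \<open>Barycentric coordinates cannot all vanish, so the open stars cover the realization and
  their preimages under \<open>H\<close> cover \<open>S\<close>.\<close>

lemma Lebesgue_star:
  fixes S :: "'a::metric_space set"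
  assumes S: "compact S" and H: "continuous_map (top_of_set S) (realization L) H"
  obtains e where "e > 0" "\<And>s. s \<in> S \<Longrightarrow> \<exists>v. \<forall>s'\<in>S. dist s s' < e \<longrightarrow> H s' v \<noteq> 0"
proof -
  let ?W = "\<lambda>v. {s \<in> S. H s v \<noteq> 0}"
  have op: "openin (top_of_set S) (?W v)" for v
  proof -
    have "openin (top_of_set S) {s \<in> topspace (top_of_set S). H s \<in> {t \<in> topspace (realization L). t v \<noteq> 0}}"
      by (rule openin_continuous_map_preimage[OF H openin_star])
    moreover have "H s \<in> topspace (realization L)" if "s \<in> S" for s
      using continuous_map_image_subset_topspace[OF H] that by auto
    then have "{s \<in> topspace (top_of_set S). H s \<in> {t \<in> topspace (realization L). t v \<noteq> 0}} = ?W v" by auto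
    ultimately show ?thesis by simp
  qed
  have cover: "\<exists>v\<in>UNIV. s \<in> ?W v" if s: "s \<in> S" for s
  proof -
    have "H s \<in> topspace (realization L)" using continuous_map_image_subset_topspace[OF H] s by auto
    then obtain \<sigma> where "H s \<in> closed_face \<sigma>" by (rule topspace_realizationE)
    then show ?thesis using supp_nonempty[of "H s" \<sigma>] s by auto
  qed
  obtain e where "e > 0" "\<And>s. s \<in> S \<Longrightarrow> \<exists>v\<in>UNIV. \<forall>s'\<in>S. dist s s' < e \<longrightarrow> s' \<in> ?W v"
    using Lebesgue_openin[OF S op cover] by metis
  then show ?thesis using that[of e] by auto
qed

lemma comp_bond_in_face:
  assumes "t \<in> closed_face \<sigma>" "finite \<sigma>"
  shows "comp_bond (\<lambda>n. realization_map (g n)) n k t \<in> closed_face (comp_bond g n k ` \<sigma>)"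
  using assms
proof (induction k arbitrary: t \<sigma>)
  case (Suc k)
  then show ?case
    using Suc.IH[OF realization_map_in_face[OF Suc.prems, of "g (n + k)"]] by (simp add: image_image)
qed simp

section \<open>Adjusted approximative sequences\<close>

locale approx_sequence =
  fixes X :: "'a::metric_space set" and \<epsilon> :: "nat \<Rightarrow> real" and A :: "nat \<Rightarrow> 'a set"
  assumes X_compact: "compact X" and X_nonempty: "X \<noteq> {}"
    and adjusted: "adjusted_approximative_sequence X \<epsilon> A"
begin

abbreviation gap where "gap n \<equiv> approx_gap X (A n)"

text \<open>The last fact is the adjustment condition solved for \<open>\<epsilon> n\<close>: a
  distance below \<open>2 * \<epsilon> (Suc n)\<close> followed by a move to a nearest point stays
  below \<open>\<epsilon> n\<close>.\<close>

lemma eps_pos: "0 < \<epsilon> n" and eps_decseq: "decseq \<epsilon>" and eps_lim: "\<epsilon> \<longlonglongrightarrow> 0"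
  and A_finite: "finite (A n)" and A_subset: "A n \<subseteq> X"
  and A_approx: "x \<in> X \<Longrightarrow> \<exists>a\<in>A n. dist x a < \<epsilon> n"
  and eps_step: "gap n + 2 * \<epsilon> (Suc n) < \<epsilon> n"
proof -
  have "\<epsilon> (Suc n) < (\<epsilon> n - gap n) / 2"
    using adjusted by (simp add: adjusted_approximative_sequence_def)
  then show "gap n + 2 * \<epsilon> (Suc n) < \<epsilon> n" by (simp add: field_simps)
qed (use adjusted in \<open>auto simp: adjusted_approximative_sequence_def approximation_def\<close>)

lemma A_nonempty: "A n \<noteq> {}"
  using A_approx X_nonempty by fastforce

lemma infdist_le_gap:
  assumes "x \<in> X" shows "infdist x (A n) \<le> gap n"
  unfolding approx_gap_def
proof (rule cSUP_upper[OF assms])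
  show "bdd_above ((\<lambda>x. infdist x (A n)) ` X)"
  proof (rule bdd_aboveI2)
    fix x assume "x \<in> X"
    then obtain a where "a \<in> A n" "dist x a < \<epsilon> n" using A_approx by blast
    then show "infdist x (A n) \<le> \<epsilon> n" using infdist_le[of a "A n" x] by linarith
  qed
qed

lemma gap_nonneg: "0 \<le> gap n"
proof -
  obtain x where "x \<in> X" using X_nonempty by blast
  then show ?thesis using infdist_le_gap[of x n] infdist_nonneg[of x "A n"] by linarith
qed

lemma nearestD:
  assumes "b \<in> nearest (A n) x" "x \<in> X"
  shows "b \<in> A n" "dist x b \<le> gap n"
  using assms infdist_le_gap by (auto simp: nearest_def)

lemma nearest_nonempty: "nearest (A n) x \<noteq> {}"
proof -
  have "infdist x (A n) = Min ((\<lambda>a. dist x a) ` A n)"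
    using A_finite A_nonempty by (simp add: infdist_def cInf_eq_Min)
  then have "infdist x (A n) \<in> (\<lambda>a. dist x a) ` A n"
    using Min_in[of "(\<lambda>a. dist x a) ` A n"] A_finite A_nonempty by simp
  then show ?thesis by (auto simp: nearest_def)
qed

text \<open>Bound for the displacement under \<open>k\<close> successive nearest-point steps, from
  stage \<open>n + k\<close> down to stage \<open>n\<close>.\<close>

definition drift where "drift n k = (\<Sum>i<k. gap (n + i))"

lemma drift_Suc_left: "drift n (Suc k) = gap n + drift (Suc n) k"
  unfolding drift_def by (subst sum.lessThan_Suc_shift) simp

text \<open>Each gap is absorbed by the drop from one \<open>\<epsilon>\<close> to the next. At
  least one step is taken, since for none the claim would read
  \<open>2 * \<epsilon> n < \<epsilon> n\<close>.\<close>

lemma drift_bound: "drift n (Suc k) + 2 * \<epsilon> (n + Suc k) < \<epsilon> n"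
proof (induction k arbitrary: n)
  case 0
  show ?case using eps_step[of n] by (simp add: drift_def)
next
  case (Suc k)
  have "drift n (Suc (Suc k)) + 2 * \<epsilon> (n + Suc (Suc k))
      = gap n + (drift (Suc n) (Suc k) + 2 * \<epsilon> (Suc n + Suc k))"
    by (simp add: drift_Suc_left[of n])
  also have "\<dots> < gap n + \<epsilon> (Suc n)" using Suc.IH[of "Suc n"] by simp
  also have "\<dots> < \<epsilon> n" using eps_step[of n] eps_pos[of "Suc n"] by linarith
  finally show ?case .
qed

text \<open>Each step more than halves the scale, so two steps leave room for
  \<open>4 * \<epsilon> (n + 2)\<close>, the bound for distances within the union of two cells with
  a common point.\<close>

lemma drift_bound_2: "drift n 2 + 4 * \<epsilon> (n + 2) < \<epsilon> n"
proof -
  have "drift n 2 = gap n + gap (Suc n)" by (simp add: drift_def numeral_2_eq_2)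
  then show ?thesis using eps_step[of n] eps_step[of "Suc n"] gap_nonneg[of "Suc n"] by simp
qed

lemma comp_choice:
  assumes step: "\<And>n a. a \<in> A (Suc n) \<Longrightarrow> \<pi> n a \<in> nearest (A n) a" and a: "a \<in> A (n + k)"
  shows "comp_bond \<pi> n k a \<in> A n \<and> dist a (comp_bond \<pi> n k a) \<le> drift n k"
  using a
proof (induction k arbitrary: a)
  case 0
  then show ?case by (simp add: drift_def)
next
  case (Suc k)
  let ?b = "\<pi> (n + k) a"
  have "?b \<in> nearest (A (n + k)) a" using step Suc.prems by simp
  then have b: "?b \<in> A (n + k)" "dist a ?b \<le> gap (n + k)"
    using nearestD Suc.prems A_subset by blast+
  then show ?case using Suc.IH[OF b(1)] dist_triangle[of a "comp_bond \<pi> n k ?b" ?b] by (simp add: drift_def)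
qed

text \<open>The complexes \<open>ball_complex n\<close> are the nerves of the balls \<open>B\<^sub>n(a)\<close> with the vertices
  indexed by the centres.\<close>

definition ball_complex :: "nat \<Rightarrow> 'a set set" where
  "ball_complex n = {\<sigma>. finite \<sigma> \<and> \<sigma> \<noteq> {} \<and> \<sigma> \<subseteq> A n \<and> (\<exists>x\<in>X. \<forall>a\<in>\<sigma>. dist x a < \<epsilon> n)}"

lemma simplicial_ball_complex: "simplicial_complex (ball_complex n)"
  unfolding simplicial_complex_def ball_complex_def by (auto intro: finite_subset)

lemma finite_ball_complex: "finite (ball_complex n)"
  by (rule finite_subset[of _ "Pow (A n)"]) (auto simp: ball_complex_def A_finite)

lemma ball_complexI: "\<sigma> \<subseteq> A n \<Longrightarrow> \<sigma> \<noteq> {} \<Longrightarrow> x \<in> X \<Longrightarrow> (\<And>a. a \<in> \<sigma> \<Longrightarrow> dist x a < \<epsilon> n) \<Longrightarrow> \<sigma> \<in> ball_complex n"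
  using finite_subset[OF _ A_finite[of n]] unfolding ball_complex_def by blast

section \<open>Partitions of unity subordinate to the balls\<close>

abbreviation ball_polyhedron where "ball_polyhedron n \<equiv> realization (ball_complex n)"

text \<open>The adjustment inequality says \<open>gap n < radius n\<close>, so the tents of this
  radius have positive sum at every point of \<open>X\<close>. Being below
  \<open>\<epsilon> n - \<epsilon> (Suc n)\<close>, it also ensures that a ball whose partition
  function is non-zero at \<open>b\<close> contains every \<open>x\<close> within
  \<open>\<epsilon> (Suc n)\<close> of \<open>b\<close>.\<close>

definition radius where "radius n = \<epsilon> n - 2 * \<epsilon> (Suc n)"

definition tent where "tent n x a = max 0 (radius n - dist x a)"

definition partition_map :: "nat \<Rightarrow> 'a \<Rightarrow> 'a \<Rightarrow> real" where
  "partition_map n x a = (if a \<in> A n then tent n x a / (\<Sum>b\<in>A n. tent n x b) else 0)"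

lemma tent_sum_pos:
  assumes "x \<in> X" shows "0 < (\<Sum>b\<in>A n. tent n x b)"
proof -
  obtain b where b: "b \<in> nearest (A n) x" using nearest_nonempty by blast
  have "0 < tent n x b" using nearestD[OF b assms] eps_step[of n] by (simp add: tent_def radius_def)
  then show ?thesis
    using nearestD(1)[OF b assms] A_finite by (intro sum_pos2[of _ b]) (auto simp: tent_def)
qed

lemma partition_in_face:
  assumes x: "x \<in> X" shows "partition_map n x \<in> closed_face {a \<in> A n. dist x a < radius n}"
proof (rule closed_face_subset[of _ "A n"])
  show "partition_map n x \<in> closed_face (A n)"
  proof (rule closed_faceI)
    show "0 \<le> partition_map n x v" for v
      using tent_sum_pos[OF x, of n] by (simp add: partition_map_def tent_def)
    have "sum (partition_map n x) (A n) = (\<Sum>a\<in>A n. tent n x a / (\<Sum>b\<in>A n. tent n x b))"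
      by (intro sum.cong) (auto simp: partition_map_def)
    then show "sum (partition_map n x) (A n) = 1"
      using tent_sum_pos[OF x, of n] by (simp flip: sum_divide_distrib)
  qed (auto simp: partition_map_def)
  show "supp (partition_map n x) \<subseteq> {a \<in> A n. dist x a < radius n}"
    by (auto simp: partition_map_def tent_def split: if_splits)
qed (use A_finite in auto)

lemma partition_coordinate: "continuous_on X (\<lambda>x. partition_map n x a)"
proof (cases "a \<in> A n")
  case True
  have "continuous_on X (\<lambda>x. tent n x a / (\<Sum>b\<in>A n. tent n x b))"
    using tent_sum_pos unfolding tent_def by (intro continuous_intros ballI) (auto simp: less_le)
  then show ?thesis using True by (simp add: partition_map_def)
qed (simp add: partition_map_def)

text \<open>For \<open>x\<close> in \<open>X\<close>, the largest simplex of the nerve witnessed by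
  \<open>x\<close>; it is the usual common carrier in contiguity arguments.\<close>

definition near where "near n x = {a \<in> A n. dist x a < \<epsilon> n}"

lemma near_finite: "finite (near n x)"
  by (simp add: near_def A_finite)

lemma near_in:
  assumes "x \<in> X" shows "near n x \<in> ball_complex n"
  using A_approx[OF assms, of n] assms by (intro ball_complexI[of _ n x]) (auto simp: near_def)

lemma radius_less: "radius n < \<epsilon> n"
  using eps_pos by (simp add: radius_def)

lemma partition_in_near: "x \<in> X \<Longrightarrow> partition_map n x \<in> closed_face (near n x)"
  using radius_less[of n] A_finite
  by (intro closed_face_mono[OF partition_in_face]) (auto simp: near_def)

lemma partition_cont: "continuous_map (top_of_set X) (ball_polyhedron n) (partition_map n)"
proof (rule continuous_map_realizationI[OF finite_ball_complex order_refl simplicial_ball_complex])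
  fix x assume "x \<in> topspace (top_of_set X)"
  then show "\<exists>\<sigma>\<in>ball_complex n. partition_map n x \<in> closed_face \<sigma>"
    using partition_in_near[of x n] near_in[of x n] by auto
qed (simp add: partition_coordinate)

lemma compact_ball_polyhedron: "compact_space (ball_polyhedron n)"
  by (rule compact_space_realization[OF finite_ball_complex simplicial_ball_complex])

subsection \<open>Maps adapted to the stars of a polyhedron\<close>

text \<open>The star condition of simplicial approximation: \<open>h\<close> maps the ball about
  \<open>a\<close> into the open star of the vertex \<open>u a\<close>. The balls lie in
  \<open>X\<close>, the stars in the target complex.\<close>

definition adapted :: "nat \<Rightarrow> ('a \<Rightarrow> 'v) \<Rightarrow> ('a \<Rightarrow> 'v \<Rightarrow> real) \<Rightarrow> bool" where
  "adapted m u h \<longleftrightarrow> (\<forall>a\<in>A m. \<forall>x\<in>X. dist x a < \<epsilon> m \<longrightarrow> h x (u a) \<noteq> 0)"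

context
  fixes L :: "'v set set"
  assumes L: "simplicial_complex L"
begin

lemma map_in_complex:
  assumes h: "continuous_map (top_of_set X) (realization L) h" and x: "x \<in> X"
  shows "supp (h x) \<in> L" "h x \<in> closed_face (supp (h x))"
proof -
  have "h x \<in> topspace (realization L)"
    using continuous_map_image_subset_topspace[OF h] x by auto
  then obtain \<sigma> where s: "\<sigma> \<in> L" "h x \<in> closed_face \<sigma>" by (rule topspace_realizationE)
  show "supp (h x) \<in> L" by (rule supp_in_complex[OF L s(2,1)])
  show "h x \<in> closed_face (supp (h x))" by (rule closed_face_supp[OF s(2) simplicial_complexD(1)[OF L s(1)]])
qed

text \<open>A point \<open>x\<close> common to the balls of \<open>\<sigma>\<close> puts all
  vertices \<open>u a\<close> and \<open>u' a\<close> into the carrier of \<open>h x\<close>. One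
  map taken twice gives simpliciality, two maps give contiguity.\<close>

lemma adapted_union:
  assumes h: "continuous_map (top_of_set X) (realization L) h"
    and u: "adapted m u h" "adapted m u' h" and s: "\<sigma> \<in> ball_complex m"
  shows "u ` \<sigma> \<union> u' ` \<sigma> \<in> L"
proof -
  obtain x where x: "x \<in> X" "\<forall>a\<in>\<sigma>. dist x a < \<epsilon> m" "\<sigma> \<subseteq> A m" "\<sigma> \<noteq> {}"
    using s by (auto simp: ball_complex_def)
  then have "u ` \<sigma> \<union> u' ` \<sigma> \<subseteq> supp (h x)" using u unfolding adapted_def by blast
  then show ?thesis using simplicial_complexD(3)[OF L map_in_complex(1)[OF h x(1)]] x(4) by blast
qed

lemma adapted_simplicial:
  assumes "continuous_map (top_of_set X) (realization L) h" "adapted m u h" "\<sigma> \<in> ball_complex m"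
  shows "u ` \<sigma> \<in> L"
  using adapted_union[OF assms(1,2,2,3)] by simp

lemma adapted_cont:
  assumes "continuous_map (top_of_set X) (realization L) h" "adapted m u h"
  shows "continuous_map (ball_polyhedron m) (realization L) (realization_map u)"
  by (rule realization_map_cont[OF simplicial_ball_complex finite_ball_complex L adapted_simplicial[OF assms]])

lemma adapted_homot:
  assumes h: "continuous_map (top_of_set X) (realization L) h"
    and u: "adapted m u h" "adapted m u' h"
  shows "homot (ball_polyhedron m) (realization L) (realization_map u) (realization_map u')"
proof (rule homot_contiguous[OF L compact_ball_polyhedron adapted_cont[OF h u(1)] adapted_cont[OF h u(2)]])
  fix t assume "t \<in> topspace (ball_polyhedron m)"
  then obtain \<sigma> where s: "\<sigma> \<in> ball_complex m" "t \<in> closed_face \<sigma>" by (rule topspace_realizationE)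
  have fin: "finite \<sigma>" by (rule simplicial_complexD(1)[OF simplicial_ball_complex s(1)])
  have "realization_map q t \<in> closed_face (u ` \<sigma> \<union> u' ` \<sigma>)" if "q = u \<or> q = u'" for q
    using that fin by (intro closed_face_mono[OF realization_map_in_face[OF s(2) fin]]) auto
  then show "\<exists>\<sigma>\<in>L. realization_map u t \<in> closed_face \<sigma> \<and> realization_map u' t \<in> closed_face \<sigma>"
    using adapted_union[OF h u s(1)] by blast
qed

text \<open>The simplex of balls around \<open>x\<close> is sent into the carrier of
  \<open>h x\<close>, so this carrier contains both values at \<open>x\<close>.\<close>

lemma adapted_approximates:
  assumes h: "continuous_map (top_of_set X) (realization L) h" and u: "adapted m u h"
  shows "homot (top_of_set X) (realization L) (realization_map u \<circ> partition_map m) h"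
proof (rule homot_contiguous[OF L _ continuous_map_compose[OF partition_cont adapted_cont[OF h u]] h])
  show "compact_space (top_of_set X)" using X_compact by (simp add: compact_space_subtopology)
  fix x assume "x \<in> topspace (top_of_set X)"
  then have x: "x \<in> X" by simp
  note hx = map_in_complex[OF h x]
  have "u ` near m x \<subseteq> supp (h x)" using u x unfolding adapted_def near_def by blast
  then have "realization_map u (partition_map m x) \<in> closed_face (supp (h x))"
    using simplicial_complexD(1)[OF L hx(1)]
    by (intro closed_face_mono[OF realization_map_in_face[OF partition_in_near[OF x] near_finite]])
  then show "\<exists>\<sigma>\<in>L. (realization_map u \<circ> partition_map m) x \<in> closed_face \<sigma> \<and> h x \<in> closed_face \<sigma>"
    using hx by auto
qed

end

end

section \<open>Nearest-point choices and the sequence of ball nerves\<close>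

locale approx_choice = approx_sequence X \<epsilon> A for X :: "'a::metric_space set" and \<epsilon> A +
  fixes \<pi> :: "nat \<Rightarrow> 'a \<Rightarrow> 'a"
  assumes choice: "point_choice A \<pi>"
begin

lemma choice_nearest: "a \<in> A (Suc n) \<Longrightarrow> \<pi> n a \<in> nearest (A n) a"
  using choice by (simp add: point_choice_def)

lemma choice_dist:
  assumes "a \<in> A (Suc n)" shows "\<pi> n a \<in> A n" "dist a (\<pi> n a) \<le> gap n"
  using nearestD[OF choice_nearest[OF assms]] assms A_subset by blast+

lemma comp_choice_dist:
  assumes "a \<in> A (n + k)"
  shows "comp_bond \<pi> n k a \<in> A n" "dist a (comp_bond \<pi> n k a) \<le> drift n k"
  using comp_choice[OF choice_nearest assms] by auto

text \<open>A witness survives the bonding map unchanged: the vertex moves by at most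
  \<open>gap n\<close>, and \<open>gap n + \<epsilon> (Suc n) < \<epsilon> n\<close>.\<close>

lemma choice_near:
  assumes "x \<in> X" "a \<in> near (Suc n) x" shows "\<pi> n a \<in> near n x"
  using choice_dist[of a n] assms eps_step[of n] eps_pos[of "Suc n"] dist_triangle[of x "\<pi> n a" a]
  by (simp add: near_def)

lemma choice_simplicial:
  assumes "\<sigma> \<in> ball_complex (Suc n)" shows "\<pi> n ` \<sigma> \<in> ball_complex n"
proof -
  obtain x where x: "x \<in> X" "\<sigma> \<subseteq> near (Suc n) x" "\<sigma> \<noteq> {}"
    using assms by (auto simp: ball_complex_def near_def)
  then have "\<pi> n ` \<sigma> \<subseteq> near n x" using choice_near by blast
  then show ?thesis using simplicial_complexD(3)[OF simplicial_ball_complex near_in[OF x(1)]] x(3) by blast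
qed

abbreviation bnd where "bnd n \<equiv> realization_map (\<pi> n)"

sublocale ball: cone ball_polyhedron bnd "top_of_set X" partition_map
proof
  fix n
  show bc: "continuous_map (ball_polyhedron (Suc n)) (ball_polyhedron n) (bnd n)"
    by (rule realization_map_cont[OF simplicial_ball_complex finite_ball_complex simplicial_ball_complex choice_simplicial])
  show "continuous_map (top_of_set X) (ball_polyhedron n) (partition_map n)" by (rule partition_cont)
  show "homot (top_of_set X) (ball_polyhedron n) (partition_map n) (bnd n \<circ> partition_map (Suc n))"
  proof (rule homot_contiguous[OF simplicial_ball_complex _ partition_cont continuous_map_compose[OF partition_cont bc]])
    show "compact_space (top_of_set X)" using X_compact by (simp add: compact_space_subtopology)
    fix x assume "x \<in> topspace (top_of_set X)"
    then have x: "x \<in> X" by simp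
    have "bnd n (partition_map (Suc n) x) \<in> closed_face (near n x)"
      using choice_near[OF x]
      by (intro closed_face_mono[OF realization_map_in_face[OF partition_in_near[OF x] near_finite]] near_finite) auto
    then show "\<exists>\<sigma>\<in>ball_complex n. partition_map n x \<in> closed_face \<sigma> \<and> (bnd n \<circ> partition_map (Suc n)) x \<in> closed_face \<sigma>"
      using partition_in_near[OF x] near_in[OF x] by auto
  qed
qed

text \<open>The bonding map is contiguous to the affine extension of \<open>partition_map n\<close>, whose images of
  simplices are small, unlike those of the bonding map itself.\<close>

lemma affine_partition:
  fixes n k :: nat
  defines "q \<equiv> affine_ext (\<Union>(ball_complex (n + Suc k))) (partition_map n)"
  shows "continuous_map (ball_polyhedron (n + Suc k)) (ball_polyhedron n) q"
    and "homot (ball_polyhedron (n + Suc k)) (ball_polyhedron n) q (comp_bond bnd n (Suc k))"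
proof -
  let ?m = "n + Suc k"
  have V: "finite (\<Union>(ball_complex ?m))"
    using finite_ball_complex simplicial_complexD(1)[OF simplicial_ball_complex] by blast
  \<comment> \<open>Both maps send a vertex \<open>b\<close> near \<open>x\<close> into the simplex
    \<open>near n x\<close>, which therefore carries both images of every simplex witnessed by
    \<open>x\<close>.\<close>
  have near: "partition_map n b \<in> closed_face (near n x) \<and> comp_bond \<pi> n (Suc k) b \<in> near n x"
    if x: "x \<in> X" and b: "b \<in> near ?m x" for x b
  proof
    have bA: "b \<in> A ?m" "dist x b < \<epsilon> ?m" using b by (auto simp: near_def)
    have bX: "b \<in> X" using bA A_subset by blast
    \<comment> \<open>Here at least one bonding step is used: the reduced radius of the tents leaves
      room for \<open>\<epsilon> (Suc n)\<close>, not for \<open>\<epsilon> n\<close>.\<close>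
    have em: "\<epsilon> ?m \<le> \<epsilon> (Suc n)" using eps_decseq by (auto simp: decseq_def)
    show "partition_map n b \<in> closed_face (near n x)"
    proof (rule closed_face_mono[OF partition_in_face[OF bX] _ near_finite])
      show "{a \<in> A n. dist b a < radius n} \<subseteq> near n x"
        using bA(2) em eps_pos[of "Suc n"] by (auto simp: near_def radius_def intro: le_less_trans[OF dist_triangle[of x _ b]])
    qed
    show "comp_bond \<pi> n (Suc k) b \<in> near n x"
      using comp_choice_dist[OF bA(1)] bA(2) drift_bound[of n k] eps_pos[of ?m]
        dist_triangle[of x "comp_bond \<pi> n (Suc k) b" b] by (simp add: near_def del: comp_bond.simps)
  qed
  have simplex: "\<exists>x\<in>X. \<sigma> \<subseteq> near ?m x" if "\<sigma> \<in> ball_complex ?m" for \<sigma>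
    using that by (auto simp: ball_complex_def near_def)
  show q: "continuous_map (ball_polyhedron ?m) (ball_polyhedron n) q"
    unfolding q_def
  proof (rule affine_ext_cont[OF simplicial_ball_complex finite_ball_complex simplicial_ball_complex])
    fix \<sigma> assume "\<sigma> \<in> ball_complex ?m"
    then show "\<exists>\<tau>\<in>ball_complex n. \<forall>v\<in>\<sigma>. partition_map n v \<in> closed_face \<tau>"
      using simplex near near_in by (meson subsetD)
  qed
  show "homot (ball_polyhedron ?m) (ball_polyhedron n) q (comp_bond bnd n (Suc k))"
  proof (rule homot_contiguous[OF simplicial_ball_complex compact_ball_polyhedron q ball.comp_bond_cont])
    fix t assume "t \<in> topspace (ball_polyhedron ?m)"
    then obtain \<sigma> where s: "\<sigma> \<in> ball_complex ?m" "t \<in> closed_face \<sigma>" by (rule topspace_realizationE)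
    obtain x where x: "x \<in> X" "\<sigma> \<subseteq> near ?m x" using simplex[OF s(1)] by blast
    have fin: "finite \<sigma>" by (rule simplicial_complexD(1)[OF simplicial_ball_complex s(1)])
    have "q t \<in> closed_face (near n x)"
      unfolding q_def using s near[OF x(1)] x(2) by (intro affine_ext_in_face[OF s(2) _ V]) auto
    moreover have "comp_bond bnd n (Suc k) t \<in> closed_face (near n x)"
      using near[OF x(1)] x(2)
      by (intro closed_face_mono[OF comp_bond_in_face[OF s(2) fin] _ near_finite]) blast
    ultimately show "\<exists>\<sigma>\<in>ball_complex n. q t \<in> closed_face \<sigma> \<and> comp_bond bnd n (Suc k) t \<in> closed_face \<sigma>"
      using near_in[OF x(1)] by blast
  qed
qed

text \<open>The vertex \<open>u a\<close> is one whose star contains the \<open>f\<close>-image of a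
  coordinate neighbourhood around the partition point of \<open>a\<close>. On a fine stage the
  affine extension \<open>q\<close> sends each simplex into such a neighbourhood for each of its
  vertices, so \<open>u\<close> maps the simplex into the carrier of \<open>f (q t)\<close>. Thus
  \<open>u\<close> is contiguous to \<open>f \<circ> q\<close>, and \<open>q\<close> is homotopic to
  the bonding map.\<close>

lemma bond_approximation:
  assumes L: "simplicial_complex L" and f: "continuous_map (ball_polyhedron n) (realization L) f"
  obtains e where "e > 0" "\<And>k. \<epsilon> (n + Suc k) < e \<Longrightarrow> \<exists>u. adapted (n + Suc k) u (f \<circ> partition_map n) \<and>
    homot (ball_polyhedron (n + Suc k)) (realization L) (realization_map u) (f \<circ> comp_bond bnd n (Suc k))"
proof -
  let ?N = "ball_polyhedron n"
  have fp: "continuous_map (top_of_set X) (realization L) (f \<circ> partition_map n)"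
    by (rule continuous_map_compose[OF partition_cont f])
  \<comment> \<open>Closeness is measured in the finitely many vertex coordinates, because convex
    combinations can be estimated coordinate by coordinate.\<close>
  define good where "good x v d \<longleftrightarrow>
      (\<forall>z\<in>topspace ?N. (\<forall>w\<in>\<Union>(ball_complex n). \<bar>z w - partition_map n x w\<bar> < d) \<longrightarrow> f z v \<noteq> 0)" for x v d
  have "\<exists>v d. 0 < d \<and> good x v d" if x: "x \<in> X" for x
  proof -
    obtain v where v: "f (partition_map n x) v \<noteq> 0"
      using supp_nonempty[OF map_in_complex(2)[OF L fp x]] by auto
    have op: "openin ?N {z \<in> topspace ?N. f z \<in> {t \<in> topspace (realization L). t v \<noteq> 0}}"
      by (rule openin_continuous_map_preimage[OF f openin_star])
    have "partition_map n x \<in> topspace ?N"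
      using continuous_map_image_subset_topspace[OF partition_cont] x by auto
    moreover have "f (partition_map n x) \<in> topspace (realization L)"
      using continuous_map_image_subset_topspace[OF fp] x by auto
    ultimately have "partition_map n x \<in> {z \<in> topspace ?N. f z \<in> {t \<in> topspace (realization L). t v \<noteq> 0}}"
      using v by simp
    from open_realization_coordinates[OF finite_ball_complex simplicial_ball_complex op this]
    obtain d where d: "0 < d" "\<forall>z\<in>topspace ?N. (\<forall>w\<in>\<Union>(ball_complex n). \<bar>z w - partition_map n x w\<bar> < d) \<longrightarrow>
        z \<in> {z \<in> topspace ?N. f z \<in> {t \<in> topspace (realization L). t v \<noteq> 0}}"
      by (elim exE conjE)
    have "good x v d"
      unfolding good_def
    proof (intro ballI impI)
      fix z assume "z \<in> topspace ?N" "\<forall>w\<in>\<Union>(ball_complex n). \<bar>z w - partition_map n x w\<bar> < d"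
      then have "z \<in> {z \<in> topspace ?N. f z \<in> {t \<in> topspace (realization L). t v \<noteq> 0}}"
        by (rule d(2)[THEN bspec, THEN mp])
      then show "f z v \<noteq> 0" by simp
    qed
    then show ?thesis using d(1) by (intro exI[of _ v] exI[of _ d] conjI)
  qed
  then obtain v d where vd: "\<And>x. x \<in> X \<Longrightarrow> 0 < d x \<and> good x (v x) (d x)" by metis
  have d: "\<And>x. x \<in> X \<Longrightarrow> 0 < d x"
    "\<And>x z. x \<in> X \<Longrightarrow> z \<in> topspace ?N \<Longrightarrow> (\<And>w. w \<in> \<Union>(ball_complex n) \<Longrightarrow> \<bar>z w - partition_map n x w\<bar> < d x) \<Longrightarrow> f z (v x) \<noteq> 0"
    using vd unfolding good_def by blast+
  let ?V = "\<Union>(ball_complex n)"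
  let ?W = "\<lambda>x. {x' \<in> X. \<forall>w\<in>?V. \<bar>partition_map n x' w - partition_map n x w\<bar> < d x}"
  have V: "finite ?V"
    using finite_ball_complex simplicial_complexD(1)[OF simplicial_ball_complex] by blast
  have op: "openin (top_of_set X) (?W x)" for x
  proof -
    have coord: "openin (top_of_set X) {x' \<in> X. \<bar>partition_map n x' w - partition_map n x w\<bar> < d x}" for w
    proof -
      have c: "continuous_on X (\<lambda>x'. \<bar>partition_map n x' w - partition_map n x w\<bar>)"
        by (intro continuous_intros partition_coordinate)
      have "openin (top_of_set X) (X \<inter> (\<lambda>x'. \<bar>partition_map n x' w - partition_map n x w\<bar>) -` {..<d x})"
        by (rule continuous_openin_preimage_gen[OF c]) simp
      moreover have "X \<inter> (\<lambda>x'. \<bar>partition_map n x' w - partition_map n x w\<bar>) -` {..<d x}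
          = {x' \<in> X. \<bar>partition_map n x' w - partition_map n x w\<bar> < d x}" by auto
      ultimately show ?thesis by simp
    qed
    have "openin (top_of_set X) {x' \<in> X. \<forall>w\<in>V'. \<bar>partition_map n x' w - partition_map n x w\<bar> < d x}"
      if "finite V'" for V'
      using that
    proof induction
      case empty
      show ?case using openin_topspace[of "top_of_set X"] by simp
    next
      case (insert w V')
      have "{x' \<in> X. \<forall>w\<in>insert w V'. \<bar>partition_map n x' w - partition_map n x w\<bar> < d x} =
          {x' \<in> X. \<bar>partition_map n x' w - partition_map n x w\<bar> < d x} \<inter>
          {x' \<in> X. \<forall>w\<in>V'. \<bar>partition_map n x' w - partition_map n x w\<bar> < d x}" by blast
      then show ?case using openin_Int[OF coord[of w] insert.IH] by simp
    qed
    from this[OF V] show ?thesis .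
  qed
  have cover: "\<exists>i\<in>X. x \<in> ?W i" if "x \<in> X" for x
    using that d(1) by (intro bexI[of _ x]) auto
  obtain e where e: "e > 0" "\<And>s. s \<in> X \<Longrightarrow> \<exists>i\<in>X. \<forall>s'\<in>X. dist s s' < e \<longrightarrow> s' \<in> ?W i"
    by (rule Lebesgue_openin[OF X_compact, of X ?W]) (use op cover in auto)
  have "\<exists>c. \<forall>s\<in>X. c s \<in> X \<and> (\<forall>s'\<in>X. dist s s' < e \<longrightarrow> s' \<in> ?W (c s))"
    by (rule bchoice) (use e(2) in blast)
  then obtain c where c': "\<forall>s\<in>X. c s \<in> X \<and> (\<forall>s'\<in>X. dist s s' < e \<longrightarrow> s' \<in> ?W (c s))" ..
  have c: "\<And>s. s \<in> X \<Longrightarrow> c s \<in> X" "\<And>s s'. s \<in> X \<Longrightarrow> s' \<in> X \<Longrightarrow> dist s s' < e \<Longrightarrow> s' \<in> ?W (c s)"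
    using c' by blast+
  \<comment> \<open>Half of \<open>e\<close>: two vertices of a simplex share a witness within
    \<open>\<epsilon> (n + Suc k)\<close> of both, hence lie less than \<open>e\<close>
    apart.\<close>
  have "\<exists>u. adapted (n + Suc k) u (f \<circ> partition_map n) \<and>
    homot (ball_polyhedron (n + Suc k)) (realization L) (realization_map u) (f \<circ> comp_bond bnd n (Suc k))"
    if k: "\<epsilon> (n + Suc k) < e / 2" for k
  proof (intro exI conjI)
    let ?m = "n + Suc k"
    let ?q = "affine_ext (\<Union>(ball_complex ?m)) (partition_map n)"
    \<comment> \<open>\<open>c a\<close> indexes a member of the cover containing the
      \<open>e\<close>-ball about \<open>a\<close>, and \<open>v\<close> is the vertex attached to
      that member.\<close>
    let ?u = "v \<circ> c"
    note q = affine_partition[of n k]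
    have AX: "a \<in> X" if "a \<in> A ?m" for a using that A_subset by blast
    have close: "\<bar>partition_map n b w - partition_map n (c a) w\<bar> < d (c a)"
      if "a \<in> A ?m" "b \<in> X" "dist a b < e" "w \<in> ?V" for a b w
      using c(2)[OF AX[OF that(1)] that(2,3)] that(4) by blast
    show ad: "adapted ?m ?u (f \<circ> partition_map n)"
      unfolding adapted_def
    proof (intro ballI impI)
      fix a x assume a: "a \<in> A ?m" and x: "x \<in> X" and ax: "dist x a < \<epsilon> ?m"
      have "dist a x < e" using ax k e(1) by (simp add: dist_commute)
      moreover have "partition_map n x \<in> topspace ?N"
        using continuous_map_image_subset_topspace[OF partition_cont] x by auto
      ultimately show "(f \<circ> partition_map n) x (?u a) \<noteq> 0"
        using d(2)[OF c(1)[OF AX[OF a]]] close[OF a x] by simp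
    qed
    have "homot (ball_polyhedron ?m) (realization L) (realization_map ?u) (f \<circ> ?q)"
    proof (rule homot_contiguous[OF L compact_ball_polyhedron adapted_cont[OF L fp ad] continuous_map_compose[OF q(1) f]])
      fix t assume t: "t \<in> topspace (ball_polyhedron ?m)"
      then obtain \<sigma> where s: "\<sigma> \<in> ball_complex ?m" "t \<in> closed_face \<sigma>" by (rule topspace_realizationE)
      have sA: "\<sigma> \<subseteq> A ?m" and fin: "finite \<sigma>" using s(1) by (auto simp: ball_complex_def)
      have qt: "?q t \<in> topspace ?N" using continuous_map_image_subset_topspace[OF q(1)] t by blast
      have "f (?q t) \<in> topspace (realization L)" using continuous_map_image_subset_topspace[OF f] qt by blast
      then obtain \<tau> where tau: "\<tau> \<in> L" "f (?q t) \<in> closed_face \<tau>" by (rule topspace_realizationE)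
      have "f (?q t) (?u a) \<noteq> 0" if a: "a \<in> \<sigma>" for a
      proof -
        have "\<bar>?q t w - partition_map n (c a) w\<bar> < d (c a)" if w: "w \<in> ?V" for w
        proof -
          have fU: "finite (\<Union>(ball_complex ?m))"
            using finite_ball_complex simplicial_complexD(1)[OF simplicial_ball_complex] by blast
          have "?q t w = (\<Sum>b\<in>\<sigma>. t b * partition_map n b w)"
            unfolding affine_ext_def using s fU by (intro sum.mono_neutral_right) (auto simp: closed_face_def)
          moreover have "(\<Sum>b\<in>\<sigma>. t b * partition_map n (c a) w) = partition_map n (c a) w"
            using closed_faceD(3)[OF s(2)] by (simp flip: sum_distrib_right)
          ultimately have eq: "?q t w - partition_map n (c a) w = (\<Sum>b\<in>\<sigma>. t b * (partition_map n b w - partition_map n (c a) w))"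
            by (simp add: right_diff_distrib sum_subtractf)
          have bd: "\<bar>partition_map n b w - partition_map n (c a) w\<bar> < d (c a)" if b: "b \<in> \<sigma>" for b
          proof (rule close[OF _ _ _ w])
            obtain x where "dist x a < \<epsilon> ?m" "dist x b < \<epsilon> ?m"
              using s(1) a b by (auto simp: ball_complex_def)
            then show "dist a b < e" using k dist_triangle3[of a b x] by linarith
          qed (use a b sA AX in auto)
          have "\<bar>\<Sum>b\<in>\<sigma>. t b * (partition_map n b w - partition_map n (c a) w)\<bar> \<le> (\<Sum>b\<in>\<sigma>. t b * \<bar>partition_map n b w - partition_map n (c a) w\<bar>)"
            using closed_faceD(1)[OF s(2)] by (intro order_trans[OF sum_abs] sum_mono) (simp add: abs_mult)
          \<comment> \<open>Strictness needs one positive weight, which exists because the carrier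
            of \<open>t\<close> is non-empty.\<close>
          also have "\<dots> < (\<Sum>b\<in>\<sigma>. t b * d (c a))"
          proof (rule sum_strict_mono_ex1[OF fin])
            show "\<forall>b\<in>\<sigma>. t b * \<bar>partition_map n b w - partition_map n (c a) w\<bar> \<le> t b * d (c a)"
              by (intro ballI mult_left_mono less_imp_le[OF bd] closed_faceD(1)[OF s(2)])
            obtain b where b: "t b \<noteq> 0" using supp_nonempty[OF s(2)] by blast
            then have "b \<in> \<sigma>" "0 < t b" using closed_faceD(1,2)[OF s(2)] by (auto simp: less_le)
            then show "\<exists>b\<in>\<sigma>. t b * \<bar>partition_map n b w - partition_map n (c a) w\<bar> < t b * d (c a)"
              using bd[of b] by (intro bexI[of _ b] mult_strict_left_mono)
          qed
          also have "\<dots> = d (c a)" using closed_faceD(3)[OF s(2)] by (simp flip: sum_distrib_right)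
          finally show ?thesis using eq by simp
        qed
        then show ?thesis using d(2)[OF c(1) qt] AX sA a by auto
      qed
      then have "?u ` \<sigma> \<subseteq> supp (f (?q t))" by auto
      then have "?u ` \<sigma> \<subseteq> \<tau>" using closed_faceD(2)[OF tau(2)] by blast
      then have "realization_map ?u t \<in> closed_face \<tau>"
        by (rule closed_face_mono[OF realization_map_in_face[OF s(2) fin] _ simplicial_complexD(1)[OF L tau(1)]])
      then show "\<exists>\<sigma>\<in>L. realization_map ?u t \<in> closed_face \<sigma> \<and> (f \<circ> ?q) t \<in> closed_face \<sigma>"
        using tau by auto
    qed
    also have "homot (ball_polyhedron ?m) (realization L) (f \<circ> ?q) (f \<circ> comp_bond bnd n (Suc k))"
      by (rule homot_comp_left[OF q(2) f])
    finally show "homot (ball_polyhedron ?m) (realization L) (realization_map ?u) (f \<circ> comp_bond bnd n (Suc k))" .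
  qed
  then show ?thesis using that[of "e / 2"] e(1) by simp
qed

section \<open>The expansion criterion for the ball nerves\<close>

lemma eps_eventually_less:
  assumes "0 < e" obtains k where "\<epsilon> (n + Suc k) < e"
proof -
  obtain N where "\<And>i. i \<ge> N \<Longrightarrow> \<epsilon> i < e"
    using order_tendstoD(2)[OF eps_lim assms] by (auto simp: eventually_sequentially)
  then show ?thesis using that[of N] by simp
qed

text \<open>Surjectivity: a Lebesgue number for the stars yields a vertex map adapted to
  \<open>h\<close>. Injectivity: a Lebesgue number for a homotopy \<open>H\<close> on
  \<open>[0,1] \<times> X\<close> yields a vertex map for each time, adapted to the slices at all
  nearby times, so nearby vertex maps share a slice and are homotopic. At the two ends
  \<open>bond_approximation\<close> leads to \<open>f\<close> and \<open>g\<close> after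
  bonding.\<close>

lemma ball_expands:
  fixes L :: "'v set set"
  assumes L: "simplicial_complex L"
  shows "expands (top_of_set X) ball_polyhedron bnd partition_map (realization L)"
  unfolding expands_def
proof (intro conjI allI impI)
  fix h assume h: "continuous_map (top_of_set X) (realization L) h"
  obtain e where e: "e > 0" "\<And>s. s \<in> X \<Longrightarrow> \<exists>v. \<forall>s'\<in>X. dist s s' < e \<longrightarrow> h s' v \<noteq> 0"
    using Lebesgue_star[OF X_compact h] by blast
  then obtain u where u: "\<And>s s'. s \<in> X \<Longrightarrow> s' \<in> X \<Longrightarrow> dist s s' < e \<Longrightarrow> h s' (u s) \<noteq> 0" by metis
  obtain k where k: "\<epsilon> (0 + Suc k) < e" using eps_eventually_less[OF e(1)] .
  have ad: "adapted (Suc k) u h"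
    unfolding adapted_def
  proof (intro ballI impI)
    fix a x assume "a \<in> A (Suc k)" "x \<in> X" "dist x a < \<epsilon> (Suc k)"
    then show "h x (u a) \<noteq> 0" using u[of a x] k A_subset[of "Suc k"] by (auto simp: dist_commute)
  qed
  show "\<exists>n f. continuous_map (ball_polyhedron n) (realization L) f \<and> homot (top_of_set X) (realization L) (f \<circ> partition_map n) h"
    using adapted_cont[OF L h ad] adapted_approximates[OF L h ad] by blast
next
  fix n f g
  assume f: "continuous_map (ball_polyhedron n) (realization L) f"
    and g: "continuous_map (ball_polyhedron n) (realization L) g"
    and fg: "homot (top_of_set X) (realization L) (f \<circ> partition_map n) (g \<circ> partition_map n)"
  obtain H :: "real \<times> 'a \<Rightarrow> 'v \<Rightarrow> real"
    where H': "continuous_map (prod_topology (top_of_set {0..1}) (top_of_set X)) (realization L) H \<and>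
      (\<forall>x. H (0, x) = (f \<circ> partition_map n) x) \<and> (\<forall>x. H (1, x) = (g \<circ> partition_map n) x) \<and>
      (\<forall>t\<in>{0..1::real}. True)"
    using fg unfolding homotopic_with_def ..
  then have H: "continuous_map (prod_topology (top_of_set {0..1}) (top_of_set X)) (realization L) H"
    and H0: "\<And>x. H (0, x) = (f \<circ> partition_map n) x" and H1: "\<And>x. H (1, x) = (g \<circ> partition_map n) x"
    by (elim conjE; simp)+
  let ?Q = "{0..1::real} \<times> X"
  have HQ: "continuous_map (top_of_set ?Q) (realization L) H"
    using H by (simp add: prod_topology_subtopology_eu)
  have Q: "compact ?Q" by (rule compact_Times[OF compact_Icc X_compact])
  obtain e where e: "e > 0" "\<And>s. s \<in> ?Q \<Longrightarrow> \<exists>v. \<forall>s'\<in>?Q. dist s s' < e \<longrightarrow> H s' v \<noteq> 0"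
    using Lebesgue_star[OF Q HQ] by blast
  then obtain v where v: "\<And>s s'. s \<in> ?Q \<Longrightarrow> s' \<in> ?Q \<Longrightarrow> dist s s' < e \<Longrightarrow> H s' (v s) \<noteq> 0" by metis
  obtain ef where ef: "ef > 0" "\<And>k. \<epsilon> (n + Suc k) < ef \<Longrightarrow> \<exists>u. adapted (n + Suc k) u (f \<circ> partition_map n) \<and>
    homot (ball_polyhedron (n + Suc k)) (realization L) (realization_map u) (f \<circ> comp_bond bnd n (Suc k))"
    by (rule bond_approximation[OF L f]) (rule that)
  obtain eg where eg: "eg > 0" "\<And>k. \<epsilon> (n + Suc k) < eg \<Longrightarrow> \<exists>u. adapted (n + Suc k) u (g \<circ> partition_map n) \<and>
    homot (ball_polyhedron (n + Suc k)) (realization L) (realization_map u) (g \<circ> comp_bond bnd n (Suc k))"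
    by (rule bond_approximation[OF L g]) (rule that)
  \<comment> \<open>One stage fine enough for three purposes: half the Lebesgue number of
    \<open>H\<close>, the other half being reserved for time, and the approximations of
    \<open>f\<close> and of \<open>g\<close>.\<close>
  obtain k where k: "\<epsilon> (n + Suc k) < min (e / 2) (min ef eg)"
    using eps_eventually_less[of "min (e / 2) (min ef eg)" n] e(1) ef(1) eg(1) by auto
  let ?m = "n + Suc k"
  obtain uf where uf: "adapted ?m uf (f \<circ> partition_map n)"
    "homot (ball_polyhedron ?m) (realization L) (realization_map uf) (f \<circ> comp_bond bnd n (Suc k))"
    using ef(2)[of k] k by auto
  obtain ug where ug: "adapted ?m ug (g \<circ> partition_map n)"
    "homot (ball_polyhedron ?m) (realization L) (realization_map ug) (g \<circ> comp_bond bnd n (Suc k))"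
    using eg(2)[of k] k by auto
  let ?u = "\<lambda>t a. v (t, a)"
  have slice: "continuous_map (top_of_set X) (realization L) (\<lambda>x. H (t, x))" if "t \<in> {0..1}" for t
  proof -
    have "continuous_map (top_of_set X) (prod_topology (top_of_set {0..1}) (top_of_set X)) (\<lambda>x. (t, x))"
      using that by (intro continuous_map_pairedI) (auto simp: continuous_map_const)
    from continuous_map_compose[OF this H] show ?thesis by (simp add: o_def)
  qed
  have ad: "adapted ?m (?u t) (\<lambda>x. H (s, x))" if ts: "t \<in> {0..1}" "s \<in> {0..1}" "dist t s < e / 2" for t s
    unfolding adapted_def
  proof (intro ballI impI)
    fix a x assume a: "a \<in> A ?m" and x: "x \<in> X" and ax: "dist x a < \<epsilon> ?m"
    have aX: "a \<in> X" using a A_subset by blast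
    have "dist (t, a) (s, x) \<le> dist t s + dist a x"
      unfolding dist_Pair_Pair by (rule sqrt_sum_squares_le_sum) auto
    also have "\<dots> < e" using ts(3) ax k by (simp add: dist_commute)
    finally show "H (s, x) (?u t a) \<noteq> 0" using v[of "(t, a)" "(s, x)"] ts aX x by simp
  qed
  let ?R = "\<lambda>t s. homot (ball_polyhedron ?m) (realization L) (realization_map (?u t)) (realization_map (?u s))"
  \<comment> \<open>Being homotopic is an equivalence relation among the maps at the times
    \<open>t\<close>; it holds locally, hence globally as the interval is connected. This replaces a
    finite subdivision.\<close>
  have R: "?R 0 1"
  proof (rule connected_equivalence_relation[of "{0..1::real}"])
    show "connected {0..1::real}" by (rule connected_Icc)
    show "\<exists>T. openin (top_of_set {0..1}) T \<and> t \<in> T \<and> (\<forall>s\<in>T. ?R t s)" if t: "t \<in> {0..1}" for t :: real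
    proof (intro exI conjI ballI)
      show "openin (top_of_set {0..1}) ({0..1} \<inter> ball t (e / 2))" by (intro openin_open_Int open_ball)
      show "t \<in> {0..1} \<inter> ball t (e / 2)" using t e(1) by simp
      fix s assume s: "s \<in> {0..1} \<inter> ball t (e / 2)"
      \<comment> \<open>Both vertex maps are adapted to the slice at time \<open>s\<close>.\<close>
      show "?R t s"
        by (rule adapted_homot[OF L slice[of s] ad[of t s] ad[of s s]]) (use s t e(1) in auto)
    qed
  qed (auto intro: homotopic_with_symD homotopic_with_trans)
  have f0: "(\<lambda>x. H (0, x)) = f \<circ> partition_map n" and g1: "(\<lambda>x. H (1, x)) = g \<circ> partition_map n"
    using H0 H1 by auto
  have "homot (ball_polyhedron ?m) (realization L) (f \<circ> comp_bond bnd n (Suc k)) (realization_map uf)"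
    by (rule homotopic_with_symD[OF uf(2)])
  also have "homot (ball_polyhedron ?m) (realization L) \<dots> (realization_map (?u 0))"
    using e(1) by (intro adapted_homot[OF L slice[of 0] uf(1)[folded f0] ad[of 0 0]]) auto
  also note R
  also have "homot (ball_polyhedron ?m) (realization L) (realization_map (?u 1)) (realization_map ug)"
    using e(1) by (intro adapted_homot[OF L slice[of 1] ad[of 1 1] ug(1)[folded g1]]) auto
  also note ug(2)
  finally show "\<exists>k. homot (ball_polyhedron (n + k)) (realization L) (f \<circ> comp_bond bnd n k) (g \<circ> comp_bond bnd n k)"
    by blast
qed

end

section \<open>Sequences of finite complexes\<close>

locale simplicial_sequence =
  fixes K :: "nat \<Rightarrow> 'w set set" and g :: "nat \<Rightarrow> 'w \<Rightarrow> 'w"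
  assumes complex: "simplicial_complex (K n)" and finite_complex: "finite (K n)"
    and simplicial: "\<sigma> \<in> K (Suc n) \<Longrightarrow> g n ` \<sigma> \<in> K n"
begin

sublocale map_sequence "\<lambda>n. realization (K n)" "\<lambda>n. realization_map (g n)"
  by unfold_locales (rule realization_map_cont[OF complex finite_complex complex simplicial])

lemma comp_simplicial: "\<sigma> \<in> K (n + k) \<Longrightarrow> comp_bond g n k ` \<sigma> \<in> K n"
proof (induction k arbitrary: \<sigma>)
  case (Suc k)
  then show ?case using Suc.IH[OF simplicial[of \<sigma> "n + k"]] by (simp add: image_image)
qed simp

lemma comp_in_face:
  assumes "t \<in> closed_face \<sigma>" "\<sigma> \<in> K (n + k)"
  shows "comp_bond (\<lambda>n. realization_map (g n)) n k t \<in> closed_face (comp_bond g n k ` \<sigma>)"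
  by (rule comp_bond_in_face[OF assms(1) simplicial_complexD(1)[OF complex assms(2)]])

end

text \<open>The definition of expansion has two stages, so the criterion is supplied for two vertex
  types. Both instances yield the same \<open>pro_cone\<close>, which
  \<open>HPol_universal_transport\<close> compares with any other universal morphism.\<close>

lemma HPol_expansion_cone:
  fixes K :: "nat \<Rightarrow> 'w set set"
  assumes cone: "cone (\<lambda>n. realization (K n)) (\<lambda>n. realization_map (g n)) X p"
    and K: "\<And>n. simplicial_complex (K n)"
    and V: "\<And>L :: 'v set set. simplicial_complex L \<Longrightarrow>
      expands X (\<lambda>n. realization (K n)) (\<lambda>n. realization_map (g n)) p (realization L)"
    and W: "\<And>L :: 'w set set. simplicial_complex L \<Longrightarrow>
      expands X (\<lambda>n. realization (K n)) (\<lambda>n. realization_map (g n)) p (realization L)"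
  shows "HPol_expansion TYPE('v) TYPE(('m, 'b) inv_system) TYPE('w) X (polyhedral_sequence K g)"
proof -
  interpret cone "\<lambda>n. realization (K n)" "\<lambda>n. realization_map (g n)" X p by (rule cone)
  have "in_HPol TYPE('w) (realization (K i))" for i
    using K homotopy_equivalent_space_refl unfolding in_HPol_def by blast
  then have sys: "HPol_system TYPE('w) (polyhedral_sequence K g)"
    unfolding HPol_system_def polyhedral_sequence_def using inverse_system_map_system
    by (simp add: system_simps)
  note own = pro_cone_universal[OF W, where ?'m=nat and ?'b="'w \<Rightarrow> real", folded polyhedral_sequence_def]
  note univ = pro_cone_universal[OF V, where ?'m='m and ?'b='b, folded polyhedral_sequence_def]
  show ?thesis
    unfolding HPol_expansion_def using sys own HPol_universal_transport[OF sys own univ] by blast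
qed

section \<open>Homotopies from common carriers\<close>

lemma homot_faces:
  assumes K: "simplicial_complex K" "finite K" and L: "simplicial_complex L"
    and f: "continuous_map (realization K) (realization L) f"
    and g: "continuous_map (realization K) (realization L) g"
    and face: "\<And>\<sigma> t. \<sigma> \<in> K \<Longrightarrow> t \<in> closed_face \<sigma> \<Longrightarrow> \<exists>\<tau>\<in>L. f t \<in> closed_face \<tau> \<and> g t \<in> closed_face \<tau>"
  shows "homot (realization K) (realization L) f g"
proof (rule homot_contiguous[OF L compact_space_realization[OF K(2,1)] f g])
  fix t assume "t \<in> topspace (realization K)"
  then obtain \<sigma> where "\<sigma> \<in> K" "t \<in> closed_face \<sigma>" by (rule topspace_realizationE)
  then show "\<exists>\<tau>\<in>L. f t \<in> closed_face \<tau> \<and> g t \<in> closed_face \<tau>" by (rule face)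
qed

text \<open>\<open>F\<close> and \<open>G\<close> are carriers of the two maps; the hypothesis on
  unions is contiguity.\<close>

lemma homot_simplicial:
  assumes K: "simplicial_complex K" "finite K" and L: "simplicial_complex L"
    and f: "continuous_map (realization K) (realization L) f"
    and g: "continuous_map (realization K) (realization L) g"
    and face: "\<And>\<sigma> t. \<sigma> \<in> K \<Longrightarrow> t \<in> closed_face \<sigma> \<Longrightarrow> f t \<in> closed_face (F \<sigma>) \<and> g t \<in> closed_face (G \<sigma>)"
    and union: "\<And>\<sigma>. \<sigma> \<in> K \<Longrightarrow> F \<sigma> \<union> G \<sigma> \<in> L"
  shows "homot (realization K) (realization L) f g"
proof (rule homot_faces[OF K L f g])
  fix \<sigma> t assume s: "\<sigma> \<in> K" "t \<in> closed_face \<sigma>"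
  have "finite (F \<sigma> \<union> G \<sigma>)" by (rule simplicial_complexD(1)[OF L union[OF s(1)]])
  then have "f t \<in> closed_face (F \<sigma> \<union> G \<sigma>)" "g t \<in> closed_face (F \<sigma> \<union> G \<sigma>)"
    using face[OF s] by (auto intro: closed_face_mono)
  then show "\<exists>\<tau>\<in>L. f t \<in> closed_face \<tau> \<and> g t \<in> closed_face \<tau>" using union[OF s(1)] by blast
qed

lemma subcomplex_cont:
  assumes "simplicial_complex K" "finite K0" "K0 \<subseteq> K"
  shows "continuous_map (realization K0) (realization K) id"
proof (rule continuous_map_realizationI[OF assms(2,3,1)])
  fix t assume "t \<in> topspace (realization K0)"
  then show "\<exists>\<sigma>\<in>K0. id t \<in> closed_face \<sigma>" by (auto simp: topspace_realization)
qed (simp add: continuous_map_coordinate)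

text \<open>A finite set attains its largest distance, so the strict inequality passes from pairs to
  the supremum.\<close>

lemma diameter_finite_less:
  fixes S :: "'a::metric_space set"
  assumes "finite S" "S \<noteq> {}"
  shows "diameter S < d \<longleftrightarrow> (\<forall>x\<in>S. \<forall>y\<in>S. dist x y < d)"
proof
  assume "diameter S < d"
  moreover have "bounded S" using assms(1) by (rule finite_imp_bounded)
  ultimately show "\<forall>x\<in>S. \<forall>y\<in>S. dist x y < d"
    using diameter_bounded_bound[of S] le_less_trans by blast
next
  assume d: "\<forall>x\<in>S. \<forall>y\<in>S. dist x y < d"
  let ?D = "(\<lambda>(x, y). dist x y) ` (S \<times> S)"
  have fin: "finite ?D" "?D \<noteq> {}" using assms by auto
  have le: "dist x y \<le> Max ?D" if "x \<in> S" "y \<in> S" for x y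
    using that fin by (intro Max_ge) auto
  obtain x where "x \<in> S" using assms(2) by blast
  then have "0 \<le> Max ?D" using le[of x x] by simp
  then have "diameter S \<le> Max ?D" using le by (intro metric_diameter_le)
  also have "Max ?D < d" using d by (subst Max_less_iff[OF fin]) auto
  finally show "diameter S < d" .
qed

section \<open>Barycentric subdivision\<close>

text \<open>The weight of \<open>C\<close> is positive iff \<open>t\<close> is positive on \<open>C\<close> and exceeds on \<open>C\<close> all its values
  off \<open>C\<close>; the sets with positive weight therefore form a chain.\<close>

definition layer_weight :: "'a set \<Rightarrow> ('a \<Rightarrow> real) \<Rightarrow> 'a set \<Rightarrow> real" where
  "layer_weight B t C = (\<Prod>a\<in>C. t a) * (\<Prod>a\<in>C. \<Prod>b\<in>B - C. max 0 (t a - t b))"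

text \<open>A homotopy inverse of the affine homeomorphism from the barycentric subdivision, not its
  exact inverse: one continuous formula replaces the sorting of coordinates, and agreement of
  carriers is what contiguity asks for.\<close>

definition subdiv :: "'a set \<Rightarrow> ('a \<Rightarrow> real) \<Rightarrow> 'a set \<Rightarrow> real" where
  "subdiv B t C = (if C \<in> Pow B - {{}}
     then layer_weight B t C / (\<Sum>D\<in>Pow B - {{}}. layer_weight B t D) else 0)"

lemma layer_weight_nonneg: "(\<And>a. 0 \<le> t a) \<Longrightarrow> 0 \<le> layer_weight B t C"
  unfolding layer_weight_def by (intro mult_nonneg_nonneg prod_nonneg) auto

lemma layer_weight_nonzero:
  assumes "finite B" "C \<subseteq> B" "\<And>a. 0 \<le> t a"
  shows "layer_weight B t C \<noteq> 0 \<longleftrightarrow> (\<forall>a\<in>C. 0 < t a \<and> (\<forall>b\<in>B - C. t b < t a))"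
proof -
  have C: "finite C" using assms finite_subset by blast
  have "layer_weight B t C \<noteq> 0 \<longleftrightarrow> (\<forall>a\<in>C. t a \<noteq> 0) \<and> (\<forall>a\<in>C. \<forall>b\<in>B - C. max 0 (t a - t b) \<noteq> 0)"
    unfolding layer_weight_def using C assms(1) by (auto simp: prod_zero_iff)
  moreover have "t a \<noteq> 0 \<longleftrightarrow> 0 < t a" for a using assms(3)[of a] by linarith
  moreover have "max 0 (t a - t b) \<noteq> 0 \<longleftrightarrow> t b < t a" for a b by linarith
  ultimately show ?thesis by auto
qed

context
  fixes B :: "'a set" and t :: "'a \<Rightarrow> real"
  assumes B: "finite B" and t: "t \<in> closed_face B"
begin

text \<open>The set where \<open>t\<close> attains its maximum on \<open>B\<close> has positive
  weight: the value there is positive and exceeds all others.\<close>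

lemma layer_sum_pos: "0 < (\<Sum>D\<in>Pow B - {{}}. layer_weight B t D)"
proof -
  note nn = closed_faceD(1)[OF t]
  let ?M = "Max (t ` B)"
  let ?C = "{a \<in> B. t a = ?M}"
  have ne: "B \<noteq> {}" using closed_faceD(3)[OF t] by auto
  have max: "t b \<le> ?M" if "b \<in> B" for b using that B by simp
  obtain v where v: "t v \<noteq> 0" using supp_nonempty[OF t] by blast
  then have "0 < t v" "v \<in> B" using nn[of v] closed_faceD(2)[OF t] by auto
  then have "0 < ?M" using max[of v] by linarith
  then have "layer_weight B t ?C \<noteq> 0"
    using max B nn by (subst layer_weight_nonzero) (auto simp: less_le)
  then have "0 < layer_weight B t ?C" using layer_weight_nonneg[of t B ?C, OF nn] by linarith
  moreover have "?C \<in> Pow B - {{}}"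
  proof -
    have "?M \<in> t ` B" using B ne by simp
    then obtain a where "a \<in> B" "?M = t a" by (rule imageE)
    then have "a \<in> ?C" by simp
    then show ?thesis by blast
  qed
  ultimately show ?thesis using B nn by (intro sum_pos2[of _ ?C] layer_weight_nonneg) auto
qed

lemma subdiv_supp:
  assumes "C \<in> supp (subdiv B t)"
  shows "C \<subseteq> B" "C \<noteq> {}" "a \<in> C \<Longrightarrow> 0 < t a" "a \<in> C \<Longrightarrow> b \<in> B - C \<Longrightarrow> t b < t a"
proof -
  have C: "C \<in> Pow B - {{}}" "layer_weight B t C \<noteq> 0"
    using assms by (auto simp: subdiv_def split: if_splits)
  then show "C \<subseteq> B" "C \<noteq> {}" by auto
  show "a \<in> C \<Longrightarrow> 0 < t a" "a \<in> C \<Longrightarrow> b \<in> B - C \<Longrightarrow> t b < t a"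
    using C layer_weight_nonzero[OF B, of C t] closed_faceD(1)[OF t] by auto
qed

text \<open>For \<open>a\<close> in \<open>C - D\<close> and \<open>b\<close> in
  \<open>D - C\<close> the weights would demand both \<open>t b < t a\<close> and
  \<open>t a < t b\<close>.\<close>

lemma subdiv_chain:
  assumes "C \<in> supp (subdiv B t)" "D \<in> supp (subdiv B t)"
  shows "C \<subseteq> D \<or> D \<subseteq> C"
proof (rule ccontr)
  assume "\<not> (C \<subseteq> D \<or> D \<subseteq> C)"
  then obtain a b where "a \<in> C" "a \<notin> D" "b \<in> D" "b \<notin> C" by blast
  then show False
    using subdiv_supp(4)[OF assms(1), of a b] subdiv_supp(4)[OF assms(2), of b a]
      subdiv_supp(1)[OF assms(1)] subdiv_supp(1)[OF assms(2)] by force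
qed

lemma subdiv_supp_subset: "C \<in> supp (subdiv B t) \<Longrightarrow> C \<subseteq> supp t"
  using subdiv_supp(3) by fastforce

lemma finite_subdiv_supp: "finite (supp (subdiv B t))"
  by (rule finite_subset[of _ "Pow B"]) (use subdiv_supp(1) B in auto)

lemma subdiv_in_face: "subdiv B t \<in> closed_face (supp (subdiv B t))"
proof -
  have "subdiv B t \<in> closed_face (Pow B - {{}})"
  proof (rule closed_faceI)
    have "sum (subdiv B t) (Pow B - {{}})
        = (\<Sum>C\<in>Pow B - {{}}. layer_weight B t C / (\<Sum>D\<in>Pow B - {{}}. layer_weight B t D))"
      by (intro sum.cong) (auto simp: subdiv_def)
    then show "sum (subdiv B t) (Pow B - {{}}) = 1"
      using layer_sum_pos by (simp flip: sum_divide_distrib)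
    show "0 \<le> subdiv B t C" for C
      using layer_sum_pos layer_weight_nonneg[of t B C] closed_faceD(1)[OF t] by (simp add: subdiv_def)
  qed (auto simp: subdiv_def)
  then show ?thesis by (rule closed_face_supp) (use B in auto)
qed

lemma subdiv_in_order_complex:
  assumes "\<And>C. C \<noteq> {} \<Longrightarrow> C \<subseteq> supp t \<Longrightarrow> C \<in> P"
  shows "supp (subdiv B t) \<in> order_complex P"
proof -
  have "C \<in> P" if "C \<in> supp (subdiv B t)" for C
    using assms[OF subdiv_supp(2)[OF that] subdiv_supp_subset[OF that]] .
  then show ?thesis
    unfolding order_complex_def
    using finite_subdiv_supp supp_nonempty[OF subdiv_in_face] subdiv_chain by blast
qed

end

lemma simplicial_order_complex: "simplicial_complex (order_complex P)"
  unfolding simplicial_complex_def order_complex_def by (auto intro: finite_subset)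

lemma finite_order_complex: "finite P \<Longrightarrow> finite (order_complex P)"
  by (rule finite_subset[of _ "Pow P"]) (auto simp: order_complex_def)

lemma subdiv_cont:
  assumes B: "finite B" and K: "simplicial_complex K" "\<And>\<sigma>. \<sigma> \<in> K \<Longrightarrow> \<sigma> \<subseteq> B"
  shows "continuous_map (realization K) (realization (order_complex K)) (subdiv B)"
proof (rule continuous_map_realizationI[OF _ order_refl simplicial_order_complex])
  have fin: "finite K" by (rule finite_subset[of _ "Pow B"]) (use K(2) B in auto)
  then show "finite (order_complex K)" by (rule finite_order_complex)
  have inB: "t \<in> closed_face B" if "t \<in> closed_face \<sigma>" "\<sigma> \<in> K" for t \<sigma>
    using closed_face_mono[OF that(1) K(2)[OF that(2)] B] .
  fix t assume "t \<in> topspace (realization K)"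
  then obtain \<sigma> where s: "\<sigma> \<in> K" "t \<in> closed_face \<sigma>" by (rule topspace_realizationE)
  have "C \<in> K" if "C \<noteq> {}" "C \<subseteq> supp t" for C
    using simplicial_complexD(3)[OF K(1) supp_in_complex[OF K(1) s(2,1)] that(2,1)] .
  then show "\<exists>\<sigma>\<in>order_complex K. subdiv B t \<in> closed_face \<sigma>"
    using subdiv_in_order_complex[OF B inB[OF s(2,1)]] subdiv_in_face[OF B inB[OF s(2,1)]] by blast
next
  fix C
  have fin: "finite K" by (rule finite_subset[of _ "Pow B"]) (use K(2) B in auto)
  let ?T = "\<Union>\<sigma>\<in>K. closed_face \<sigma>"
  have "(\<Sum>D\<in>Pow B - {{}}. layer_weight B t D) \<noteq> 0" if t: "t \<in> ?T" for t
  proof -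
    obtain \<sigma> where s: "\<sigma> \<in> K" "t \<in> closed_face \<sigma>" using t by blast
    show ?thesis using layer_sum_pos[OF B closed_face_mono[OF s(2) K(2)[OF s(1)] B]] by simp
  qed
  moreover have "continuous_on ?T (\<lambda>t. layer_weight B t D)" for D
    unfolding layer_weight_def by (intro continuous_intros continuous_coordinate)
  ultimately have "continuous_on ?T (\<lambda>t. layer_weight B t C / (\<Sum>D\<in>Pow B - {{}}. layer_weight B t D))"
    by (intro continuous_on_divide continuous_on_sum) auto
  then have "continuous_on ?T (\<lambda>t. subdiv B t C)"
    by (cases "C \<in> Pow B - {{}}") (simp_all only: subdiv_def if_True if_False continuous_on_const)
  then show "continuous_map (realization K) euclideanreal (\<lambda>t. subdiv B t C)"
    using realization_finite[OF fin simplicial_complexD(1)[OF K(1)]] by simp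
qed

definition barycenter :: "'a set \<Rightarrow> 'a \<Rightarrow> real" where
  "barycenter C = (\<lambda>a. if a \<in> C then 1 / real (card C) else 0)"

lemma barycenter_in_face: "finite C \<Longrightarrow> C \<noteq> {} \<Longrightarrow> barycenter C \<in> closed_face C"
  by (auto simp: barycenter_def closed_face_def)

text \<open>The coordinate of \<open>a\<close> in a barycentric combination of a chain depends only
  on which members contain \<open>a\<close>. A set \<open>C\<close> of positive weight is separated
  from its complement by strict inequalities, each caused by a member of the chain; so
  \<open>C\<close> is a union of members, and a finite non-empty chain contains its union.\<close>

lemma subdiv_barycentric:
  assumes B: "finite B" and P: "finite P" and y: "y \<in> closed_face \<D>" and D: "\<D> \<in> order_complex P"
    and PB: "\<And>C. C \<in> P \<Longrightarrow> C \<subseteq> B \<and> C \<noteq> {}"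
  shows "subdiv B (affine_ext P barycenter y) \<in> closed_face \<D>"
proof -
  let ?t = "affine_ext P barycenter y"
  have D': "finite \<D>" "\<D> \<subseteq> P" and chain: "\<And>C D. C \<in> \<D> \<Longrightarrow> D \<in> \<D> \<Longrightarrow> C \<subseteq> D \<or> D \<subseteq> C"
    using D by (auto simp: order_complex_def)
  have t: "?t \<in> closed_face B"
  proof (rule affine_ext_in_face[OF y D'(2) P])
    fix C assume "C \<in> \<D>"
    then have "C \<subseteq> B" "C \<noteq> {}" using D' PB by auto
    then show "barycenter C \<in> closed_face B"
      using closed_face_mono[OF barycenter_in_face _ B] finite_subset[OF _ B] by blast
  qed
  have eq: "?t a = (\<Sum>C\<in>\<D>. y C * barycenter C a)" for a
    unfolding affine_ext_def using P D'(2) closed_faceD(2)[OF y] by (intro sum.mono_neutral_right) auto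
  have sep: "\<exists>D\<in>\<D>. a \<in> D \<and> b \<notin> D" if "?t b < ?t a" for a b
  proof (rule ccontr)
    assume "\<not> (\<exists>D\<in>\<D>. a \<in> D \<and> b \<notin> D)"
    then have "barycenter D a \<le> barycenter D b" if "D \<in> \<D>" for D
      using that by (auto simp: barycenter_def)
    then have "?t a \<le> ?t b"
      unfolding eq using closed_faceD(1)[OF y] by (intro sum_mono mult_left_mono) auto
    then show False using that by simp
  qed
  have pos: "\<exists>D\<in>\<D>. a \<in> D" if "0 < ?t a" for a
  proof (rule ccontr)
    assume "\<not> (\<exists>D\<in>\<D>. a \<in> D)"
    then have "?t a = 0" unfolding eq by (intro sum.neutral) (auto simp: barycenter_def)
    then show False using that by simp
  qed
  have "C \<in> \<D>" if C: "C \<in> supp (subdiv B ?t)" for C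
  proof -
    note CB = subdiv_supp[OF B t C]
    have sub: "subset.chain UNIV \<E>" if "\<E> \<subseteq> \<D>" for \<E>
      using chain that by (auto simp: subset.chain_def)
    \<comment> \<open>The smallest member containing \<open>a\<close> lies in \<open>C\<close>: a
      point \<open>b\<close> of it outside \<open>C\<close> would be missing from some other member
      containing \<open>a\<close>.\<close>
    have "\<exists>D\<in>\<D>. a \<in> D \<and> D \<subseteq> C" if a: "a \<in> C" for a
    proof -
      define \<E> where "\<E> = {D \<in> \<D>. a \<in> D}"
      have "\<E> \<noteq> {}" using pos[OF CB(3)[OF a]] by (auto simp: \<E>_def)
      moreover have "finite \<E>" "subset.chain UNIV \<E>" using D'(1) by (auto simp: \<E>_def intro!: sub)
      ultimately have "\<Inter>\<E> \<in> \<E>" using Inter_in_chain[of \<E> UNIV] by simp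
      then have I: "\<Inter>\<E> \<in> \<D>" "a \<in> \<Inter>\<E>" by (simp_all add: \<E>_def)
      have "\<Inter>\<E> \<subseteq> C"
      proof (rule subsetI, rule ccontr)
        fix b assume b: "b \<in> \<Inter>\<E>" "b \<notin> C"
        have "\<Inter>\<E> \<subseteq> B" using PB D'(2) I(1) by blast
        then have "b \<in> B - C" using b by blast
        then obtain D where "D \<in> \<D>" "a \<in> D" "b \<notin> D" using sep[OF CB(4)[OF a]] by blast
        then show False using b(1) by (auto simp: \<E>_def)
      qed
      then show ?thesis using I by blast
    qed
    then have CU: "C = \<Union>{D \<in> \<D>. D \<subseteq> C}" by blast
    then have ne: "{D \<in> \<D>. D \<subseteq> C} \<noteq> {}" using CB(2) by blast
    have "\<Union>{D \<in> \<D>. D \<subseteq> C} \<in> {D \<in> \<D>. D \<subseteq> C}"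
      by (rule Union_in_chain[OF _ ne sub]) (use D'(1) in auto)
    then show ?thesis using CU by simp
  qed
  then have "supp (subdiv B ?t) \<subseteq> \<D>" by blast
  then show ?thesis by (rule closed_face_mono[OF subdiv_in_face[OF B t] _ D'(1)])
qed

section \<open>The polyhedral approximative sequences\<close>

lemma nearest_set_mono: "C \<subseteq> D \<Longrightarrow> nearest_set A C \<subseteq> nearest_set A D"
  by (auto simp: nearest_set_def)

lemma upper_dowkerI:
  "finite \<sigma> \<Longrightarrow> \<sigma> \<noteq> {} \<Longrightarrow> \<sigma> \<subseteq> P \<Longrightarrow> D \<in> P \<Longrightarrow> (\<And>C. C \<in> \<sigma> \<Longrightarrow> C \<subseteq> D) \<Longrightarrow> \<sigma> \<in> upper_dowker P"
  unfolding upper_dowker_def by blast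

lemma lower_dowkerI:
  "finite \<sigma> \<Longrightarrow> \<sigma> \<noteq> {} \<Longrightarrow> \<sigma> \<subseteq> P \<Longrightarrow> D \<in> P \<Longrightarrow> (\<And>C. C \<in> \<sigma> \<Longrightarrow> D \<subseteq> C) \<Longrightarrow> \<sigma> \<in> lower_dowker P"
  unfolding lower_dowker_def by blast

section \<open>Cells, Rips complexes and their barycentric subdivisions\<close>

context approx_sequence
begin

abbreviation cells where "cells n \<equiv> small_subsets (2 * \<epsilon> n) (A n)"

lemma cells_iff: "C \<in> cells n \<longleftrightarrow> C \<subseteq> A n \<and> C \<noteq> {} \<and> (\<forall>x\<in>C. \<forall>y\<in>C. dist x y < 2 * \<epsilon> n)"
  using diameter_finite_less[OF finite_subset[OF _ A_finite[of n]], of C "2 * \<epsilon> n"]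
  by (auto simp: small_subsets_def)

lemma finite_cells: "finite (cells n)"
  by (rule finite_subset[of _ "Pow (A n)"]) (auto simp: small_subsets_def A_finite)

lemma finite_cell: "C \<in> cells n \<Longrightarrow> finite C"
  using finite_subset[OF _ A_finite[of n]] by (simp add: small_subsets_def)

lemma cells_subset: "C \<in> cells n \<Longrightarrow> D \<subseteq> C \<Longrightarrow> D \<noteq> {} \<Longrightarrow> D \<in> cells n"
  unfolding cells_iff by blast

lemma simplicial_cells: "simplicial_complex (cells n)"
  unfolding simplicial_complex_def
proof (intro ballI conjI allI impI)
  fix \<sigma> assume s: "\<sigma> \<in> cells n"
  show "finite \<sigma>" by (rule finite_cell[OF s])
  show "\<sigma> \<noteq> {}" using s by (simp add: cells_iff)
  show "\<tau> \<in> cells n" if "\<tau> \<subseteq> \<sigma>" "\<tau> \<noteq> {}" for \<tau> by (rule cells_subset[OF s that])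
qed

text \<open>The points of the finite space are the simplices of the Rips complex, so the order
  complex of the former is the barycentric subdivision of the latter.\<close>

lemma rips_eq_cells: "rips_complex (2 * \<epsilon> n) (A n) = cells n"
  using finite_cell unfolding rips_complex_def small_subsets_def by blast

lemma singleton_cell: "a \<in> A n \<Longrightarrow> {a} \<in> cells n"
  using eps_pos[of n] by (simp add: cells_iff)

lemma near_cell:
  assumes "x \<in> X" shows "near n x \<in> cells n"
  unfolding cells_iff
proof (intro conjI ballI)
  show "near n x \<subseteq> A n" by (auto simp: near_def)
  show "near n x \<noteq> {}" by (rule simplicial_complexD(2)[OF simplicial_ball_complex near_in[OF assms]])
  fix a b assume "a \<in> near n x" "b \<in> near n x"
  then show "dist a b < 2 * \<epsilon> n" using dist_triangle3[of a b x] by (simp add: near_def)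
qed

lemma ball_complex_cells: "\<sigma> \<in> ball_complex n \<Longrightarrow> \<sigma> \<in> cells n"
proof -
  assume s: "\<sigma> \<in> ball_complex n"
  then obtain x where "x \<in> X" "\<sigma> \<subseteq> near n x" "\<sigma> \<noteq> {}" by (auto simp: ball_complex_def near_def)
  then show ?thesis using cells_subset[OF near_cell] by blast
qed

text \<open>Each of two points moves by at most \<open>gap n\<close>; twice the adjustment
  inequality covers both moves and the original distance.\<close>

lemma nearest_set_cell:
  assumes "C \<in> cells (Suc n)" shows "nearest_set (A n) C \<in> cells n"
  unfolding cells_iff
proof (intro conjI ballI)
  have CX: "C \<subseteq> X" "C \<noteq> {}" using assms A_subset[of "Suc n"] by (auto simp: cells_iff)
  show "nearest_set (A n) C \<subseteq> A n" by (auto simp: nearest_set_def nearest_def)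
  show "nearest_set (A n) C \<noteq> {}" using CX(2) nearest_nonempty[of n] by (auto simp: nearest_set_def)
  fix b b' assume "b \<in> nearest_set (A n) C" "b' \<in> nearest_set (A n) C"
  then obtain c c' where c: "c \<in> C" "c' \<in> C" "b \<in> nearest (A n) c" "b' \<in> nearest (A n) c'"
    by (auto simp: nearest_set_def)
  have "dist c b \<le> gap n" "dist c' b' \<le> gap n" using nearestD(2) c CX by blast+
  moreover have "dist c c' < 2 * \<epsilon> (Suc n)" using assms c by (simp add: cells_iff)
  moreover have "dist b b' \<le> dist c b + dist c c' + dist c' b'"
    using dist_triangle[of b b' c] dist_triangle[of c b' c'] by (simp add: dist_commute)
  ultimately show "dist b b' < 2 * \<epsilon> n" using eps_step[of n] eps_pos[of "Suc n"] by linarith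
qed

abbreviation nset where "nset n \<equiv> nearest_set (A n)"

definition pick :: "'a set \<Rightarrow> 'a" where "pick C = (SOME a. a \<in> C)"

lemma pick_in: "C \<in> cells n \<Longrightarrow> pick C \<in> C"
  unfolding pick_def cells_iff by (simp add: some_in_eq)

lemma order_sequence: "simplicial_sequence (\<lambda>n. order_complex (cells n)) nset"
proof
  fix n \<sigma> assume s: "\<sigma> \<in> order_complex (cells (Suc n))"
  have "nset n ` \<sigma> \<subseteq> cells n" using s nearest_set_cell by (auto simp: order_complex_def)
  moreover have "nset n C \<subseteq> nset n D \<or> nset n D \<subseteq> nset n C" if "C \<in> \<sigma>" "D \<in> \<sigma>" for C D
  proof -
    have "C \<subseteq> D \<or> D \<subseteq> C" using s that by (simp add: order_complex_def)
    then show ?thesis using nearest_set_mono[of C D] nearest_set_mono[of D C] by blast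
  qed
  ultimately show "nset n ` \<sigma> \<in> order_complex (cells n)"
    using s by (simp add: order_complex_def)
qed (auto intro: simplicial_order_complex finite_order_complex finite_cells)

lemma upper_sequence: "simplicial_sequence (\<lambda>n. upper_dowker (cells n)) nset"
proof
  fix n
  show "simplicial_complex (upper_dowker (cells n))"
    unfolding simplicial_complex_def upper_dowker_def by (auto intro: finite_subset)
  show "finite (upper_dowker (cells n))"
    by (rule finite_subset[of _ "Pow (cells n)"]) (auto simp: upper_dowker_def finite_cells)
  fix \<sigma> assume "\<sigma> \<in> upper_dowker (cells (Suc n))"
  then obtain D where D: "finite \<sigma>" "\<sigma> \<noteq> {}" "\<sigma> \<subseteq> cells (Suc n)" "D \<in> cells (Suc n)" "\<forall>C\<in>\<sigma>. C \<subseteq> D"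
    by (auto simp: upper_dowker_def)
  then have "\<forall>C\<in>nset n ` \<sigma>. C \<subseteq> nset n D" using nearest_set_mono by blast
  moreover have "nset n ` \<sigma> \<subseteq> cells n" using D(3) nearest_set_cell by blast
  ultimately show "nset n ` \<sigma> \<in> upper_dowker (cells n)"
    using D(1,2) by (intro upper_dowkerI[OF _ _ _ nearest_set_cell[OF D(4)]]) auto
qed

lemma lower_sequence: "simplicial_sequence (\<lambda>n. lower_dowker (cells n)) nset"
proof
  fix n
  show "simplicial_complex (lower_dowker (cells n))"
    unfolding simplicial_complex_def lower_dowker_def by (auto intro: finite_subset)
  show "finite (lower_dowker (cells n))"
    by (rule finite_subset[of _ "Pow (cells n)"]) (auto simp: lower_dowker_def finite_cells)
  fix \<sigma> assume "\<sigma> \<in> lower_dowker (cells (Suc n))"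
  then obtain D where D: "finite \<sigma>" "\<sigma> \<noteq> {}" "\<sigma> \<subseteq> cells (Suc n)" "D \<in> cells (Suc n)" "\<forall>C\<in>\<sigma>. D \<subseteq> C"
    by (auto simp: lower_dowker_def)
  then have "\<forall>C\<in>nset n ` \<sigma>. nset n D \<subseteq> C" using nearest_set_mono by blast
  moreover have "nset n ` \<sigma> \<subseteq> cells n" using D(3) nearest_set_cell by blast
  ultimately show "nset n ` \<sigma> \<in> lower_dowker (cells n)"
    using D(1,2) by (intro lower_dowkerI[OF _ _ _ nearest_set_cell[OF D(4)]]) auto
qed

lemma comp_nset_cell: "D \<in> cells (n + k) \<Longrightarrow> comp_bond nset n k D \<in> cells n"
proof (induction k arbitrary: D)
  case (Suc k)
  then show ?case using Suc.IH[OF nearest_set_cell[of D "n + k"]] by simp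
qed simp

lemma comp_nset_dist:
  "D \<in> cells (n + k) \<Longrightarrow> b \<in> comp_bond nset n k D \<Longrightarrow> \<exists>d\<in>D. dist d b \<le> drift n k"
proof (induction k arbitrary: D)
  case 0
  then show ?case by (auto simp: drift_def)
next
  case (Suc k)
  have D: "D \<in> cells (Suc (n + k))" using Suc.prems(1) by simp
  obtain d where d: "d \<in> nset (n + k) D" "dist d b \<le> drift n k"
    using Suc.IH[OF nearest_set_cell[OF D]] Suc.prems(2) by auto
  then obtain c where c: "c \<in> D" "d \<in> nearest (A (n + k)) c" by (auto simp: nearest_set_def)
  have "c \<in> X" using c D A_subset by (auto simp: cells_iff)
  then have "dist c d \<le> gap (n + k)" using nearestD(2)[OF c(2)] by blast
  then have "dist c b \<le> drift n (Suc k)" using d(2) dist_triangle[of c b d] by (simp add: drift_def)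
  then show ?case using c(1) by blast
qed

lemma Union_order_simplex:
  assumes "\<sigma> \<in> order_complex (cells n)"
  shows "\<Union>\<sigma> \<in> cells n"
proof -
  have "\<Union>\<sigma> \<in> \<sigma>"
    using assms by (intro Union_in_chain[of \<sigma> UNIV]) (auto simp: order_complex_def subset.chain_def)
  then show ?thesis using assms by (auto simp: order_complex_def)
qed

lemma Union_order_complex: "\<Union>(order_complex (cells n)) = cells n"
proof
  show "cells n \<subseteq> \<Union>(order_complex (cells n))"
  proof
    fix C assume "C \<in> cells n"
    then have "{C} \<in> order_complex (cells n)" by (simp add: order_complex_def)
    then show "C \<in> \<Union>(order_complex (cells n))" by blast
  qed
qed (auto simp: order_complex_def)

text \<open>The classical affine map from the barycentric subdivision, sending the vertex
  \<open>C\<close> to the barycentre of the simplex \<open>C\<close>.\<close>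

abbreviation unsubdiv where "unsubdiv n \<equiv> affine_ext (cells n) barycenter"

lemma barycenter_in_Union:
  assumes "\<sigma> \<in> order_complex (cells n)" "C \<in> \<sigma>"
  shows "barycenter C \<in> closed_face (\<Union>\<sigma>)"
proof -
  have C: "C \<in> cells n" using assms by (auto simp: order_complex_def)
  have "C \<noteq> {}" using C by (simp add: cells_iff)
  then show ?thesis
    by (rule closed_face_mono[OF barycenter_in_face[OF finite_cell[OF C]] Union_upper[OF assms(2)]
        finite_cell[OF Union_order_simplex[OF assms(1)]]])
qed

lemma unsubdiv_in_face:
  assumes "\<sigma> \<in> order_complex (cells n)" "y \<in> closed_face \<sigma>"
  shows "unsubdiv n y \<in> closed_face (\<Union>\<sigma>)"
proof (rule affine_ext_in_face[OF assms(2) _ finite_cells])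
  show "\<sigma> \<subseteq> cells n" using assms by (auto simp: order_complex_def)
qed (rule barycenter_in_Union[OF assms(1)])

lemma unsubdiv_cont: "continuous_map (realization (order_complex (cells n))) (realization (cells n)) (unsubdiv n)"
proof -
  have "continuous_map (realization (order_complex (cells n))) (realization (cells n))
      (affine_ext (\<Union>(order_complex (cells n))) barycenter)"
  proof (rule affine_ext_cont[OF simplicial_order_complex finite_order_complex[OF finite_cells] simplicial_cells])
    fix \<sigma> assume "\<sigma> \<in> order_complex (cells n)"
    then show "\<exists>\<tau>\<in>cells n. \<forall>v\<in>\<sigma>. barycenter v \<in> closed_face \<tau>"
      using Union_order_simplex barycenter_in_Union by blast
  qed
  then show ?thesis by (simp only: Union_order_complex)
qed

lemma cell_face_A: "\<sigma> \<in> cells n \<Longrightarrow> t \<in> closed_face \<sigma> \<Longrightarrow> t \<in> closed_face (A n)"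
  using closed_face_mono[OF _ _ A_finite[of n]] by (auto simp: cells_iff)

lemma subdiv_cells_cont: "continuous_map (realization (cells n)) (realization (order_complex (cells n))) (subdiv (A n))"
  by (rule subdiv_cont[OF A_finite simplicial_cells]) (simp add: cells_iff)

lemma subdiv_supp_cells:
  assumes "\<sigma> \<in> cells n" "t \<in> closed_face \<sigma>"
  shows "supp (subdiv (A n) t) \<in> order_complex (cells n)" "\<Union>(supp (subdiv (A n) t)) \<subseteq> \<sigma>"
    "subdiv (A n) t \<in> closed_face (supp (subdiv (A n) t))"
proof -
  note t = cell_face_A[OF assms]
  show "supp (subdiv (A n) t) \<in> order_complex (cells n)"
  proof (rule subdiv_in_order_complex[OF A_finite t])
    fix C assume "C \<noteq> {}" "C \<subseteq> supp t"
    then show "C \<in> cells n" using cells_subset[OF assms(1)] closed_faceD(2)[OF assms(2)] by blast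
  qed
  show "\<Union>(supp (subdiv (A n) t)) \<subseteq> \<sigma>"
    using subdiv_supp_subset[OF A_finite t] closed_faceD(2)[OF assms(2)] by blast
  show "subdiv (A n) t \<in> closed_face (supp (subdiv (A n) t))" by (rule subdiv_in_face[OF A_finite t])
qed

text \<open>The composite preserves each closed simplex \<open>\<sigma>\<close>, since all sets of
  positive weight at \<open>t\<close> are subsets of the carrier of \<open>t\<close>.\<close>

lemma unsubdiv_subdiv: "homot (realization (cells n)) (realization (cells n)) (unsubdiv n \<circ> subdiv (A n)) id"
proof (rule homot_simplicial[OF simplicial_cells finite_cells simplicial_cells
      continuous_map_compose[OF subdiv_cells_cont unsubdiv_cont], where F="\<lambda>\<sigma>. \<sigma>" and G="\<lambda>\<sigma>. \<sigma>"])
  fix \<sigma> t assume s: "\<sigma> \<in> cells n" "t \<in> closed_face \<sigma>"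
  have "unsubdiv n (subdiv (A n) t) \<in> closed_face \<sigma>"
    by (rule closed_face_mono[OF unsubdiv_in_face[OF subdiv_supp_cells(1,3)[OF s]] subdiv_supp_cells(2)[OF s] finite_cell[OF s(1)]])
  then show "(unsubdiv n \<circ> subdiv (A n)) t \<in> closed_face \<sigma> \<and> id t \<in> closed_face \<sigma>" using s by simp
qed auto

lemma subdiv_unsubdiv:
  "homot (realization (order_complex (cells n))) (realization (order_complex (cells n))) (subdiv (A n) \<circ> unsubdiv n) id"
proof (rule homot_simplicial[OF simplicial_order_complex finite_order_complex[OF finite_cells] simplicial_order_complex
      continuous_map_compose[OF unsubdiv_cont subdiv_cells_cont], where F="\<lambda>\<sigma>. \<sigma>" and G="\<lambda>\<sigma>. \<sigma>"])
  fix \<sigma> y assume s: "\<sigma> \<in> order_complex (cells n)" "y \<in> closed_face \<sigma>"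
  have "subdiv (A n) (unsubdiv n y) \<in> closed_face \<sigma>"
    by (rule subdiv_barycentric[OF A_finite finite_cells s(2,1)]) (simp add: cells_iff)
  then show "(subdiv (A n) \<circ> unsubdiv n) y \<in> closed_face \<sigma> \<and> id y \<in> closed_face \<sigma>" using s by simp
qed auto

end

section \<open>Comparison of the Rips and witness complexes with the ball nerves\<close>

context approx_choice
begin

lemma choice_nset: "C \<subseteq> A (Suc n) \<Longrightarrow> \<pi> n ` C \<subseteq> nset n C"
  using choice_nearest by (auto simp: nearest_set_def)

lemma choice_cells:
  assumes "C \<in> cells (Suc n)" shows "\<pi> n ` C \<in> cells n"
  using cells_subset[OF nearest_set_cell[OF assms] choice_nset] assms by (simp add: cells_iff)

lemma comp_choice_nset:
  "D \<in> cells (n + k) \<Longrightarrow> a \<in> D \<Longrightarrow> comp_bond \<pi> n k a \<in> comp_bond nset n k D"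
proof (induction k arbitrary: D a)
  case (Suc k)
  have D: "D \<in> cells (Suc (n + k))" using Suc.prems(1) by simp
  then have "\<pi> (n + k) a \<in> nset (n + k) D" using choice_nset[of D "n + k"] Suc.prems(2) by (auto simp: cells_iff)
  then show ?case using Suc.IH[OF nearest_set_cell[OF D]] by simp
qed simp

text \<open>For complexes between the nerve and the Rips complex, the inclusion and the choice map
  into the nerve one stage down interleave with shift 1. The triangles commute strictly, since both
  composites are the choice map on vertices.\<close>

lemma centre_interleaving:
  assumes seq: "simplicial_sequence K \<pi>"
    and sub: "\<And>n. ball_complex n \<subseteq> K n" "\<And>n. K n \<subseteq> cells n"
  shows "interleaving ball_polyhedron bnd (top_of_set X) partition_map (\<lambda>n. realization (K n)) bnd (\<lambda>_. id)"
proof -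
  interpret K: simplicial_sequence K \<pi> by (rule seq)
  have s_cont: "continuous_map (ball_polyhedron n) (realization (K n)) id" for n
    by (rule subcomplex_cont[OF K.complex finite_ball_complex sub(1)])
  have l: "continuous_map (realization (K (Suc n))) (ball_polyhedron n) (bnd n)" for n
  proof (rule realization_map_cont[OF K.complex K.finite_complex simplicial_ball_complex])
    fix \<sigma> assume "\<sigma> \<in> K (Suc n)"
    then have s: "\<sigma> \<in> cells (Suc n)" using sub(2) by blast
    then obtain a where a: "a \<in> \<sigma>" by (auto simp: cells_iff)
    have sA: "\<sigma> \<subseteq> A (Suc n)" using s by (simp add: cells_iff)
    \<comment> \<open>Any vertex \<open>a\<close> of the simplex is a witness, because
      \<open>2 * \<epsilon> (Suc n) + gap n < \<epsilon> n\<close>.\<close>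
    show "\<pi> n ` \<sigma> \<in> ball_complex n"
    proof (rule ball_complexI[of _ n a])
      show "\<pi> n ` \<sigma> \<subseteq> A n" using sA choice_dist(1) by blast
      show "a \<in> X" using a sA A_subset by blast
      fix c assume "c \<in> \<pi> n ` \<sigma>"
      then obtain b where b: "b \<in> \<sigma>" "c = \<pi> n b" by blast
      have "dist a b < 2 * \<epsilon> (Suc n)" using s a b by (simp add: cells_iff)
      moreover have "dist b c \<le> gap n" using choice_dist(2) b sA by blast
      ultimately show "dist a c < \<epsilon> n" using dist_triangle[of a c b] eps_step[of n] by linarith
    qed (use a in blast)
  qed
  show ?thesis
  proof (intro interleaving.intro interleaving_axioms.intro ball.cone_axioms K.map_sequence_axioms s_cont)
    fix n
    show "homot (ball_polyhedron (Suc n)) (realization (K n)) (id \<circ> bnd n) (bnd n \<circ> id)"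
      using continuous_map_compose[OF ball.bond_cont s_cont] by simp
    show "\<exists>k l. continuous_map (realization (K (n + k))) (ball_polyhedron n) l \<and>
      homot (ball_polyhedron (n + k)) (ball_polyhedron n) (l \<circ> id) (comp_bond bnd n k) \<and>
      homot (realization (K (n + k))) (realization (K n)) (id \<circ> l) (comp_bond bnd n k)"
      using l[of n] ball.bond_cont[of n] K.bond_cont[of n] by (intro exI[of _ 1] exI[of _ "bnd n"]) simp
  qed
qed

lemma cells_sequence: "simplicial_sequence cells \<pi>"
  by unfold_locales (auto intro: simplicial_cells finite_cells choice_cells)

sublocale rips: interleaving ball_polyhedron bnd "top_of_set X" partition_map
    "\<lambda>n. realization (cells n)" bnd "\<lambda>_. id"
  by (rule centre_interleaving[OF cells_sequence]) (auto intro: ball_complex_cells)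

lemma expansion_over_ball:
  fixes K :: "nat \<Rightarrow> 'w set set"
  assumes K: "\<And>n. simplicial_complex (K n)"
    and int: "interleaving ball_polyhedron bnd (top_of_set X) partition_map
      (\<lambda>n. realization (K n)) (\<lambda>n. realization_map (g n)) s"
  shows "HPol_expansion TYPE('v) TYPE(('m, 'b) inv_system) TYPE('w) (top_of_set X) (polyhedral_sequence K g)"
proof -
  interpret K: interleaving ball_polyhedron bnd "top_of_set X" partition_map
    "\<lambda>n. realization (K n)" "\<lambda>n. realization_map (g n)" s by (rule int)
  show ?thesis
    by (rule HPol_expansion_cone[OF K.target.cone_axioms K
          K.expands_transfer[OF ball_expands] K.expands_transfer[OF ball_expands]])
qed

text \<open>The criterion is transferred twice, from the nerves to the Rips complexes and from there
  to \<open>K\<close>. The form \<open>id \<circ> partition_map n\<close> is the cone as the first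
  transfer delivers it.\<close>

lemma expansion_over_rips:
  fixes K :: "nat \<Rightarrow> 'w set set"
  assumes K: "\<And>n. simplicial_complex (K n)"
    and int: "interleaving (\<lambda>n. realization (cells n)) bnd (top_of_set X) (\<lambda>n. id \<circ> partition_map n)
      (\<lambda>n. realization (K n)) (\<lambda>n. realization_map (g n)) s"
  shows "HPol_expansion TYPE('v) TYPE(('m, 'b) inv_system) TYPE('w) (top_of_set X) (polyhedral_sequence K g)"
proof -
  interpret K: interleaving "\<lambda>n. realization (cells n)" bnd "top_of_set X" "\<lambda>n. id \<circ> partition_map n"
    "\<lambda>n. realization (K n)" "\<lambda>n. realization_map (g n)" s by (rule int)
  show ?thesis
    by (rule HPol_expansion_cone[OF K.target.cone_axioms K
          K.expands_transfer[OF rips.expands_transfer[OF ball_expands]]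
          K.expands_transfer[OF rips.expands_transfer[OF ball_expands]]])
qed

lemma rips_expansion:
  "HPol_expansion TYPE('v) TYPE(('m, 'b) inv_system) TYPE('a) (top_of_set X) (rips_sequence \<epsilon> A \<pi>)"
  unfolding rips_sequence_def rips_eq_cells
  by (rule expansion_over_ball[OF simplicial_cells rips.interleaving_axioms])

text \<open>Applied to a two-element subset, the witness condition bounds the sum of two distances
  by \<open>2 * \<epsilon> n\<close>, and the triangle inequality does the rest.\<close>

lemma witness_pairs:
  assumes "\<sigma> \<in> witness_complex X (\<epsilon> n) (A n)" shows "\<sigma> \<in> cells n"
  unfolding cells_iff
proof (intro conjI ballI)
  show "\<sigma> \<subseteq> A n" "\<sigma> \<noteq> {}" using assms by (auto simp: witness_complex_def)
  fix a b assume ab: "a \<in> \<sigma>" "b \<in> \<sigma>"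
  show "dist a b < 2 * \<epsilon> n"
  proof (cases "a = b")
    case False
    have wit: "\<exists>x\<in>X. (\<Sum>a\<in>\<tau>. dist x a) < real (card \<tau>) * \<epsilon> n" if "\<tau> \<subseteq> \<sigma>" "\<tau> \<noteq> {}" for \<tau>
      using assms that by (simp add: witness_complex_def)
    obtain x where "(\<Sum>a\<in>{a, b}. dist x a) < real (card {a, b}) * \<epsilon> n"
      using wit[of "{a, b}"] ab by fast
    then show ?thesis using False dist_triangle3[of a b x] by simp
  qed (use eps_pos[of n] in simp)
qed

lemma witness_sequence: "simplicial_sequence (\<lambda>n. witness_complex X (\<epsilon> n) (A n)) \<pi>"
proof
  fix n
  show "simplicial_complex (witness_complex X (\<epsilon> n) (A n))"
    unfolding simplicial_complex_def witness_complex_def by (auto intro: finite_subset)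
  show "finite (witness_complex X (\<epsilon> n) (A n))"
    by (rule finite_subset[OF _ finite_cells[of n]]) (use witness_pairs in blast)
  fix \<sigma> assume s: "\<sigma> \<in> witness_complex X (\<epsilon> (Suc n)) (A (Suc n))"
  then have sA: "\<sigma> \<subseteq> A (Suc n)" "finite \<sigma>" "\<sigma> \<noteq> {}" by (auto simp: witness_complex_def)
  have wit: "\<exists>x\<in>X. (\<Sum>a\<in>\<tau>. dist x a) < real (card \<tau>) * \<epsilon> (Suc n)" if "\<tau> \<subseteq> \<sigma>" "\<tau> \<noteq> {}" for \<tau>
    using s that by (simp add: witness_complex_def)
  have "\<exists>x\<in>X. (\<Sum>a\<in>\<tau>. dist x a) < real (card \<tau>) * \<epsilon> n" if t: "\<tau> \<subseteq> \<pi> n ` \<sigma>" "\<tau> \<noteq> {}" for \<tau>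
  proof -
    \<comment> \<open>The choice map may identify vertices. A set \<open>\<rho>\<close> of
      representatives has as many elements as \<open>\<tau>\<close>, so the sums compare term by
      term, and \<open>\<rho>\<close> has a witness because all non-empty subsets of
      \<open>\<sigma>\<close> do.\<close>
    obtain \<rho> where r: "\<rho> \<subseteq> \<sigma>" "inj_on (\<pi> n) \<rho>" "\<tau> = \<pi> n ` \<rho>"
      using t(1) subset_image_inj[of \<tau> "\<pi> n" \<sigma>] by blast
    obtain x where x: "x \<in> X" "(\<Sum>a\<in>\<rho>. dist x a) < real (card \<rho>) * \<epsilon> (Suc n)"
      using wit[OF r(1)] t(2) r(3) by blast
    have "(\<Sum>a\<in>\<tau>. dist x a) = (\<Sum>a\<in>\<rho>. dist x (\<pi> n a))"
      unfolding r(3) by (simp add: sum.reindex[OF r(2)])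
    also have "\<dots> \<le> (\<Sum>a\<in>\<rho>. dist x a + gap n)"
    proof (rule sum_mono)
      fix a assume "a \<in> \<rho>"
      then show "dist x (\<pi> n a) \<le> dist x a + gap n"
        using choice_dist(2)[of a n] r(1) sA(1) dist_triangle[of x "\<pi> n a" a] by fastforce
    qed
    also have "\<dots> = (\<Sum>a\<in>\<rho>. dist x a) + real (card \<rho>) * gap n" by (simp add: sum.distrib)
    also have "\<dots> < real (card \<rho>) * (\<epsilon> (Suc n) + gap n)" using x(2) by (simp add: algebra_simps)
    also have "\<dots> \<le> real (card \<rho>) * \<epsilon> n"
      using eps_step[of n] eps_pos[of "Suc n"] by (intro mult_left_mono) auto
    also have "card \<rho> = card \<tau>" unfolding r(3) by (simp add: card_image[OF r(2)])
    finally show ?thesis using x(1) by blast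
  qed
  moreover have "\<pi> n ` \<sigma> \<subseteq> A n" using choice_dist(1) sA(1) by blast
  ultimately show "\<pi> n ` \<sigma> \<in> witness_complex X (\<epsilon> n) (A n)"
    using sA by (auto simp: witness_complex_def)
qed

lemma ball_complex_witness: "ball_complex n \<subseteq> witness_complex X (\<epsilon> n) (A n)"
proof
  fix \<sigma> assume s: "\<sigma> \<in> ball_complex n"
  then obtain x where x: "x \<in> X" "\<forall>a\<in>\<sigma>. dist x a < \<epsilon> n" and f: "finite \<sigma>" "\<sigma> \<noteq> {}" "\<sigma> \<subseteq> A n"
    by (auto simp: ball_complex_def)
  have "(\<Sum>a\<in>\<tau>. dist x a) < real (card \<tau>) * \<epsilon> n" if "\<tau> \<subseteq> \<sigma>" "\<tau> \<noteq> {}" for \<tau>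
  proof -
    have "(\<Sum>a\<in>\<tau>. dist x a) < (\<Sum>a\<in>\<tau>. \<epsilon> n)"
      using that x(2) finite_subset[OF that(1) f(1)] by (intro sum_strict_mono) auto
    then show ?thesis by simp
  qed
  then show "\<sigma> \<in> witness_complex X (\<epsilon> n) (A n)" using f x(1) by (auto simp: witness_complex_def)
qed

lemma witness_expansion:
  "HPol_expansion TYPE('v) TYPE(('m, 'b) inv_system) TYPE('a) (top_of_set X) (witness_sequence X \<epsilon> A \<pi>)"
  unfolding witness_sequence_def
proof (rule expansion_over_ball)
  interpret W: simplicial_sequence "\<lambda>n. witness_complex X (\<epsilon> n) (A n)" \<pi> by (rule witness_sequence)
  show "simplicial_complex (witness_complex X (\<epsilon> n) (A n))" for n by (rule W.complex)
  show "interleaving ball_polyhedron bnd (top_of_set X) partition_map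
      (\<lambda>n. realization (witness_complex X (\<epsilon> n) (A n))) bnd (\<lambda>_. id)"
    by (rule centre_interleaving[OF witness_sequence ball_complex_witness]) (use witness_pairs in blast)
qed

subsection \<open>The Cech sequence\<close>

abbreviation oball where "oball n \<equiv> ball_in X (\<epsilon> n)"

abbreviation ball_nerve where "ball_nerve n \<equiv> nerve (oball n ` A n)"

text \<open>A section of the map from centres to balls, which may fail to be injective.\<close>

definition centre where "centre n V = (SOME a. a \<in> A n \<and> oball n a = V)"

lemma centre:
  assumes "V \<in> oball n ` A n"
  shows "centre n V \<in> A n" "oball n (centre n V) = V"
proof -
  have "\<exists>a. a \<in> A n \<and> oball n a = V" using assms by blast
  from someI_ex[OF this] show "centre n V \<in> A n" "oball n (centre n V) = V"
    unfolding centre_def by auto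
qed

lemma nerveE:
  assumes "\<sigma> \<in> ball_nerve n"
  obtains x where "x \<in> X" "\<forall>V\<in>\<sigma>. V \<in> oball n ` A n \<and> x \<in> V" "\<sigma> \<noteq> {}"
proof -
  obtain x where x: "x \<in> \<Inter>\<sigma>" using assms by (auto simp: nerve_def)
  have s: "\<sigma> \<noteq> {}" "finite \<sigma>" "\<sigma> \<subseteq> oball n ` A n" using assms by (auto simp: nerve_def)
  then obtain a where "x \<in> oball n a" using x by blast
  then have "x \<in> X" by (simp add: ball_in_def)
  then show ?thesis by (rule that) (use s x in auto)
qed

lemma nerveI:
  assumes "\<sigma> \<noteq> {}" "\<And>V. V \<in> \<sigma> \<Longrightarrow> V \<in> oball n ` A n \<and> x \<in> V"
  shows "\<sigma> \<in> ball_nerve n"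
proof -
  have "\<sigma> \<subseteq> oball n ` A n" using assms(2) by blast
  moreover from this have "finite \<sigma>" using A_finite finite_subset by blast
  moreover have "x \<in> \<Inter>\<sigma>" using assms(2) by blast
  ultimately show ?thesis using assms(1) unfolding nerve_def by blast
qed

text \<open>Whatever centre represents \<open>V\<close>, the chosen ball contains \<open>V\<close>,
  as \<open>\<epsilon> (Suc n) + gap n < \<epsilon> n\<close>. Witnesses are therefore kept.\<close>

lemma ball_choice_mem:
  assumes "ball_choice X \<epsilon> A \<beta>" "V \<in> oball (Suc n) ` A (Suc n)" "x \<in> V"
  shows "\<beta> n V \<in> oball n ` A n \<and> x \<in> \<beta> n V"
proof -
  obtain a b where ab: "a \<in> A (Suc n)" "V = oball (Suc n) a" "b \<in> nearest (A n) a" "\<beta> n V = oball n b"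
    using assms(1,2) unfolding ball_choice_def by blast
  have aX: "a \<in> X" using ab(1) A_subset by blast
  have x: "x \<in> X" "dist x a < \<epsilon> (Suc n)" using assms(3) ab(2) by (simp_all add: ball_in_def)
  then have "dist x b < \<epsilon> n"
    using nearestD(2)[OF ab(3) aX] dist_triangle[of x b a] eps_step[of n] eps_pos[of "Suc n"] by linarith
  then show ?thesis using ab(4) nearestD(1)[OF ab(3) aX] x(1) by (auto simp: ball_in_def)
qed

lemma cech_simplicial_sequence:
  assumes "ball_choice X \<epsilon> A \<beta>"
  shows "simplicial_sequence ball_nerve \<beta>"
proof
  fix n
  show "simplicial_complex (ball_nerve n)"
    unfolding simplicial_complex_def
  proof (intro ballI conjI allI impI)
    fix \<sigma> assume s: "\<sigma> \<in> ball_nerve n"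
    then show "finite \<sigma>" "\<sigma> \<noteq> {}" by (auto simp: nerve_def)
    fix \<tau> assume t: "\<tau> \<subseteq> \<sigma>" "\<tau> \<noteq> {}"
    obtain x where "x \<in> X" "\<forall>V\<in>\<sigma>. V \<in> oball n ` A n \<and> x \<in> V" "\<sigma> \<noteq> {}" using s by (rule nerveE)
    then show "\<tau> \<in> ball_nerve n" using t by (intro nerveI[of _ n x]) auto
  qed
  show "finite (ball_nerve n)"
    by (rule finite_subset[of _ "Pow (oball n ` A n)"]) (auto simp: nerve_def A_finite)
  fix \<sigma> assume "\<sigma> \<in> ball_nerve (Suc n)"
  then obtain x where x: "x \<in> X" "\<forall>V\<in>\<sigma>. V \<in> oball (Suc n) ` A (Suc n) \<and> x \<in> V" "\<sigma> \<noteq> {}"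
    by (rule nerveE)
  show "\<beta> n ` \<sigma> \<in> ball_nerve n"
  proof (rule nerveI[of _ n x])
    fix W assume "W \<in> \<beta> n ` \<sigma>"
    then obtain V where V: "V \<in> \<sigma>" "W = \<beta> n V" by blast
    then show "W \<in> oball n ` A n \<and> x \<in> W" using ball_choice_mem[OF assms, of V n x] bspec[OF x(2) V(1)] V(2) by simp
  qed (use x(3) in blast)
qed

text \<open>Passing from centres to balls is a homotopy equivalence at every stage: a centre and the
  one selected for its ball have the same witnesses, and the round trip on the nerve of balls is the
  identity.\<close>

lemma cech_expansion:
  assumes beta: "ball_choice X \<epsilon> A \<beta>"
  shows "HPol_expansion TYPE('v) TYPE(('m, 'b) inv_system) TYPE('a set) (top_of_set X) (cech_sequence X \<epsilon> A \<beta>)"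
  unfolding cech_sequence_def
proof (rule expansion_over_ball)
  interpret N: simplicial_sequence ball_nerve \<beta> by (rule cech_simplicial_sequence[OF beta])
  show "simplicial_complex (ball_nerve n)" for n by (rule N.complex)
  let ?s = "\<lambda>n. realization_map (oball n)" and ?l = "\<lambda>n. realization_map (centre n)"
  have simplex: "\<exists>x\<in>X. \<sigma> \<noteq> {} \<and> \<sigma> \<subseteq> A n \<and> (\<forall>a\<in>\<sigma>. dist x a < \<epsilon> n)" if "\<sigma> \<in> ball_complex n" for \<sigma> n
    using that by (auto simp: ball_complex_def)
  have s: "oball n ` \<sigma> \<in> ball_nerve n" if "\<sigma> \<in> ball_complex n" for \<sigma> n
  proof -
    obtain x where "x \<in> X" "\<sigma> \<noteq> {}" "\<sigma> \<subseteq> A n" "\<forall>a\<in>\<sigma>. dist x a < \<epsilon> n" using simplex[OF \<open>\<sigma> \<in> ball_complex n\<close>] by blast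
    then show ?thesis by (intro nerveI[of _ n x]) (auto simp: ball_in_def)
  qed
  have l: "centre n ` \<sigma> \<in> ball_complex n" if sn: "\<sigma> \<in> ball_nerve n" for \<sigma> n
  proof -
    obtain x where x: "x \<in> X" "\<forall>V\<in>\<sigma>. V \<in> oball n ` A n \<and> x \<in> V" "\<sigma> \<noteq> {}" using sn by (rule nerveE)
    have "dist x (centre n V) < \<epsilon> n" if "V \<in> \<sigma>" for V
      using bspec[OF x(2) that] centre(2)[of V n] by (auto simp: ball_in_def)
    then show ?thesis using x centre(1) by (intro ball_complexI[of _ n x]) auto
  qed
  have s_cont: "continuous_map (ball_polyhedron n) (realization (ball_nerve n)) (?s n)" for n
    by (rule realization_map_cont[OF simplicial_ball_complex finite_ball_complex N.complex s])
  have l_cont: "continuous_map (realization (ball_nerve n)) (ball_polyhedron n) (?l n)" for n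
    by (rule realization_map_cont[OF N.complex N.finite_complex simplicial_ball_complex l])
  show "interleaving ball_polyhedron bnd (top_of_set X) partition_map
      (\<lambda>n. realization (ball_nerve n)) (\<lambda>n. realization_map (\<beta> n)) ?s"
  proof (intro interleaving.intro interleaving_axioms.intro ball.cone_axioms N.map_sequence_axioms s_cont)
    fix n
    show "homot (ball_polyhedron (Suc n)) (realization (ball_nerve n)) (?s n \<circ> bnd n) (realization_map (\<beta> n) \<circ> ?s (Suc n))"
    proof (rule homot_simplicial[OF simplicial_ball_complex finite_ball_complex N.complex
          continuous_map_compose[OF ball.bond_cont s_cont] continuous_map_compose[OF s_cont N.bond_cont],
          where F="\<lambda>\<sigma>. oball n ` \<pi> n ` \<sigma>" and G="\<lambda>\<sigma>. \<beta> n ` oball (Suc n) ` \<sigma>"])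
      fix \<sigma> t assume st: "\<sigma> \<in> ball_complex (Suc n)" "t \<in> closed_face \<sigma>"
      have "finite \<sigma>" by (rule simplicial_complexD(1)[OF simplicial_ball_complex st(1)])
      then show "(?s n \<circ> bnd n) t \<in> closed_face (oball n ` \<pi> n ` \<sigma>) \<and>
          (realization_map (\<beta> n) \<circ> ?s (Suc n)) t \<in> closed_face (\<beta> n ` oball (Suc n) ` \<sigma>)"
        using st(2) by (simp add: realization_map_in_face)
    next
      fix \<sigma> assume st: "\<sigma> \<in> ball_complex (Suc n)"
      then obtain x where x: "x \<in> X" "\<sigma> \<noteq> {}" "\<sigma> \<subseteq> near (Suc n) x" using simplex by (fastforce simp: near_def)
      \<comment> \<open>The witness of \<open>\<sigma>\<close> lies in the chosen ball on either
        route, although the routes may use different centres of the same ball.\<close>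
      show "oball n ` \<pi> n ` \<sigma> \<union> \<beta> n ` oball (Suc n) ` \<sigma> \<in> ball_nerve n"
      proof (rule nerveI[of _ n x])
        fix V assume "V \<in> oball n ` \<pi> n ` \<sigma> \<union> \<beta> n ` oball (Suc n) ` \<sigma>"
        then consider a where "a \<in> \<sigma>" "V = oball n (\<pi> n a)" | a where "a \<in> \<sigma>" "V = \<beta> n (oball (Suc n) a)" by blast
        then show "V \<in> oball n ` A n \<and> x \<in> V"
        proof cases
          case 1
          then have "\<pi> n a \<in> near n x" using choice_near[OF x(1)] x(3) by blast
          then show ?thesis using 1 x(1) by (auto simp: near_def ball_in_def)
        next
          case 2
          have "a \<in> near (Suc n) x" using 2 x(3) by blast
          then have aA: "oball (Suc n) a \<in> oball (Suc n) ` A (Suc n)" "x \<in> oball (Suc n) a"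
            using x(1) by (auto simp: near_def ball_in_def)
          show ?thesis using ball_choice_mem[OF beta aA] 2(2) by simp
        qed
      qed (use x(2) in blast)
    qed
    have ls: "homot (ball_polyhedron n) (ball_polyhedron n) (?l n \<circ> ?s n) id"
    proof (rule homot_simplicial[OF simplicial_ball_complex finite_ball_complex simplicial_ball_complex
          continuous_map_compose[OF s_cont l_cont], where F="\<lambda>\<sigma>. centre n ` oball n ` \<sigma>" and G="\<lambda>\<sigma>. \<sigma>"])
      fix \<sigma> t assume st: "\<sigma> \<in> ball_complex n" "t \<in> closed_face \<sigma>"
      have "finite \<sigma>" by (rule simplicial_complexD(1)[OF simplicial_ball_complex st(1)])
      then show "(?l n \<circ> ?s n) t \<in> closed_face (centre n ` oball n ` \<sigma>) \<and> id t \<in> closed_face \<sigma>"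
        using st(2) by (simp add: realization_map_in_face)
    next
      fix \<sigma> assume st: "\<sigma> \<in> ball_complex n"
      then obtain x where x: "x \<in> X" "\<sigma> \<noteq> {}" "\<sigma> \<subseteq> A n" "\<forall>a\<in>\<sigma>. dist x a < \<epsilon> n" using simplex by blast
      have c: "centre n (oball n a) \<in> A n \<and> dist x (centre n (oball n a)) < \<epsilon> n" if "a \<in> \<sigma>" for a
      proof -
        have "oball n a \<in> oball n ` A n" "x \<in> oball n a" using that x by (auto simp: ball_in_def)
        then show ?thesis using centre[of "oball n a" n] by (auto simp: ball_in_def)
      qed
      show "centre n ` oball n ` \<sigma> \<union> \<sigma> \<in> ball_complex n"
        by (rule ball_complexI[of _ n x]) (use x c in auto)
    qed simp
    have sl: "homot (realization (ball_nerve n)) (realization (ball_nerve n)) (?s n \<circ> ?l n) id"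
    proof (rule homot_simplicial[OF N.complex N.finite_complex N.complex
          continuous_map_compose[OF l_cont s_cont], where F="\<lambda>\<sigma>. \<sigma>" and G="\<lambda>\<sigma>. \<sigma>"])
      fix \<sigma> t assume st: "\<sigma> \<in> ball_nerve n" "t \<in> closed_face \<sigma>"
      have fin: "finite \<sigma>" by (rule simplicial_complexD(1)[OF N.complex st(1)])
      have "\<sigma> \<subseteq> oball n ` A n" using st(1) by (simp add: nerve_def)
      then have "oball n (centre n V) = V" if "V \<in> \<sigma>" for V using centre(2) that by blast
      then have "oball n ` centre n ` \<sigma> = \<sigma>" by (simp add: image_image)
      then have "?s n (?l n t) \<in> closed_face \<sigma>"
        using realization_map_in_face[OF realization_map_in_face[OF st(2) fin, of "centre n"], of "oball n"] fin by simp
      then show "(?s n \<circ> ?l n) t \<in> closed_face \<sigma> \<and> id t \<in> closed_face \<sigma>" using st(2) by simp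
    qed auto
    show "\<exists>k l. continuous_map (realization (ball_nerve (n + k))) (ball_polyhedron n) l \<and>
      homot (ball_polyhedron (n + k)) (ball_polyhedron n) (l \<circ> ?s (n + k)) (comp_bond bnd n k) \<and>
      homot (realization (ball_nerve (n + k))) (realization (ball_nerve n)) (?s n \<circ> l) (comp_bond (\<lambda>n. realization_map (\<beta> n)) n k)"
      using l_cont[of n] ls sl by (intro exI[of _ 0] exI[of _ "?l n"]) simp
  qed
qed

subsection \<open>The Alexandroff-McCord and Dowker sequences\<close>

text \<open>Both routes around the square are carried by the nearest-point set of the largest member
  of the chain.\<close>

lemma nset_face:
  assumes "\<sigma> \<in> order_complex (cells (Suc n))" "y \<in> closed_face \<sigma>"
  shows "unsubdiv n (realization_map (nset n) y) \<in> closed_face (nset n (\<Union>\<sigma>))"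
    and "bnd n (unsubdiv (Suc n) y) \<in> closed_face (nset n (\<Union>\<sigma>))"
proof -
  interpret O: simplicial_sequence "\<lambda>n. order_complex (cells n)" nset by (rule order_sequence)
  have fin: "finite \<sigma>" by (rule simplicial_complexD(1)[OF simplicial_order_complex assms(1)])
  note U = Union_order_simplex[OF assms(1)]
  have finN: "finite (nset n (\<Union>\<sigma>))" by (rule finite_cell[OF nearest_set_cell[OF U]])
  have "unsubdiv n (realization_map (nset n) y) \<in> closed_face (\<Union>(nset n ` \<sigma>))"
    by (rule unsubdiv_in_face[OF O.simplicial[OF assms(1)] realization_map_in_face[OF assms(2) fin]])
  then show "unsubdiv n (realization_map (nset n) y) \<in> closed_face (nset n (\<Union>\<sigma>))"
    by (rule closed_face_mono[OF _ _ finN]) (auto simp: nearest_set_def)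
  show "bnd n (unsubdiv (Suc n) y) \<in> closed_face (nset n (\<Union>\<sigma>))"
    by (rule closed_face_mono[OF realization_map_in_face[OF unsubdiv_in_face[OF assms] finite_cell[OF U]] choice_nset finN])
      (use U in \<open>simp add: cells_iff\<close>)
qed

text \<open>Naturality up to homotopy is read off from carriers for the affine maps
  \<open>unsubdiv\<close>; conjugating with the homotopy equivalences moves it to
  \<open>subdiv\<close>.\<close>

lemma subdiv_bond:
  "homot (realization (cells (Suc n))) (realization (order_complex (cells n)))
    (subdiv (A n) \<circ> bnd n) (realization_map (nset n) \<circ> subdiv (A (Suc n)))"
proof -
  interpret O: simplicial_sequence "\<lambda>n. order_complex (cells n)" nset by (rule order_sequence)
  let ?H = "homot (realization (cells (Suc n))) (realization (order_complex (cells n)))"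
  let ?s = "\<lambda>n. subdiv (A n)" and ?N = "realization_map (nset n)"
  have mid: "homot (realization (order_complex (cells (Suc n)))) (realization (cells n))
      (bnd n \<circ> unsubdiv (Suc n)) (unsubdiv n \<circ> ?N)"
  proof (rule homot_simplicial[OF simplicial_order_complex finite_order_complex[OF finite_cells] simplicial_cells
        continuous_map_compose[OF unsubdiv_cont rips.P'.bond_cont] continuous_map_compose[OF O.bond_cont unsubdiv_cont],
        where F="\<lambda>\<sigma>. nset n (\<Union>\<sigma>)" and G="\<lambda>\<sigma>. nset n (\<Union>\<sigma>)"])
    fix \<sigma> y assume "\<sigma> \<in> order_complex (cells (Suc n))" "y \<in> closed_face \<sigma>"
    then show "(bnd n \<circ> unsubdiv (Suc n)) y \<in> closed_face (nset n (\<Union>\<sigma>)) \<and>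
        (unsubdiv n \<circ> ?N) y \<in> closed_face (nset n (\<Union>\<sigma>))" using nset_face by simp
  next
    fix \<sigma> assume "\<sigma> \<in> order_complex (cells (Suc n))"
    then show "nset n (\<Union>\<sigma>) \<union> nset n (\<Union>\<sigma>) \<in> cells n" using nearest_set_cell[OF Union_order_simplex] by simp
  qed
  have sb: "continuous_map (realization (cells (Suc n))) (realization (order_complex (cells n))) (?s n \<circ> bnd n)"
    by (rule continuous_map_compose[OF rips.P'.bond_cont subdiv_cells_cont])
  have Ns: "continuous_map (realization (cells (Suc n))) (realization (order_complex (cells n))) (?N \<circ> ?s (Suc n))"
    by (rule continuous_map_compose[OF subdiv_cells_cont O.bond_cont])
  have "?H (?s n \<circ> bnd n) ((?s n \<circ> bnd n) \<circ> (unsubdiv (Suc n) \<circ> ?s (Suc n)))"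
    using homotopic_with_symD[OF homot_comp_left[OF unsubdiv_subdiv[of "Suc n"] sb]] by simp
  also have "?H \<dots> (?s n \<circ> ((unsubdiv n \<circ> ?N) \<circ> ?s (Suc n)))"
    using homot_comp_left[OF homot_comp_right[OF mid subdiv_cells_cont] subdiv_cells_cont]
    by (simp only: comp_assoc)
  also have "?H \<dots> (?N \<circ> ?s (Suc n))"
    using homot_comp_right[OF subdiv_unsubdiv[of n] Ns] by (simp only: comp_assoc id_comp)
  finally show ?thesis .
qed

lemma alexandroff_mccord_expansion:
  "HPol_expansion TYPE('v) TYPE(('m, 'b) inv_system) TYPE('a set) (top_of_set X) (alexandroff_mccord_sequence \<epsilon> A)"
  unfolding alexandroff_mccord_sequence_def
proof (rule expansion_over_rips[OF simplicial_order_complex])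
  interpret O: simplicial_sequence "\<lambda>n. order_complex (cells n)" nset by (rule order_sequence)
  show "interleaving (\<lambda>n. realization (cells n)) bnd (top_of_set X) (\<lambda>n. id \<circ> partition_map n)
      (\<lambda>n. realization (order_complex (cells n))) (\<lambda>n. realization_map (nset n)) (\<lambda>n. subdiv (A n))"
  proof (intro interleaving.intro interleaving_axioms.intro rips.target.cone_axioms O.map_sequence_axioms
      subdiv_cells_cont subdiv_bond)
    fix n
    show "\<exists>k l. continuous_map (realization (order_complex (cells (n + k)))) (realization (cells n)) l \<and>
      homot (realization (cells (n + k))) (realization (cells n)) (l \<circ> subdiv (A (n + k))) (comp_bond bnd n k) \<and>
      homot (realization (order_complex (cells (n + k)))) (realization (order_complex (cells n)))
        (subdiv (A n) \<circ> l) (comp_bond (\<lambda>n. realization_map (nset n)) n k)"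
      using unsubdiv_cont[of n] unsubdiv_subdiv[of n] subdiv_unsubdiv[of n]
      by (intro exI[of _ 0] exI[of _ "unsubdiv n"]) simp
  qed
qed

text \<open>Singletons embed the Rips complex, and picking a point from each cell leads back. For a
  simplex with bound \<open>D\<close> all cells \<open>E\<close> and \<open>{pick E}\<close> lie
  below \<open>D\<close>, so the round trip is contiguous to the identity at the same stage.\<close>

lemma upper_dowker_expansion:
  "HPol_expansion TYPE('v) TYPE(('m, 'b) inv_system) TYPE('a set) (top_of_set X) (upper_dowker_sequence \<epsilon> A)"
  unfolding upper_dowker_sequence_def
proof (rule expansion_over_rips)
  interpret U: simplicial_sequence "\<lambda>n. upper_dowker (cells n)" nset by (rule upper_sequence)
  show "simplicial_complex (upper_dowker (cells n))" for n by (rule U.complex)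
  let ?K = "\<lambda>n. upper_dowker (cells n)"
  let ?s = "realization_map (\<lambda>a. {a})" and ?l = "realization_map pick"
  \<comment> \<open>Non-empty subsets of a cell are cells, so a common upper bound is all there is
    to check.\<close>
  have bounded: "\<sigma> \<in> ?K n" if "\<sigma> \<noteq> {}" "D \<in> cells n" "\<And>C. C \<in> \<sigma> \<Longrightarrow> C \<noteq> {} \<and> C \<subseteq> D" for \<sigma> D n
  proof -
    have "\<sigma> \<subseteq> cells n" using cells_subset[OF that(2)] that(3) by blast
    then show ?thesis using that by (intro upper_dowkerI[OF finite_subset[OF _ finite_cells[of n]] _ _ that(2)]) auto
  qed
  have boundE: "\<exists>D\<in>cells n. \<sigma> \<noteq> {} \<and> (\<forall>C\<in>\<sigma>. C \<in> cells n \<and> C \<subseteq> D)" if s: "\<sigma> \<in> ?K n" for \<sigma> n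
  proof -
    obtain D where "\<sigma> \<subseteq> cells n" "\<sigma> \<noteq> {}" "D \<in> cells n" "\<forall>C\<in>\<sigma>. C \<subseteq> D"
      using s by (auto simp: upper_dowker_def)
    then show ?thesis by (intro bexI[of _ D]) auto
  qed
  have s: "(\<lambda>a. {a}) ` \<sigma> \<in> ?K n" if "\<sigma> \<in> cells n" for \<sigma> n
    using that by (intro bounded[of _ \<sigma>]) (auto simp: cells_iff)
  have l: "pick ` \<sigma> \<in> cells n" if \<sigma>: "\<sigma> \<in> ?K n" for \<sigma> n
  proof -
    obtain D where D: "D \<in> cells n" "\<sigma> \<noteq> {}" "\<forall>C\<in>\<sigma>. C \<in> cells n \<and> C \<subseteq> D" by (rule bexE[OF boundE[OF \<sigma>]]) (elim conjE)
    then have "pick ` \<sigma> \<subseteq> D" using pick_in by blast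
    then show ?thesis using cells_subset[OF D(1)] D(2) by blast
  qed
  have s_cont: "continuous_map (realization (cells n)) (realization (?K n)) ?s" for n
    by (rule realization_map_cont[OF simplicial_cells finite_cells U.complex s])
  have l_cont: "continuous_map (realization (?K n)) (realization (cells n)) ?l" for n
    by (rule realization_map_cont[OF U.complex U.finite_complex simplicial_cells l])
  show "interleaving (\<lambda>n. realization (cells n)) bnd (top_of_set X) (\<lambda>n. id \<circ> partition_map n)
      (\<lambda>n. realization (?K n)) (\<lambda>n. realization_map (nset n)) (\<lambda>n. ?s)"
  proof (intro interleaving.intro interleaving_axioms.intro rips.target.cone_axioms U.map_sequence_axioms s_cont)
    fix n
    show "homot (realization (cells (Suc n))) (realization (?K n)) (?s \<circ> bnd n) (realization_map (nset n) \<circ> ?s)"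
    proof (rule homot_simplicial[OF simplicial_cells finite_cells U.complex
          continuous_map_compose[OF rips.P'.bond_cont s_cont] continuous_map_compose[OF s_cont U.bond_cont],
          where F="\<lambda>\<sigma>. (\<lambda>a. {a}) ` \<pi> n ` \<sigma>" and G="\<lambda>\<sigma>. nset n ` (\<lambda>a. {a}) ` \<sigma>"])
      fix \<sigma> t assume st: "\<sigma> \<in> cells (Suc n)" "t \<in> closed_face \<sigma>"
      then show "(?s \<circ> bnd n) t \<in> closed_face ((\<lambda>a. {a}) ` \<pi> n ` \<sigma>) \<and>
          (realization_map (nset n) \<circ> ?s) t \<in> closed_face (nset n ` (\<lambda>a. {a}) ` \<sigma>)"
        using finite_cell[OF st(1)] by (simp add: realization_map_in_face)
    next
      fix \<sigma> assume s: "\<sigma> \<in> cells (Suc n)"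
      then have sA: "\<sigma> \<subseteq> A (Suc n)" "\<sigma> \<noteq> {}" by (auto simp: cells_iff)
      show "(\<lambda>a. {a}) ` \<pi> n ` \<sigma> \<union> nset n ` (\<lambda>a. {a}) ` \<sigma> \<in> ?K n"
      proof (rule bounded[OF _ nearest_set_cell[OF s]])
        fix C assume "C \<in> (\<lambda>a. {a}) ` \<pi> n ` \<sigma> \<union> nset n ` (\<lambda>a. {a}) ` \<sigma>"
        then consider a where "a \<in> \<sigma>" "C = {\<pi> n a}" | a where "a \<in> \<sigma>" "C = nset n {a}" by blast
        then show "C \<noteq> {} \<and> C \<subseteq> nset n \<sigma>"
        proof cases
          case 1 then show ?thesis using choice_nset[OF sA(1)] by blast
        next
          case 2
          then show ?thesis using nearest_nonempty[of n a] nearest_set_mono[of "{a}" \<sigma>] by (simp add: nearest_set_def)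
        qed
      qed (use sA in blast)
    qed
    have ls: "homot (realization (cells n)) (realization (cells n)) (?l \<circ> ?s) id"
    proof (rule homot_simplicial[OF simplicial_cells finite_cells simplicial_cells
          continuous_map_compose[OF s_cont l_cont], where F="\<lambda>\<sigma>. \<sigma>" and G="\<lambda>\<sigma>. \<sigma>"])
      fix \<sigma> t assume st: "\<sigma> \<in> cells n" "t \<in> closed_face \<sigma>"
      have "pick ` (\<lambda>a. {a}) ` \<sigma> = \<sigma>" by (simp add: image_image pick_def)
      then have "?l (?s t) \<in> closed_face \<sigma>"
        using realization_map_in_face[OF realization_map_in_face[OF st(2) finite_cell[OF st(1)], of "\<lambda>a. {a}"], of pick]
          finite_cell[OF st(1)] by simp
      then show "(?l \<circ> ?s) t \<in> closed_face \<sigma> \<and> id t \<in> closed_face \<sigma>" using st(2) by simp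
    qed auto
    have sl: "homot (realization (?K n)) (realization (?K n)) (?s \<circ> ?l) id"
    proof (rule homot_simplicial[OF U.complex U.finite_complex U.complex
          continuous_map_compose[OF l_cont s_cont], where F="\<lambda>\<sigma>. (\<lambda>a. {a}) ` pick ` \<sigma>" and G="\<lambda>\<sigma>. \<sigma>"])
      fix \<sigma> t assume st: "\<sigma> \<in> ?K n" "t \<in> closed_face \<sigma>"
      have "finite \<sigma>" by (rule simplicial_complexD(1)[OF U.complex st(1)])
      then show "(?s \<circ> ?l) t \<in> closed_face ((\<lambda>a. {a}) ` pick ` \<sigma>) \<and> id t \<in> closed_face \<sigma>"
        using st(2) by (simp add: realization_map_in_face)
    next
      fix \<sigma> assume \<sigma>: "\<sigma> \<in> ?K n"
      obtain D where D: "D \<in> cells n" "\<sigma> \<noteq> {}" "\<forall>C\<in>\<sigma>. C \<in> cells n \<and> C \<subseteq> D"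
        by (rule bexE[OF boundE[OF \<sigma>]]) (elim conjE)
      show "(\<lambda>a. {a}) ` pick ` \<sigma> \<union> \<sigma> \<in> ?K n"
      proof (rule bounded[OF _ D(1)])
        fix C assume "C \<in> (\<lambda>a. {a}) ` pick ` \<sigma> \<union> \<sigma>"
        then consider E where "E \<in> \<sigma>" "C = {pick E}" | "C \<in> \<sigma>" by blast
        then show "C \<noteq> {} \<and> C \<subseteq> D"
        proof cases
          case 1 then show ?thesis using pick_in[of E n] D(3) by blast
        next
          case 2 then show ?thesis using D(3) by (auto simp: cells_iff)
        qed
      qed (use D(2) in blast)
    qed simp
    show "\<exists>k l. continuous_map (realization (?K (n + k))) (realization (cells n)) l \<and>
      homot (realization (cells (n + k))) (realization (cells n)) (l \<circ> ?s) (comp_bond bnd n k) \<and>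
      homot (realization (?K (n + k))) (realization (?K n)) (?s \<circ> l) (comp_bond (\<lambda>n. realization_map (nset n)) n k)"
      using l_cont[of n] ls sl by (intro exI[of _ 0] exI[of _ ?l]) simp
  qed
qed

text \<open>Simplices of the lower Dowker complex have diameter up to \<open>4\<epsilon>\<^sub>n\<close>, so the map back to the
  Rips complex exists only after passing two stages down. The homotopy on the Dowker side goes through
  the map \<open>D \<mapsto> near n (pick D)\<close>.\<close>

lemma lower_dowker_expansion:
  "HPol_expansion TYPE('v) TYPE(('m, 'b) inv_system) TYPE('a set) (top_of_set X) (lower_dowker_sequence \<epsilon> A)"
  unfolding lower_dowker_sequence_def
proof (rule expansion_over_rips)
  interpret O: simplicial_sequence "\<lambda>n. order_complex (cells n)" nset by (rule order_sequence)
  interpret L: simplicial_sequence "\<lambda>n. lower_dowker (cells n)" nset by (rule lower_sequence)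
  interpret C: simplicial_sequence cells \<pi> by (rule cells_sequence)
  show "simplicial_complex (lower_dowker (cells n))" for n by (rule L.complex)
  let ?K = "\<lambda>n. lower_dowker (cells n)"
  let ?s = "\<lambda>n. subdiv (A n)"
  have common: "\<sigma> \<in> ?K n" if "\<sigma> \<noteq> {}" "E \<in> cells n" "\<And>C. C \<in> \<sigma> \<Longrightarrow> C \<in> cells n \<and> E \<subseteq> C" for \<sigma> E n
  proof -
    have "\<sigma> \<subseteq> cells n" using that(3) by blast
    then show ?thesis using that by (intro lower_dowkerI[OF finite_subset[OF _ finite_cells[of n]] _ _ that(2)]) auto
  qed
  \<comment> \<open>A chain is bounded below by its smallest member, so the subdivided Rips complex
    is a subcomplex.\<close>
  have order_lower: "order_complex (cells n) \<subseteq> ?K n" for n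
  proof
    fix \<sigma> assume s: "\<sigma> \<in> order_complex (cells n)"
    have "\<Inter>\<sigma> \<in> \<sigma>"
      using s by (intro Inter_in_chain[of \<sigma> UNIV]) (auto simp: order_complex_def subset.chain_def)
    then show "\<sigma> \<in> ?K n" using s by (intro common[of _ "\<Inter>\<sigma>"]) (auto simp: order_complex_def)
  qed
  have incl: "continuous_map (realization (order_complex (cells n))) (realization (?K n)) id" for n
    by (rule subcomplex_cont[OF L.complex finite_order_complex[OF finite_cells] order_lower])
  have s_cont: "continuous_map (realization (cells n)) (realization (?K n)) (?s n)" for n
    using continuous_map_compose[OF subdiv_cells_cont incl] by simp
  \<comment> \<open>The common lower bound enters the estimates below through a single common point
    \<open>a\<close>.\<close>
  have simplex: "\<exists>a. \<sigma> \<noteq> {} \<and> (\<forall>D\<in>\<sigma>. D \<in> cells n \<and> a \<in> D)" if s: "\<sigma> \<in> ?K n" for \<sigma> n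
  proof -
    obtain E where E: "\<sigma> \<subseteq> cells n" "\<sigma> \<noteq> {}" "E \<in> cells n" "\<forall>D\<in>\<sigma>. E \<subseteq> D"
      using s by (auto simp: lower_dowker_def)
    then obtain a where "a \<in> E" by (auto simp: cells_iff)
    then show ?thesis using E by (intro exI[of _ a]) auto
  qed
  show "interleaving (\<lambda>n. realization (cells n)) bnd (top_of_set X) (\<lambda>n. id \<circ> partition_map n)
      (\<lambda>n. realization (?K n)) (\<lambda>n. realization_map (nset n)) ?s"
  proof (intro interleaving.intro interleaving_axioms.intro rips.target.cone_axioms L.map_sequence_axioms s_cont)
    fix n
    show "homot (realization (cells (Suc n))) (realization (?K n)) (?s n \<circ> bnd n) (realization_map (nset n) \<circ> ?s (Suc n))"
      using homot_comp_left[OF subdiv_bond incl] by simp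
    let ?m = "n + 2"
    let ?G = "comp_bond \<pi> n 2"
    let ?l = "realization_map (?G \<circ> pick)"
    let ?M = "\<lambda>D. near n (pick D)"
    have G_dist: "?G a \<in> A n \<and> dist a (?G a) \<le> drift n 2" if "a \<in> A ?m" for a
      using comp_choice_dist[OF that] by blast
    have pickA: "pick D \<in> A ?m" "pick D \<in> X" if "D \<in> cells ?m" for D
      using pick_in[OF that] that A_subset[of ?m] by (auto simp: cells_iff)
    have Gpick_near: "?G (pick D) \<in> near n a" if "D \<in> cells ?m" "a \<in> D" for D a
    proof -
      have "dist a (pick D) < 2 * \<epsilon> ?m" using that pick_in[OF that(1)] by (simp add: cells_iff)
      then show ?thesis
        using G_dist[OF pickA(1)[OF that(1)]] dist_triangle[of a "?G (pick D)" "pick D"] drift_bound_2[of n] eps_pos[of ?m]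
        by (simp add: near_def)
    qed
    \<comment> \<open>Since the cells share \<open>a\<close>, \<open>pick D\<close> and
      \<open>pick D'\<close> are less than \<open>4 * \<epsilon> ?m\<close> apart; the two bonding
      steps add \<open>drift n 2\<close>, and \<open>drift_bound_2\<close> keeps the total below
      \<open>\<epsilon> n\<close>.\<close>
    have M: "?G (pick D') \<in> ?M D \<and> (\<forall>b\<in>comp_bond nset n 2 D. b \<in> ?M D)"
      if D: "D \<in> cells ?m" "D' \<in> cells ?m" "a \<in> D" "a \<in> D'" for D D' a
    proof
      have d: "dist (pick D) a < 2 * \<epsilon> ?m" "dist a (pick D') < 2 * \<epsilon> ?m"
        using D pick_in[OF D(1)] pick_in[OF D(2)] by (auto simp: cells_iff)
      have "dist (pick D) (?G (pick D')) \<le> dist (pick D) a + dist a (pick D') + dist (pick D') (?G (pick D'))"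
        using dist_triangle[of "pick D" "?G (pick D')" a] dist_triangle[of a "?G (pick D')" "pick D'"] by linarith
      then show "?G (pick D') \<in> ?M D"
        using d G_dist[OF pickA(1)[OF D(2)]] drift_bound_2[of n] by (simp add: near_def)
      show "\<forall>b\<in>comp_bond nset n 2 D. b \<in> ?M D"
      proof
        fix b assume b: "b \<in> comp_bond nset n 2 D"
        obtain e where e: "e \<in> D" "dist e b \<le> drift n 2" using comp_nset_dist[OF D(1) b] by blast
        have "dist (pick D) e < 2 * \<epsilon> ?m" using e(1) D(1) pick_in[OF D(1)] by (auto simp: cells_iff)
        moreover have "b \<in> A n" using comp_nset_cell[OF D(1)] b by (auto simp: cells_iff)
        ultimately show "b \<in> ?M D"
          using e(2) dist_triangle[of "pick D" b e] drift_bound_2[of n] eps_pos[of ?m] by (simp add: near_def)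
      qed
    qed
    have M_cell: "?M D \<in> cells n" if "D \<in> cells ?m" for D by (rule near_cell[OF pickA(2)[OF that]])
    have l: "(?G \<circ> pick) ` \<sigma> \<in> cells n" if s: "\<sigma> \<in> ?K ?m" for \<sigma>
    proof -
      obtain a where a: "\<sigma> \<noteq> {}" "\<forall>D\<in>\<sigma>. D \<in> cells ?m \<and> a \<in> D"
        by (rule exE[OF simplex[OF s]]) (elim conjE)
      then have "a \<in> X" using A_subset[of ?m] by (fastforce simp: cells_iff)
      moreover have "(?G \<circ> pick) ` \<sigma> \<subseteq> near n a" using a(2) Gpick_near by auto
      ultimately show ?thesis using cells_subset[OF near_cell] a(1) by blast
    qed
    have l_cont: "continuous_map (realization (?K ?m)) (realization (cells n)) ?l"
      by (rule realization_map_cont[OF L.complex L.finite_complex simplicial_cells l])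
    have l_face: "?l y \<in> closed_face ((?G \<circ> pick) ` \<sigma>)" if "\<sigma> \<in> ?K ?m" "y \<in> closed_face \<sigma>" for \<sigma> y
      by (rule realization_map_in_face[OF that(2) simplicial_complexD(1)[OF L.complex that(1)]])
    have M_simplicial: "?M ` \<sigma> \<union> comp_bond nset n 2 ` \<sigma> \<in> ?K n" if s: "\<sigma> \<in> ?K ?m" for \<sigma>
    proof -
      obtain a where a: "\<sigma> \<noteq> {}" "\<forall>D\<in>\<sigma>. D \<in> cells ?m \<and> a \<in> D"
        by (rule exE[OF simplex[OF s]]) (elim conjE)
      then have aA: "a \<in> A ?m" by (fastforce simp: cells_iff)
      \<comment> \<open>The image of the common point \<open>a\<close> under the choice maps lies in
        all cells involved, so its singleton is a common lower bound.\<close>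
      show ?thesis
      proof (rule common[of _ "{?G a}"])
        show "{?G a} \<in> cells n" using G_dist[OF aA] singleton_cell by blast
        fix C assume "C \<in> ?M ` \<sigma> \<union> comp_bond nset n 2 ` \<sigma>"
        then consider D where "D \<in> \<sigma>" "C = ?M D" | D where "D \<in> \<sigma>" "C = comp_bond nset n 2 D" by blast
        then show "C \<in> cells n \<and> {?G a} \<subseteq> C"
        proof cases
          case 1
          then show ?thesis using a(2) M_cell M[of D D a] comp_choice_nset[of D n 2 a] by blast
        next
          case 2
          then show ?thesis using a(2) comp_nset_cell[of D n 2] comp_choice_nset[of D n 2 a] by blast
        qed
      qed (use a(1) in blast)
    qed
    have M_cont: "continuous_map (realization (?K ?m)) (realization (?K n)) (realization_map ?M)"
    proof (rule realization_map_cont[OF L.complex L.finite_complex L.complex])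
      fix \<sigma> assume s: "\<sigma> \<in> ?K ?m"
      show "?M ` \<sigma> \<in> ?K n"
        using simplicial_complexD(3)[OF L.complex M_simplicial[OF s], of "?M ` \<sigma>"]
          simplicial_complexD(2)[OF L.complex s] by blast
    qed
    \<comment> \<open>Subdividing a point of \<open>\<sigma>\<close> yields subsets of
      \<open>\<sigma>\<close>, so the picked points stay in \<open>\<sigma>\<close> and both maps
      are carried by its image under \<open>?G\<close>.\<close>
    have ls: "homot (realization (cells ?m)) (realization (cells n)) (?l \<circ> ?s ?m) (comp_bond bnd n 2)"
    proof (rule homot_simplicial[OF simplicial_cells finite_cells simplicial_cells
          continuous_map_compose[OF s_cont l_cont] rips.P'.comp_bond_cont,
          where F="\<lambda>\<sigma>. ?G ` \<sigma>" and G="\<lambda>\<sigma>. ?G ` \<sigma>"])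
      fix \<sigma> t assume st: "\<sigma> \<in> cells ?m" "t \<in> closed_face \<sigma>"
      let ?S = "supp (?s ?m t)"
      note sub = subdiv_supp_cells[OF st]
      have SK: "?S \<in> ?K ?m" using sub(1) order_lower by blast
      have "(?G \<circ> pick) ` ?S \<subseteq> ?G ` \<sigma>"
      proof
        fix c assume "c \<in> (?G \<circ> pick) ` ?S"
        then obtain D where D: "D \<in> ?S" "c = ?G (pick D)" by auto
        then have "D \<in> cells ?m" using sub(1) by (auto simp: order_complex_def)
        then have "pick D \<in> \<sigma>" using pick_in D(1) sub(2) by blast
        then show "c \<in> ?G ` \<sigma>" using D(2) by blast
      qed
      then have "?l (?s ?m t) \<in> closed_face (?G ` \<sigma>)"
        by (rule closed_face_mono[OF l_face[OF SK sub(3)]]) (use finite_cell[OF st(1)] in blast)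
      moreover have "comp_bond bnd n 2 t \<in> closed_face (?G ` \<sigma>)" by (rule C.comp_in_face[OF st(2,1)])
      ultimately show "(?l \<circ> ?s ?m) t \<in> closed_face (?G ` \<sigma>) \<and> comp_bond bnd n 2 t \<in> closed_face (?G ` \<sigma>)" by simp
    next
      fix \<sigma> assume "\<sigma> \<in> cells ?m"
      then show "?G ` \<sigma> \<union> ?G ` \<sigma> \<in> cells n" using C.comp_simplicial[of \<sigma> n 2] by simp
    qed
    have "homot (realization (?K ?m)) (realization (?K n)) (?s n \<circ> ?l) (realization_map ?M)"
    proof (rule homot_faces[OF L.complex L.finite_complex L.complex continuous_map_compose[OF l_cont s_cont] M_cont])
      fix \<sigma> y assume sy: "\<sigma> \<in> ?K ?m" "y \<in> closed_face \<sigma>"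
      obtain a where a: "\<sigma> \<noteq> {}" "\<forall>D\<in>\<sigma>. D \<in> cells ?m \<and> a \<in> D"
        by (rule exE[OF simplex[OF sy(1)]]) (elim conjE)
      let ?S = "supp (?s n (?l y))"
      note sub = subdiv_supp_cells[OF l[OF sy(1)] l_face[OF sy]]
      have fin: "finite \<sigma>" by (rule simplicial_complexD(1)[OF L.complex sy(1)])
      have chain: "\<Inter>?S \<in> ?S"
        using sub(1) by (intro Inter_in_chain[of ?S UNIV]) (auto simp: order_complex_def subset.chain_def)
      have Scells: "?S \<subseteq> cells n" using sub(1) by (auto simp: order_complex_def)
      \<comment> \<open>The smallest cell in the subdivided image consists of points
        \<open>?G (pick D')\<close> with \<open>D'\<close> in \<open>\<sigma>\<close>, and every
        \<open>?M D\<close> contains all of those; so it bounds both vertex sets from below.\<close>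
      have "\<Inter>?S \<subseteq> ?M D" if D: "D \<in> \<sigma>" for D
      proof -
        have "(?G \<circ> pick) ` \<sigma> \<subseteq> ?M D"
        proof
          fix c assume "c \<in> (?G \<circ> pick) ` \<sigma>"
          then obtain D' where D': "D' \<in> \<sigma>" "c = ?G (pick D')" by auto
          show "c \<in> ?M D"
            using conjunct1[OF M[of D D' a]] a(2) D D' by simp
        qed
        then show ?thesis using chain sub(2) by blast
      qed
      then have K: "?S \<union> ?M ` \<sigma> \<in> ?K n"
        using chain Scells a M_cell by (intro common[of _ "\<Inter>?S"]) auto
      have finK: "finite (?S \<union> ?M ` \<sigma>)" by (rule simplicial_complexD(1)[OF L.complex K])
      have "?s n (?l y) \<in> closed_face (?S \<union> ?M ` \<sigma>)" by (rule closed_face_mono[OF sub(3) _ finK]) blast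
      moreover have "realization_map ?M y \<in> closed_face (?S \<union> ?M ` \<sigma>)"
        by (rule closed_face_mono[OF realization_map_in_face[OF sy(2) fin] _ finK]) blast
      ultimately show "\<exists>\<tau>\<in>?K n. (?s n \<circ> ?l) y \<in> closed_face \<tau> \<and> realization_map ?M y \<in> closed_face \<tau>"
        using K by auto
    qed
    also have "homot (realization (?K ?m)) (realization (?K n)) (realization_map ?M) (comp_bond (\<lambda>n. realization_map (nset n)) n 2)"
    proof (rule homot_simplicial[OF L.complex L.finite_complex L.complex M_cont L.comp_bond_cont _ M_simplicial])
      fix \<sigma> y assume sy: "\<sigma> \<in> ?K ?m" "y \<in> closed_face \<sigma>"
      show "realization_map ?M y \<in> closed_face (?M ` \<sigma>) \<and>
          comp_bond (\<lambda>n. realization_map (nset n)) n 2 y \<in> closed_face (comp_bond nset n 2 ` \<sigma>)"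
        using realization_map_in_face[OF sy(2) simplicial_complexD(1)[OF L.complex sy(1)]] L.comp_in_face[OF sy(2,1)] by blast
    qed
    finally have sl: "homot (realization (?K ?m)) (realization (?K n)) (?s n \<circ> ?l) (comp_bond (\<lambda>n. realization_map (nset n)) n 2)" .
    show "\<exists>k l. continuous_map (realization (?K (n + k))) (realization (cells n)) l \<and>
      homot (realization (cells (n + k))) (realization (cells n)) (l \<circ> ?s (n + k)) (comp_bond bnd n k) \<and>
      homot (realization (?K (n + k))) (realization (?K n)) (?s n \<circ> l) (comp_bond (\<lambda>n. realization_map (nset n)) n k)"
      using l_cont ls sl by blast
  qed
qed

end

theorem theorem4:
  fixes X :: "'a::metric_space set"
    and \<epsilon> :: "nat \<Rightarrow> real"
    and A :: "nat \<Rightarrow> 'a set"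
  assumes "compact X" and "X \<noteq> {}"
    and "adjusted_approximative_sequence X \<epsilon> A"
  shows
    "HPol_expansion TYPE('v) TYPE(('m, 'b) inv_system) TYPE('a set) (top_of_set X)
       (alexandroff_mccord_sequence \<epsilon> A) \<and>
     (\<forall>\<pi>. point_choice A \<pi> \<longrightarrow>
       HPol_expansion TYPE('v) TYPE(('m, 'b) inv_system) TYPE('a) (top_of_set X)
         (rips_sequence \<epsilon> A \<pi>)) \<and>
     (\<forall>\<beta>. ball_choice X \<epsilon> A \<beta> \<longrightarrow>
       HPol_expansion TYPE('v) TYPE(('m, 'b) inv_system) TYPE('a set) (top_of_set X)
         (cech_sequence X \<epsilon> A \<beta>)) \<and>
     (\<forall>\<pi>. point_choice A \<pi> \<longrightarrow>
       HPol_expansion TYPE('v) TYPE(('m, 'b) inv_system) TYPE('a) (top_of_set X)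
         (witness_sequence X \<epsilon> A \<pi>)) \<and>
     HPol_expansion TYPE('v) TYPE(('m, 'b) inv_system) TYPE('a set) (top_of_set X)
       (upper_dowker_sequence \<epsilon> A) \<and>
     HPol_expansion TYPE('v) TYPE(('m, 'b) inv_system) TYPE('a set) (top_of_set X)
       (lower_dowker_sequence \<epsilon> A)"
proof -
  interpret approx_sequence X \<epsilon> A by (rule approx_sequence.intro[OF assms])
  have sub: "approx_choice X \<epsilon> A \<pi>" if "point_choice A \<pi>" for \<pi>
    using that by unfold_locales
  \<comment> \<open>The Alexandroff-McCord, Cech and Dowker statements involve no choice of points,
    but their comparison with the ball nerves does; one fixed choice serves them. The Rips and
    witness statements are instantiated at each given \<open>\<pi>\<close>.\<close>
  have "point_choice A (\<lambda>n a. SOME b. b \<in> nearest (A n) a)"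
    using nearest_nonempty by (simp add: point_choice_def some_in_eq)
  then interpret approx_choice X \<epsilon> A "\<lambda>n a. SOME b. b \<in> nearest (A n) a" by (rule sub)
  show ?thesis
    by (intro conjI allI impI alexandroff_mccord_expansion cech_expansion upper_dowker_expansion
        lower_dowker_expansion approx_choice.rips_expansion[OF sub] approx_choice.witness_expansion[OF sub])
qed

end
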